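(* Let $h_0=-d^2/dx^2+V_0(x)$ be a scattering Hamiltonian on the whole real line, with real potential satisfying $$\int_{-\infty}^\infty(1+|x|)\,|V_0(x)|\,dx<\infty,$$ and let $h_1$ be its SUSY partner obtained by a transformation of type (i), (ii) or (iii) with factorization constant $\alpha=-a^2$, $a>0$. Then for $E=\kappa^2\notin\mathrm{spec}\,h_0$ with $E\neq\alpha$ and $\mathrm{Im}\,\kappa=\mathrm{Im}\sqrt{E}>0$, $$\int_{-\infty}^\infty\left[G_0(x,x,E)-G_1(x,x,E)\right]dx=\frac{\delta}{\kappa^2+ia\kappa}-\frac{\delta}{\kappa^2+a^2},$$ where $\delta=1$ in case (i), $\delta=-1$ in case (ii), and $\delta=0$ in case (iii).
   Context: **Green functions.** For $j=0,1$ and $E\notin\mathrm{spec}\,h_j$, $G_j(x,y,E)$ denotes the integral kernel of the resolvent $(h_j-E)^{-1}$ in $L^2(\mathbb R)$. **SUSY partner.** Let $u$ be a real nodeless solution on $\mathbb R$ of $-u''+V_0u=\alpha u$, where the factorization constant $\alpha$ is less than or equal to the ground state energy of $h_0$ if $h_0$ has a discrete spectrum, and lower than the continuum threshold $0$ otherwise. Put $w=(\log u)'=u'/u$, $V_1=V_0-2w'$ and $h_1=-d^2/dx^2+V_1$. The operator $L=-d/dx+w$ satisfies $Lu=0$, $Lh_0=h_1L$, $L^+L=h_0-\alpha$ with $L^+=d/dx+w$. **The three types.** (i) Deleting the ground state of $h_0$: $\alpha=E_0$ is the lowest eigenvalue of $h_0$, $u=\psi_0$ is its ground state eigenfunction,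 $\mathrm{spec}\,h_1=\mathrm{spec}\,h_0\setminus\{E_0\}$. (ii) Creating a new ground state: $\alpha$ lies below $\mathrm{spec}\,h_0$, $1/u$ is (up to normalization) the ground state eigenfunction of $h_1$ at energy $\alpha$, $\mathrm{spec}\,h_1=\mathrm{spec}\,h_0\cup\{\alpha\}$. (iii) Isospectral: $\alpha$ lies below $\mathrm{spec}\,h_0$ and $\mathrm{spec}\,h_1=\mathrm{spec}\,h_0$. The integral is understood as the integral of the difference (the two Green functions need not be separately integrable on the diagonal). *)

theory Defs
  imports "HOL-Analysis.Analysis"
begin

section \<open>The Hilbert space \<open>L\<^sup>2(\<real>)\<close>, by representatives\<close>

definition L2 :: "(real \<Rightarrow> complex) set" where
  "L2 = {f. f \<in> borel_measurable lebesgue \<and> integrable lebesgue (\<lambda>x. (cmod (f x))\<^sup>2)}"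

definition L2norm :: "(real \<Rightarrow> complex) \<Rightarrow> real" where
  "L2norm f = sqrt (LINT x|lebesgue. (cmod (f x))\<^sup>2)"


section \<open>Schroedinger operators with locally integrable potential\<close>

text \<open>
  \<open>f\<close> is locally absolutely continuous and \<open>g\<close> is (a representative of) its almost-everywhere
  derivative. The potentials are merely integrable, so second derivatives are understood in
  this sense; classical differentiability of \<open>f\<close> at every point is not required.
\<close>

definition has_ac_derivative ::
    "(real \<Rightarrow> 'a::euclidean_space) \<Rightarrow> (real \<Rightarrow> 'a) \<Rightarrow> bool" where
  "has_ac_derivative f g \<longleftrightarrow>
     (\<forall>a b. a \<le> b \<longrightarrow>
        g absolutely_integrable_on {a..b} \<and> (g has_integral (f b - f a)) {a..b})"

text \<open>
  The graph of \<open>h = -d\<^sup>2/dx\<^sup>2 + V\<close> with its maximal domain: all \<open>f \<in> L\<^sup>2\<close> with \<open>f\<close> and \<open>f'\<close> locally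
  absolutely continuous and \<open>g = -f'' + V f \<in> L\<^sup>2\<close>. For potentials with finite first moment this
  is the self-adjoint realisation. An element of the domain is represented by its
  continuously differentiable representative \<open>f\<close>, its image by any representative \<open>g\<close>.
\<close>

definition schroedinger ::
    "(real \<Rightarrow> real) \<Rightarrow> ((real \<Rightarrow> complex) \<times> (real \<Rightarrow> complex)) set" where
  "schroedinger V = {(f, g). f \<in> L2 \<and> g \<in> L2 \<and>
     (\<exists>f'. (\<forall>x. (f has_vector_derivative f' x) (at x)) \<and>
           has_ac_derivative f' (\<lambda>x. of_real (V x) * f x - g x))}"

definition eigenfunction :: "(real \<Rightarrow> real) \<Rightarrow> real \<Rightarrow> (real \<Rightarrow> complex) \<Rightarrow> bool" where
  "eigenfunction V \<mu> f \<longleftrightarrow>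
     (\<exists>x. f x \<noteq> 0) \<and> (f, \<lambda>x. of_real \<mu> * f x) \<in> schroedinger V"

definition eigenvalue :: "(real \<Rightarrow> real) \<Rightarrow> real \<Rightarrow> bool" where
  "eigenvalue V \<mu> \<longleftrightarrow> (\<exists>f. eigenfunction V \<mu> f)"

definition ground_state_energy :: "(real \<Rightarrow> real) \<Rightarrow> real \<Rightarrow> bool" where
  "ground_state_energy V \<mu> \<longleftrightarrow> eigenvalue V \<mu> \<and> (\<forall>\<nu>. eigenvalue V \<nu> \<longrightarrow> \<mu> \<le> \<nu>)"

text \<open>
  \<open>z\<close> lies in the resolvent set iff \<open>h - z\<close> is a bijection from the domain of \<open>h\<close> onto \<open>L\<^sup>2\<close> with
  bounded inverse; \<open>(h - z) f = g\<close> is expressed as \<open>h f = g + z f\<close>.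
\<close>

definition spec :: "(real \<Rightarrow> real) \<Rightarrow> complex set" where
  "spec V = - {z.
     (\<forall>g\<in>L2. \<exists>!f. (f, \<lambda>x. g x + z * f x) \<in> schroedinger V) \<and>
     (\<exists>C. \<forall>g\<in>L2. \<forall>f. (f, \<lambda>x. g x + z * f x) \<in> schroedinger V \<longrightarrow> L2norm f \<le> C * L2norm g)}"

definition resolvent ::
    "(real \<Rightarrow> real) \<Rightarrow> complex \<Rightarrow> (real \<Rightarrow> complex) \<Rightarrow> (real \<Rightarrow> complex)" where
  "resolvent V z g = (THE f. (f, \<lambda>x. g x + z * f x) \<in> schroedinger V)"

text \<open>
  The integral kernel of the resolvent, normalised to be jointly continuous: an integral kernel
  is otherwise determined only up to null sets of the plane, so that its values on the
  diagonal would be meaningless.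
\<close>

definition green :: "(real \<Rightarrow> real) \<Rightarrow> real \<Rightarrow> real \<Rightarrow> complex \<Rightarrow> complex" where
  "green V x y z = (THE G :: real \<Rightarrow> real \<Rightarrow> complex.
      continuous_on UNIV (\<lambda>(s, t). G s t) \<and>
      (\<forall>g\<in>L2. \<forall>s. integrable lebesgue (\<lambda>t. G s t * g t) \<and>
                   resolvent V z g s = (LINT t|lebesgue. G s t * g t))) x y"


section \<open>SUSY partners\<close>

definition superpotential :: "(real \<Rightarrow> real) \<Rightarrow> real \<Rightarrow> real" where
  "superpotential u x = deriv u x / u x"

text \<open>
  \<open>u\<close> is a real nodeless solution of \<open>-u'' + V0 u = \<alpha> u\<close> and \<open>V1 = V0 - 2 w'\<close>, where \<open>w = u'/u\<close>.
  As \<open>w'\<close> is determined almost everywhere only, \<open>V1\<close> may be formed with any representative.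
\<close>

definition susy_partner ::
    "(real \<Rightarrow> real) \<Rightarrow> real \<Rightarrow> (real \<Rightarrow> real) \<Rightarrow> (real \<Rightarrow> real) \<Rightarrow> bool" where
  "susy_partner V0 \<alpha> u V1 \<longleftrightarrow>
     (if \<exists>\<mu>. eigenvalue V0 \<mu> then \<exists>\<mu>. ground_state_energy V0 \<mu> \<and> \<alpha> \<le> \<mu> else \<alpha> < 0) \<and>
     (\<forall>x. u differentiable (at x)) \<and>
     has_ac_derivative (deriv u) (\<lambda>x. V0 x * u x - \<alpha> * u x) \<and>
     (\<forall>x. u x \<noteq> 0) \<and>
     (\<exists>w'. has_ac_derivative (superpotential u) w' \<and> V1 = (\<lambda>x. V0 x - 2 * w' x))"

definition below_spec :: "real \<Rightarrow> (real \<Rightarrow> real) \<Rightarrow> bool" where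
  "below_spec \<alpha> V \<longleftrightarrow> (\<forall>\<mu>::real. of_real \<mu> \<in> spec V \<longrightarrow> \<alpha> < \<mu>)"

definition deletes_ground_state ::
    "(real \<Rightarrow> real) \<Rightarrow> real \<Rightarrow> (real \<Rightarrow> real) \<Rightarrow> (real \<Rightarrow> real) \<Rightarrow> bool" where
  "deletes_ground_state V0 \<alpha> u V1 \<longleftrightarrow>
     ground_state_energy V0 \<alpha> \<and> eigenfunction V0 \<alpha> (\<lambda>x. of_real (u x)) \<and>
     spec V1 = spec V0 - {of_real \<alpha>}"

definition creates_ground_state ::
    "(real \<Rightarrow> real) \<Rightarrow> real \<Rightarrow> (real \<Rightarrow> real) \<Rightarrow> (real \<Rightarrow> real) \<Rightarrow> bool" where
  "creates_ground_state V0 \<alpha> u V1 \<longleftrightarrow>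
     below_spec \<alpha> V0 \<and>
     ground_state_energy V1 \<alpha> \<and> eigenfunction V1 \<alpha> (\<lambda>x. of_real (1 / u x)) \<and>
     spec V1 = spec V0 \<union> {of_real \<alpha>}"

definition isospectral ::
    "(real \<Rightarrow> real) \<Rightarrow> real \<Rightarrow> (real \<Rightarrow> real) \<Rightarrow> bool" where
  "isospectral V0 \<alpha> V1 \<longleftrightarrow> below_spec \<alpha> V0 \<and> spec V1 = spec V0"

end

theory Submission
  imports Defs "HOL-Real_Asymp.Real_Asymp"
begin

text \<open>
  Let \<open>f\<^sub>\<plusminus>\<close> be the Jost solutions of \<open>- f'' + V0 f = \<kappa>\<^sup>2 f\<close>, decaying at \<open>\<plusminus>\<infinity>\<close>, and \<open>W\<close> their Wronskian, so that
  \<open>G0(x,x) = - f\<^sub>- f\<^sub>+ / W\<close>. The functions \<open>F\<^sub>\<plusminus> = L f\<^sub>\<plusminus>\<close> solve the equation of \<open>V1\<close>, decay likewise, and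
  have the Wronskian \<open>(\<kappa>\<^sup>2 + a\<^sup>2) W\<close>. Since \<open>(F\<^sub>- f\<^sub>+)' = (\<kappa>\<^sup>2 + a\<^sup>2) f\<^sub>- f\<^sub>+ - F\<^sub>- F\<^sub>+\<close>, the difference
  \<open>G0 - G1\<close> on the diagonal is a total derivative, and its integral is proportional to
  \<open>w(\<infinity>) - w(-\<infinity>)\<close>. Both limits are \<open>a\<close> or \<open>-a\<close>, and their signs are read off from the square
  integrability of \<open>u\<close> (case i), of \<open>1 / u\<close> (case ii), or of neither (case iii).
\<close>

section \<open>Absolutely continuous functions\<close>

text \<open>On the diagonal \<open>fm * fp\<close> tends to the nonzero constant
  \<open>A = W / (2 * \<i> * \<kappa>)\<close> at both ends, so neither Green function is integrable
  there by itself. That their difference is integrable needs more than the convergence of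
  \<open>w\<close>: the essential asymptotic input is the integrability of \<open>a^2 - w^2\<close>
  over the line. The total derivative is that of \<open>H = Fm * fp\<close>, and \<open>H\<close>
  tends to \<open>(w + \<i> * \<kappa>) * A\<close>, with \<open>w\<close> replaced by its limit at
  the respective end. The terms with \<open>\<i> * \<kappa>\<close> cancel in the difference of the
  two limits, and \<open>A\<close> cancels against the \<open>W\<close> in the denominator, so no
  scattering data survive. No scattering theory for \<open>V1\<close> is developed. Its solutions
  are \<open>L f\<close>, and their bounds come from those of \<open>f\<close>, \<open>f'\<close>
  and the boundedness of \<open>w\<close>. The potential is merely integrable. Hence
  \<open>u''\<close> and \<open>w'\<close> exist only almost everywhere, the Riccati equation
  \<open>w' = V0 + a^2 - w^2\<close> holds only almost everywhere, and a calculus of locally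
  absolutely continuous functions takes the place of pointwise differentiation.\<close>

lemma has_ac_derivative_absolutely_integrable:
  "has_ac_derivative f g \<Longrightarrow> g absolutely_integrable_on {a..b}"
  by (cases "a \<le> b") (auto simp: has_ac_derivative_def)

lemma has_ac_derivative_integrable:
  "has_ac_derivative f g \<Longrightarrow> g integrable_on {a..b}"
  using has_ac_derivative_absolutely_integrable set_lebesgue_integral_eq_integral(1) by blast

lemma has_ac_derivative_integral:
  "has_ac_derivative f g \<Longrightarrow> a \<le> b \<Longrightarrow> integral {a..b} g = f b - f a"
  by (auto simp: has_ac_derivative_def integral_unique)

lemma has_ac_derivativeI:
  assumes "\<And>a b. g absolutely_integrable_on {a..b}"
    and "\<And>a b. a \<le> b \<Longrightarrow> integral {a..b} g = f b - f a"
  shows "has_ac_derivative f g"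
  unfolding has_ac_derivative_def
  using assms by (metis has_integral_iff set_lebesgue_integral_eq_integral(1))

text \<open>The error \<open>f z - f y - integral {y..z} g\<close> is additive over adjacent
  intervals, and so is the bound. Bisection therefore carries the estimate from short intervals
  around each point to \<open>{a..b}\<close> with the same \<open>e\<close>, and \<open>e\<close> is
  arbitrary. The product rule is obtained from this criterion.\<close>

lemma has_ac_derivative_local:
  fixes f g :: "real \<Rightarrow> 'a::euclidean_space" and h :: "real \<Rightarrow> real"
  assumes g: "\<And>a b. g absolutely_integrable_on {a..b}"
    and h: "\<And>a b. h absolutely_integrable_on {a..b}"
    and loc: "\<And>x e. e > 0 \<Longrightarrow> \<exists>d>0. \<forall>y z. y \<le> x \<and> x \<le> z \<and> z - y < d \<longrightarrow>
                norm (f z - f y - integral {y..z} g) \<le> e * integral {y..z} h"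
  shows "has_ac_derivative f g"
proof (rule has_ac_derivativeI[OF g])
  have gi: "g integrable_on {a..b}" and hi: "h integrable_on {a..b}" for a b
    using g h set_lebesgue_integral_eq_integral(1) by blast+
  fix a b :: real assume "a \<le> b"
  have *: "norm (f b - f a - integral {a..b} g) \<le> e * integral {a..b} h" if "e > 0" for e
    using \<open>a \<le> b\<close>
  proof (induction rule: Bolzano)
    case (trans a b c)
    have 1: "integral {a..c} g = integral {a..b} g + integral {b..c} g"
      using trans gi by (simp add: Henstock_Kurzweil_Integration.integral_combine)
    have 2: "integral {a..c} h = integral {a..b} h + integral {b..c} h"
      using trans hi by (simp add: Henstock_Kurzweil_Integration.integral_combine)
    have "f c - f a - integral {a..c} g
        = (f b - f a - integral {a..b} g) + (f c - f b - integral {b..c} g)"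
      by (simp add: 1)
    then have "norm (f c - f a - integral {a..c} g)
        \<le> norm (f b - f a - integral {a..b} g) + norm (f c - f b - integral {b..c} g)"
      by (metis norm_triangle_ineq)
    with trans(1,2) show ?case
      by (simp add: 2 distrib_left)
  next
    case (local x)
    then show ?case using loc[OF that] by blast
  qed
  define n where "n = norm (f b - f a - integral {a..b} g)"
  \<comment> \<open>The added 1 makes \<open>H\<close> positive, so that
    \<open>e = n / (2 * H)\<close> is admissible and bounds \<open>n\<close> by
    \<open>n / 2\<close>.\<close>
  define H where "H = \<bar>integral {a..b} h\<bar> + 1"
  have "H > 0" by (simp add: H_def add_nonneg_pos)
  have "n \<le> 0"
  proof (rule ccontr)
    assume n: "\<not> n \<le> 0"
    then have "n \<le> n / (2 * H) * integral {a..b} h"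
      using *[of "n / (2 * H)"] \<open>H > 0\<close> by (simp add: n_def)
    also have "\<dots> \<le> n / (2 * H) * H"
      using n \<open>H > 0\<close> by (intro mult_left_mono) (auto simp: H_def)
    also have "\<dots> = n / 2" using \<open>H > 0\<close> by simp
    finally show False using n by simp
  qed
  then show "integral {a..b} g = f b - f a"
    by (simp add: n_def)
qed

section \<open>Continuity, and uniqueness of the derivative up to null sets\<close>

lemma has_ac_derivative_continuous:
  assumes "has_ac_derivative f g"
  shows "isCont f x"
proof -
  have "continuous_on {x-1..x+1} (\<lambda>y. integral {x-1..y} g)"
    by (rule indefinite_integral_continuous_1[OF has_ac_derivative_integrable[OF assms]])
  then have "continuous_on {x-1..x+1} (\<lambda>y. integral {x-1..y} g + f (x-1))"
    by (intro continuous_intros)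
  also have "?this \<longleftrightarrow> continuous_on {x-1..x+1} f"
    by (rule continuous_on_cong) (auto simp: has_ac_derivative_integral[OF assms])
  finally show ?thesis
    by (rule continuous_on_interior) auto
qed

lemma has_ac_derivative_continuous_on:
  "has_ac_derivative f g \<Longrightarrow> continuous_on S f"
  by (simp add: continuous_at_imp_continuous_on has_ac_derivative_continuous)

lemma has_ac_derivative_AE:
  assumes f: "has_ac_derivative f g" and ae: "AE x in lebesgue. g x = g' x"
  shows "has_ac_derivative f g'"
proof -
  obtain N where N: "negligible N" "\<And>x. x \<notin> N \<Longrightarrow> g x = g' x"
    using ae by (auto simp: eventually_ae_filter_negligible)
  show ?thesis
  proof (rule has_ac_derivativeI)
    show "g' absolutely_integrable_on {a..b}" for a b
      by (rule absolutely_integrable_spike[OF has_ac_derivative_absolutely_integrable[OF f] N(1)])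
         (use N in auto)
    show "integral {a..b} g' = f b - f a" if "a \<le> b" for a b
      using has_ac_derivative_integral[OF f that] integral_spike[OF N(1), of "{a..b}" g g'] N(2)
      by auto
  qed
qed

text \<open>Lebesgue differentiation: off a null set \<open>d x\<close> is the limit of the averages
  of \<open>d\<close> over short intervals to the right of \<open>x\<close>, and all these averages
  are 0.\<close>

lemma has_ac_derivative_zero_AE:
  fixes d :: "real \<Rightarrow> 'a::euclidean_space"
  assumes "has_ac_derivative (\<lambda>x. 0) d"
  shows "AE x in lebesgue. d x = 0"
proof -
  have "d integrable_on cbox a b" for a b
    using has_ac_derivative_integrable[OF assms] by simp
  then obtain N where N: "negligible N"
    and k: "\<And>x e. \<lbrakk>x \<notin> N; 0 < e\<rbrakk> \<Longrightarrow> \<exists>r>0. \<forall>h. 0 < h \<and> h < r \<longrightarrow>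
                  norm (integral (cbox x (x + h *\<^sub>R One)) d /\<^sub>R h ^ DIM(real) - d x) < e"
    using integrable_ccontinuous_explicit[of d] by blast
  have "d x = 0" if xN: "x \<notin> N" for x
  proof (rule ccontr)
    assume "d x \<noteq> 0"
    then obtain r where "r > 0" and r: "\<And>h. 0 < h \<and> h < r \<Longrightarrow>
        norm (integral (cbox x (x + h *\<^sub>R One)) d /\<^sub>R h ^ DIM(real) - d x) < norm (d x)"
      using k[OF xN, of "norm (d x)"] by auto
    have "integral {x..x + r/2} d = 0"
      using has_ac_derivative_integral[OF assms, of x "x + r/2"] \<open>r > 0\<close> by simp
    then show False using r[of "r/2"] \<open>r > 0\<close> by simp
  qed
  then show ?thesis
    using N by (auto simp: eventually_ae_filter_negligible)
qed

lemma has_ac_derivative_add: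
  assumes "has_ac_derivative f f'" "has_ac_derivative g g'"
  shows "has_ac_derivative (\<lambda>x. f x + g x) (\<lambda>x. f' x + g' x)"
  using assms unfolding has_ac_derivative_def
  by (auto intro!: set_integral_add(1) simp: add_diff_add intro: has_integral_add)

lemma has_ac_derivative_linear:
  assumes f: "has_ac_derivative f f'" and h: "bounded_linear h"
  shows "has_ac_derivative (\<lambda>x. h (f x)) (\<lambda>x. h (f' x))"
proof -
  interpret h: bounded_linear h by fact
  show ?thesis
    using f absolutely_integrable_linear[OF _ h] has_integral_linear[OF _ h]
    unfolding has_ac_derivative_def o_def h.diff[symmetric] by blast
qed

lemma has_ac_derivative_minus:
  "has_ac_derivative f f' \<Longrightarrow> has_ac_derivative (\<lambda>x. - f x) (\<lambda>x. - f' x)"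
  by (rule has_ac_derivative_linear[where h=uminus]) (simp_all add: bounded_linear_minus bounded_linear_ident)

lemma has_ac_derivative_diff:
  assumes "has_ac_derivative f f'" "has_ac_derivative g g'"
  shows "has_ac_derivative (\<lambda>x. f x - g x) (\<lambda>x. f' x - g' x)"
  using has_ac_derivative_add[OF assms(1) has_ac_derivative_minus[OF assms(2)]] by simp

lemma has_ac_derivative_unique_AE:
  assumes "has_ac_derivative f g" "has_ac_derivative f g'"
  shows "AE x in lebesgue. g x = g' x"
  using has_ac_derivative_zero_AE[of "\<lambda>x. g x - g' x"] has_ac_derivative_diff[OF assms] by simp

lemma has_ac_derivative_of_vector_derivative:
  fixes f :: "real \<Rightarrow> 'a::euclidean_space"
  assumes "\<And>x. (f has_vector_derivative f' x) (at x)" "\<And>x. isCont f' x"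
  shows "has_ac_derivative f f'"
  unfolding has_ac_derivative_def
proof (intro allI impI conjI)
  fix a b :: real assume "a \<le> b"
  show "f' absolutely_integrable_on {a..b}"
    using assms(2) continuous_at_imp_continuous_on by (intro absolutely_integrable_continuous_real) blast
  show "(f' has_integral f b - f a) {a..b}"
    using \<open>a \<le> b\<close> assms(1) by (intro fundamental_theorem_of_calculus) (auto intro: has_vector_derivative_at_within)
qed

lemma has_ac_derivative_const: "has_ac_derivative (\<lambda>x. c) (\<lambda>x. 0)"
  by (rule has_ac_derivative_of_vector_derivative) auto

lemma has_ac_derivative_imp_vector_derivative:
  assumes f: "has_ac_derivative f f'" and c: "\<And>x. isCont f' x"
  shows "(f has_vector_derivative f' x) (at x)"
proof -
  have "((\<lambda>y. integral {x-1..y} f') has_vector_derivative f' x) (at x within {x-1..x+1})"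
    using c continuous_at_imp_continuous_on by (intro integral_has_vector_derivative) auto
  then have "((\<lambda>y. integral {x-1..y} f' + f (x-1)) has_vector_derivative f' x) (at x within {x-1..x+1})"
    by (intro derivative_eq_intros | simp)+
  then have "(f has_vector_derivative f' x) (at x within {x-1..x+1})"
    by (rule has_vector_derivative_transform[rotated 2])
       (auto simp: has_ac_derivative_integral[OF f])
  then show ?thesis
    by (simp add: at_within_Icc_at)
qed

lemma has_ac_derivative_reflect:
  assumes "has_ac_derivative f f'"
  shows "has_ac_derivative (\<lambda>x. f (- x)) (\<lambda>x. - f' (- x))"
proof -
  have "has_ac_derivative (\<lambda>x. - f (- x)) (\<lambda>x. f' (- x))"
  proof (rule has_ac_derivativeI)
    show "(\<lambda>x. f' (- x)) absolutely_integrable_on {a..b}" for a b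
      using has_ac_derivative_absolutely_integrable[OF assms, of "-b" "-a"]
        absolutely_integrable_reflect_real[where f=f' and a="-b" and b="-a"] by simp
    show "integral {a..b} (\<lambda>x. f' (- x)) = - f (- b) - - f (- a)" if "a \<le> b" for a b
      using has_ac_derivative_integral[OF assms, of "-b" "-a"] that
        Henstock_Kurzweil_Integration.integral_reflect_real[where a="-b" and b="-a" and f=f'] by simp
  qed
  from has_ac_derivative_minus[OF this] show ?thesis by simp
qed

lemma absolutely_integrable_continuous_mult:
  fixes f g :: "real \<Rightarrow> 'a::{euclidean_space, real_normed_algebra}"
  assumes "continuous_on {a..b} f" "g absolutely_integrable_on {a..b}"
  shows "(\<lambda>x. f x * g x) absolutely_integrable_on {a..b}"
    and "(\<lambda>x. g x * f x) absolutely_integrable_on {a..b}"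
proof -
  have bil: "bilinear (\<lambda>x y::'a. x * y)" "bilinear (\<lambda>x y::'a. y * x)"
    using bounded_bilinear_mult bounded_bilinear.flip
    by (auto simp: bilinear_conv_bounded_bilinear)
  have f: "f \<in> borel_measurable (lebesgue_on {a..b})" "bounded (f ` {a..b})"
    using assms(1) by (auto simp: continuous_imp_measurable_on_sets_lebesgue compact_continuous_image
      intro: compact_imp_bounded)
  show "(\<lambda>x. f x * g x) absolutely_integrable_on {a..b}"
    using absolutely_integrable_bounded_measurable_product[OF bil(1) f(1) _ f(2) assms(2)] by simp
  show "(\<lambda>x. g x * f x) absolutely_integrable_on {a..b}"
    using absolutely_integrable_bounded_measurable_product[OF bil(2) f(1) _ f(2) assms(2)] by simp
qed

text \<open>Near a point, \<open>f z * g z - f y * g y\<close> is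
  \<open>(f z - f y) * g z + f y * (g z - g y)\<close>. Freezing \<open>g\<close> at
  \<open>z\<close> and \<open>f\<close> at \<open>y\<close> inside the integral changes the
  integrand by at most \<open>e * (norm f' + norm g')\<close>, by continuity of \<open>f\<close> and
  \<open>g\<close>; this is the error that the local criterion tolerates.\<close>

lemma has_ac_derivative_mult:
  fixes f g :: "real \<Rightarrow> 'a::{euclidean_space, real_normed_field}"
  assumes f: "has_ac_derivative f f'" and g: "has_ac_derivative g g'"
  shows "has_ac_derivative (\<lambda>x. f x * g x) (\<lambda>x. f' x * g x + f x * g' x)"
proof (rule has_ac_derivative_local)
  note cf = has_ac_derivative_continuous_on[OF f]
  note cg = has_ac_derivative_continuous_on[OF g]
  note af = has_ac_derivative_absolutely_integrable[OF f]
  note ag = has_ac_derivative_absolutely_integrable[OF g]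
  show prod: "(\<lambda>x. f' x * g x + f x * g' x) absolutely_integrable_on {a..b}" for a b
    using cf cg af ag by (intro set_integral_add absolutely_integrable_continuous_mult)
  show nrm: "(\<lambda>x. norm (f' x) + norm (g' x)) absolutely_integrable_on {a..b}" for a b
    using af ag by (intro set_integral_add absolutely_integrable_norm[unfolded o_def])
  fix x e :: real assume "e > 0"
  obtain d1 where "d1 > 0" and d1: "\<And>y. \<bar>y - x\<bar> < d1 \<Longrightarrow> norm (f y - f x) < e/2"
    using has_ac_derivative_continuous[OF f, of x] \<open>e > 0\<close> unfolding continuous_at_eps_delta
    by (metis half_gt_zero dist_norm real_norm_def)
  obtain d2 where "d2 > 0" and d2: "\<And>y. \<bar>y - x\<bar> < d2 \<Longrightarrow> norm (g y - g x) < e/2"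
    using has_ac_derivative_continuous[OF g, of x] \<open>e > 0\<close> unfolding continuous_at_eps_delta
    by (metis half_gt_zero dist_norm real_norm_def)
  show "\<exists>d>0. \<forall>y z. y \<le> x \<and> x \<le> z \<and> z - y < d \<longrightarrow>
      norm (f z * g z - f y * g y - integral {y..z} (\<lambda>x. f' x * g x + f x * g' x))
      \<le> e * integral {y..z} (\<lambda>x. norm (f' x) + norm (g' x))"
  proof (intro exI[of _ "min d1 d2"] conjI allI impI)
    show "min d1 d2 > 0" using \<open>d1 > 0\<close> \<open>d2 > 0\<close> by simp
    fix y z assume yz: "y \<le> x \<and> x \<le> z \<and> z - y < min d1 d2"
    have close: "norm (f y - f t) \<le> e" "norm (g z - g t) \<le> e" if "t \<in> {y..z}" for t
    proof -
      have "norm (f y - f t) \<le> norm (f y - f x) + norm (f t - f x)"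
        using norm_triangle_ineq4[of "f y - f x" "f t - f x"] by simp
      then show "norm (f y - f t) \<le> e" using d1[of y] d1[of t] that yz by fastforce
      have "norm (g z - g t) \<le> norm (g z - g x) + norm (g t - g x)"
        using norm_triangle_ineq4[of "g z - g x" "g t - g x"] by simp
      then show "norm (g z - g t) \<le> e" using d2[of z] d2[of t] that yz by fastforce
    qed
    have If: "(f' has_integral f z - f y) {y..z}" and Ig: "(g' has_integral g z - g y) {y..z}"
      using f g yz by (auto simp: has_ac_derivative_def)
    have I: "((\<lambda>t. f' t * g t + f t * g' t) has_integral integral {y..z} (\<lambda>x. f' x * g x + f x * g' x)) {y..z}"
      using prod set_lebesgue_integral_eq_integral(1) by blast
    have J: "((\<lambda>t. f' t * (g z - g t) + (f y - f t) * g' t) has_integral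
        (f z * g z - f y * g y - integral {y..z} (\<lambda>x. f' x * g x + f x * g' x))) {y..z}"
      using has_integral_diff[OF has_integral_add[OF has_integral_mult_left[OF If, of "g z"]
          has_integral_mult_right[OF Ig, of "f y"]] I]
      by (simp add: algebra_simps)
    have K: "((\<lambda>t. e * (norm (f' t) + norm (g' t))) has_integral
        e * integral {y..z} (\<lambda>x. norm (f' x) + norm (g' x))) {y..z}"
      using nrm set_lebesgue_integral_eq_integral(1) by (intro has_integral_mult_right) blast
    have "norm (f' t * (g z - g t) + (f y - f t) * g' t) \<le> e * (norm (f' t) + norm (g' t))"
      if "t \<in> {y..z}" for t
    proof -
      have "norm (f' t * (g z - g t) + (f y - f t) * g' t)
          \<le> norm (f' t) * norm (g z - g t) + norm (f y - f t) * norm (g' t)"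
        by (metis norm_mult norm_triangle_ineq)
      also have "\<dots> \<le> norm (f' t) * e + e * norm (g' t)"
        using close[OF that] by (intro add_mono mult_left_mono mult_right_mono) auto
      finally show ?thesis by (simp add: algebra_simps)
    qed
    then show "norm (f z * g z - f y * g y - integral {y..z} (\<lambda>x. f' x * g x + f x * g' x))
      \<le> e * integral {y..z} (\<lambda>x. norm (f' x) + norm (g' x))"
      using integral_norm_bound_integral[of "\<lambda>t. f' t * (g z - g t) + (f y - f t) * g' t" "{y..z}"
         "\<lambda>t. e * (norm (f' t) + norm (g' t))"] J K
      by (metis (no_types, lifting) has_integral_integrable integral_unique)
  qed
qed


section \<open>Integrals over half-lines\<close>

lemma absolutely_integrable_UNIV_iff: "f absolutely_integrable_on UNIV \<longleftrightarrow> integrable lebesgue f"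
  by (simp add: set_integrable_def)

lemma integrable_imp_absolutely_integrable:
  "integrable lebesgue f \<Longrightarrow> S \<in> sets lebesgue \<Longrightarrow> f absolutely_integrable_on S"
  unfolding set_integrable_def by (rule integrable_mult_indicator)

lemma absolutely_integrable_subset_Ici:
  fixes f :: "real \<Rightarrow> 'a::euclidean_space"
  shows "f absolutely_integrable_on {a..} \<Longrightarrow> a \<le> b \<Longrightarrow> f absolutely_integrable_on {b..}"
  by (rule set_integrable_subset) auto

lemma integral_Ici_split:
  fixes f :: "real \<Rightarrow> 'a::euclidean_space"
  assumes "f absolutely_integrable_on {a..}" "a \<le> b"
  shows "integral {a..} f = integral {a..b} f + integral {b..} f"
proof -
  have "{a..} = {a..b} \<union> {b..}" using assms(2) by auto
  moreover have "{a..b} \<inter> {b..} = {b}" using assms(2) by auto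
  moreover have "f integrable_on {a..b}" "f integrable_on {b..}"
    using absolutely_integrable_subset_Ici[OF assms] absolutely_integrable_on_subinterval[OF assms(1), of a b]
    by (auto intro: set_lebesgue_integral_eq_integral(1))
  ultimately show ?thesis
    by (simp add: integral_Un)
qed

lemma has_ac_derivative_tail_integral:
  fixes p :: "real \<Rightarrow> 'a::euclidean_space"
  assumes p: "\<And>s. p absolutely_integrable_on {s..}"
  shows "has_ac_derivative (\<lambda>s. integral {s..} p) (\<lambda>s. - p s)"
proof -
  have "has_ac_derivative (\<lambda>s. - integral {s..} p) p"
  proof (rule has_ac_derivativeI)
    show "p absolutely_integrable_on {a..b}" for a b
      using p[of a] by (rule absolutely_integrable_on_subinterval) auto
    show "integral {a..b} p = - integral {b..} p - - integral {a..} p" if "a \<le> b" for a b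
      using integral_Ici_split[OF p that] by simp
  qed
  from has_ac_derivative_minus[OF this] show ?thesis by simp
qed

lemma tail_integral_tendsto_0:
  fixes p :: "real \<Rightarrow> 'a::euclidean_space"
  assumes p: "p absolutely_integrable_on {a..}"
  shows "((\<lambda>s. integral {s..} p) \<longlongrightarrow> 0) at_top"
proof -
  have "((\<lambda>s. LINT y:{a..s}|lebesgue. p y) \<longlongrightarrow> (LINT y:{a..}|lebesgue. p y)) at_top"
    using p by (intro tendsto_set_lebesgue_integral_at_top) auto
  then have "((\<lambda>s. (LINT y:{a..}|lebesgue. p y) - (LINT y:{a..s}|lebesgue. p y)) \<longlongrightarrow> 0) at_top"
    by (auto intro: tendsto_eq_intros)
  then show ?thesis
  proof (rule Lim_transform_eventually)
    show "\<forall>\<^sub>F s in at_top. (LINT y:{a..}|lebesgue. p y) - (LINT y:{a..s}|lebesgue. p y) = integral {s..} p"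
      using eventually_ge_at_top[of a]
    proof eventually_elim
      case (elim s)
      have "p absolutely_integrable_on {a..s}"
        using p by (rule absolutely_integrable_on_subinterval) auto
      then show ?case
        using integral_Ici_split[OF p elim] p
        by (simp add: set_lebesgue_integral_eq_integral(2))
    qed
  qed
qed

lemma ac_tendsto_at_top:
  assumes f: "has_ac_derivative f g" and g: "g absolutely_integrable_on {a..}"
  shows "\<exists>L. (f \<longlongrightarrow> L) at_top"
proof -
  have "((\<lambda>s. f a + integral {a..} g - integral {s..} g) \<longlongrightarrow> f a + integral {a..} g - 0) at_top"
    by (intro tendsto_intros tail_integral_tendsto_0[OF g])
  then have "(f \<longlongrightarrow> f a + integral {a..} g - 0) at_top"
  proof (rule Lim_transform_eventually)
    show "\<forall>\<^sub>F s in at_top. f a + integral {a..} g - integral {s..} g = f s"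
      using eventually_ge_at_top[of a]
      by eventually_elim (use integral_Ici_split[OF g] has_ac_derivative_integral[OF f] in auto)
  qed
  then show ?thesis by blast
qed

lemma ac_eq_limit_minus_tail:
  assumes f: "has_ac_derivative f g" and g: "g absolutely_integrable_on {x..}"
    and L: "(f \<longlongrightarrow> L) at_top"
  shows "f x = L - integral {x..} g"
proof -
  have "((\<lambda>s. f x + integral {x..} g - integral {s..} g) \<longlongrightarrow> f x + integral {x..} g - 0) at_top"
    by (intro tendsto_intros tail_integral_tendsto_0[OF g])
  then have "(f \<longlongrightarrow> f x + integral {x..} g - 0) at_top"
  proof (rule Lim_transform_eventually)
    show "\<forall>\<^sub>F s in at_top. f x + integral {x..} g - integral {s..} g = f s"
      using eventually_ge_at_top[of x]
      by eventually_elim (use integral_Ici_split[OF g] has_ac_derivative_integral[OF f] in auto)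
  qed
  from tendsto_unique[OF _ this L] show ?thesis by (simp add: eq_diff_eq)
qed

lemma integrable_lebesgue_reflect:
  fixes f :: "real \<Rightarrow> 'a::euclidean_space"
  shows "integrable lebesgue (\<lambda>x. f (- x)) \<longleftrightarrow> integrable lebesgue f"
    and "(LINT x|lebesgue. f (- x)) = (LINT x|lebesgue. f x)"
  using lebesgue_integrable_real_affine_iff[of "-1" f 0] lebesgue_integral_real_affine[of "-1" f 0]
  by auto

lemma tendsto_at_bot_reflect:
  fixes f :: "real \<Rightarrow> 'a::topological_space"
  shows "(f \<longlongrightarrow> L) at_bot \<longleftrightarrow> ((\<lambda>x. f (- x)) \<longlongrightarrow> L) at_top"
  by (simp add: filterlim_at_bot_mirror)

text \<open>The fundamental theorem of calculus on the whole line. The line is cut at 0, and the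
  left half is reflected onto the right one.\<close>

lemma integral_ac_derivative:
  assumes f: "has_ac_derivative f g" and g: "integrable lebesgue g"
    and L: "(f \<longlongrightarrow> L) at_top" and M: "(f \<longlongrightarrow> M) at_bot"
  shows "(LINT x|lebesgue. g x) = L - M"
proof -
  have 1: "f 0 = L - integral {0..} g"
    using g by (intro ac_eq_limit_minus_tail[OF f _ L] integrable_imp_absolutely_integrable) auto
  have g': "integrable lebesgue (\<lambda>x. - g (- x))"
    using g integrable_lebesgue_reflect(1)[of g] by simp
  have "f (- 0) = M - integral {0..} (\<lambda>x. - g (- x))"
    using g' M
    by (intro ac_eq_limit_minus_tail[OF has_ac_derivative_reflect[OF f]] integrable_imp_absolutely_integrable)
       (auto simp: tendsto_at_bot_reflect)
  then have 2: "f 0 = M + integral {0..} (\<lambda>x. g (- x))" by simp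
  have ag: "g absolutely_integrable_on S" "(\<lambda>x. g (- x)) absolutely_integrable_on S"
    if "S \<in> sets lebesgue" for S
    using g integrable_lebesgue_reflect(1)[of g] that by (auto intro: integrable_imp_absolutely_integrable)
  have "integral {0..} (\<lambda>x. g (- x)) = (LINT x|lebesgue. indicator {0..} x *\<^sub>R g (- x))"
    using set_lebesgue_integral_eq_integral(2)[OF ag(2), of "{0..}"]
    by (simp add: set_lebesgue_integral_def)
  also have "\<dots> = (LINT x|lebesgue. indicator {0..} (- x) *\<^sub>R g x)"
    using integrable_lebesgue_reflect(2)[of "\<lambda>x. indicator {0..} (- x) *\<^sub>R g x"] by simp
  also have "\<dots> = (LINT x|lebesgue. indicator {..0} x *\<^sub>R g x)"
    by (intro Bochner_Integration.integral_cong) (auto simp: indicator_def)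
  also have "\<dots> = integral {..0} g"
    using set_lebesgue_integral_eq_integral(2)[OF ag(1), of "{..0}"]
    by (simp add: set_lebesgue_integral_def)
  finally have 3: "f 0 = M + integral {..0} g" using 2 by simp
  have "(LINT x|lebesgue. g x) = integral UNIV g"
    using integral_lebesgue[OF g] by simp
  also have "UNIV = {..0} \<union> {0::real..}" by auto
  also have "integral ({..0} \<union> {0..}) g = integral {..0} g + integral {0..} g"
  proof (rule integral_Un)
    have "{..0} \<inter> {0::real..} = {0}" by auto
    then show "negligible ({..0} \<inter> {0::real..})" by simp
  qed (auto intro!: set_lebesgue_integral_eq_integral(1) ag(1))
  also have "integral {..0} g = f 0 - M" using 3 by simp
  also have "integral {0..} g = L - f 0" using 1 by simp
  finally show ?thesis by simp
qed

text \<open>The tail integrals of \<open>norm f\<close> tend to 0, whereas a far window of length 1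
  alone would contribute at least \<open>c\<close>.\<close>

lemma integrable_not_eventually_ge:
  fixes f :: "real \<Rightarrow> 'a::euclidean_space"
  assumes f: "integrable lebesgue f" and ev: "\<forall>\<^sub>F x in at_top. c \<le> norm (f x)"
  shows "c \<le> 0"
proof (rule ccontr)
  assume c: "\<not> c \<le> 0"
  obtain X where X: "\<And>x. x \<ge> X \<Longrightarrow> c \<le> norm (f x)"
    using ev by (auto simp: eventually_at_top_linorder)
  have nf: "integrable lebesgue (\<lambda>x. norm (f x))" using f by simp
  have "((\<lambda>s. integral {s..} (\<lambda>x. norm (f x))) \<longlongrightarrow> 0) at_top"
    by (rule tail_integral_tendsto_0[where a=0], rule integrable_imp_absolutely_integrable[OF nf]) auto
  then have "\<forall>\<^sub>F s in at_top. integral {s..} (\<lambda>x. norm (f x)) < c"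
    by (rule order_tendstoD) (use c in auto)
  then obtain s where s: "s \<ge> X" "integral {s..} (\<lambda>x. norm (f x)) < c"
    using eventually_happens[OF eventually_conj[OF _ eventually_ge_at_top[of X]]] by auto
  have i: "(\<lambda>x. norm (f x)) absolutely_integrable_on S" if "S \<in> sets lebesgue" for S
    using nf that by (rule integrable_imp_absolutely_integrable)
  have "c = integral {s..s+1} (\<lambda>x. c)" by simp
  also have "\<dots> \<le> integral {s..s+1} (\<lambda>x. norm (f x))"
    using i[of "{s..s+1}"] X s(1) set_lebesgue_integral_eq_integral(1)
    by (intro integral_le) auto
  also have "\<dots> \<le> integral {s..} (\<lambda>x. norm (f x))"
    using i[of "{s..s+1}"] i[of "{s..}"] set_lebesgue_integral_eq_integral(1)
    by (intro integral_subset_le) auto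
  finally show False using s by simp
qed

lemma integrable_limit_0:
  fixes f :: "real \<Rightarrow> 'a::euclidean_space"
  assumes f: "integrable lebesgue f" and L: "(f \<longlongrightarrow> L) at_top"
  shows "L = 0"
proof (rule ccontr)
  assume "L \<noteq> 0"
  have "((\<lambda>x. norm (f x)) \<longlongrightarrow> norm L) at_top" by (intro tendsto_intros L)
  then have "\<forall>\<^sub>F x in at_top. norm L / 2 < norm (f x)"
    by (rule order_tendstoD) (use \<open>L \<noteq> 0\<close> in auto)
  then have "\<forall>\<^sub>F x in at_top. norm L / 2 \<le> norm (f x)"
    by eventually_elim simp
  from integrable_not_eventually_ge[OF f this] \<open>L \<noteq> 0\<close> show False by simp
qed

section \<open>Two-sided exponential kernels\<close>

lemma integrable_exp_minus_abs:
  assumes "e > (0::real)"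
  shows "integrable lborel (\<lambda>x. exp (- (e * \<bar>x\<bar>)))"
proof -
  have "(\<lambda>x. exp (- (e * \<bar>x\<bar>))) absolutely_integrable_on {0..}"
  proof (rule nonnegative_absolutely_integrable_1)
    show "(\<lambda>x. exp (- (e * \<bar>x\<bar>))) integrable_on {0..}"
      using integrable_on_exp_minus_to_infinity[OF assms, of 0]
      by (rule integrable_eq) auto
  qed auto
  then have "integrable lborel (\<lambda>x. indicator {0..} x *\<^sub>R exp (- (e * \<bar>x\<bar>)))"
    unfolding set_integrable_def by (subst (asm) integrable_completion) auto
  then have "has_bochner_integral lborel (\<lambda>x. indicator {0..} x *\<^sub>R exp (- (e * \<bar>x\<bar>)))
      (LINT x|lborel. indicator {0..} x *\<^sub>R exp (- (e * \<bar>x\<bar>)))"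
    by (rule has_bochner_integral_integrable)
  from has_bochner_integral_even_function[OF this] show ?thesis
    by (simp add: has_bochner_integral_iff)
qed

text \<open>Fubini, integrating first over \<open>s\<close>: by translation invariance the kernel
  has the same integral \<open>K\<close> for every \<open>t\<close>, so the iterated integral of the
  modulus is \<open>K\<close> times the integral of \<open>norm p\<close>.\<close>

lemma integrable_exp_convolution:
  fixes p :: "real \<Rightarrow> real"
  assumes e: "e > 0" and p: "integrable lebesgue p"
  shows "integrable lebesgue (\<lambda>s. LINT t|lebesgue. exp (- (e * \<bar>s - t\<bar>)) * p t)"
proof -
  have p_leb: "p \<in> borel_measurable lebesgue" using p by (rule borel_measurable_integrable)
  \<comment> \<open>Fubini is applied to the product of Borel measures, so the Lebesgue measurable
    \<open>p\<close> is first replaced by a Borel function equal to it almost everywhere.\<close>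
  then obtain q where q: "q \<in> borel_measurable lborel" and pq0: "AE x in lborel. p x = q x"
    using completion_ex_borel_measurable_real[of p lborel] by blast
  have pq: "AE x in lebesgue. p x = q x"
    using pq0 by (rule AE_completion)
  have [measurable]: "q \<in> borel_measurable borel" using q by simp
  have q_leb: "q \<in> borel_measurable lebesgue" using q by (rule measurable_completion)
  have "integrable lebesgue q"
    using integrable_cong_AE[OF p_leb q_leb pq] p by simp
  then have qi: "integrable lborel q"
    using integrable_completion[OF q] by simp
  define k where "k = (\<lambda>s t::real. exp (- (e * \<bar>s - t\<bar>)))"
  have k[measurable]: "(\<lambda>(s,t). k s t) \<in> borel_measurable (lborel \<Otimes>\<^sub>M lborel)"
    by (simp add: k_def)
  have kq: "(LINT t|lebesgue. k s t * p t) = (LINT t|lborel. k s t * q t)" for s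
  proof -
    have "(LINT t|lebesgue. k s t * p t) = (LINT t|lebesgue. k s t * q t)"
    proof (rule integral_cong_AE)
      show "AE t in lebesgue. k s t * p t = k s t * q t" using pq by auto
      have [measurable]: "(\<lambda>t. k s t) \<in> borel_measurable lebesgue"
        unfolding k_def by (intro measurable_completion) auto
      show "(\<lambda>t. k s t * p t) \<in> borel_measurable lebesgue"
        and "(\<lambda>t. k s t * q t) \<in> borel_measurable lebesgue"
        using p_leb q_leb by (auto intro!: borel_measurable_times)
    qed
    also have "\<dots> = (LINT t|lborel. k s t * q t)"
      unfolding k_def by (rule integral_completion) measurable
    finally show ?thesis .
  qed
  define K where "K = (LINT x|lborel. exp (- (e * \<bar>x\<bar>)))"
  have ki: "integrable lborel (\<lambda>s. k s t)" and kK: "(LINT s|lborel. k s t) = K" for t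
    using lborel_integrable_real_affine[OF integrable_exp_minus_abs[OF e], of 1 "-t"]
      lborel_integral_real_affine[of 1 "\<lambda>x. exp (- (e * \<bar>x\<bar>))" "-t"]
    by (simp_all add: k_def K_def abs_minus_commute)
  have "integrable (lborel \<Otimes>\<^sub>M lborel) (\<lambda>(t, s). k s t * q t)"
  proof (rule lborel_pair.Fubini_integrable)
    show "(\<lambda>(t, s). k s t * q t) \<in> borel_measurable (lborel \<Otimes>\<^sub>M lborel)"
      unfolding k_def by measurable
    have "(\<lambda>t. LINT s|lborel. norm (case (t, s) of (t, s) \<Rightarrow> k s t * q t)) = (\<lambda>t. K * \<bar>q t\<bar>)"
      using kK by (auto simp: abs_mult k_def)
    then show "integrable lborel (\<lambda>t. LINT s|lborel. norm (case (t, s) of (t, s) \<Rightarrow> k s t * q t))"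
      using qi by simp
    show "AE t in lborel. integrable lborel (\<lambda>s. case (t, s) of (t, s) \<Rightarrow> k s t * q t)"
      using ki by auto
  qed
  then have "integrable lborel (\<lambda>s. LINT t|lborel. k s t * q t)"
    by (rule lborel_pair.integrable_snd)
  then have "integrable lebesgue (\<lambda>s. LINT t|lborel. k s t * q t)"
    by (subst integrable_completion) auto
  then show ?thesis
    unfolding kq[symmetric] by (simp add: k_def)
qed

lemma integrable_exp_mult:
  fixes p :: "real \<Rightarrow> real"
  assumes "e \<ge> 0" and p: "integrable lebesgue p"
  shows "integrable lebesgue (\<lambda>t. exp (- (e * \<bar>s - t\<bar>)) * p t)"
proof (rule Bochner_Integration.integrable_bound[OF p])
  have [measurable]: "p \<in> borel_measurable lebesgue" using p by auto
  have [measurable]: "(\<lambda>t. exp (- (e * \<bar>s - t\<bar>))) \<in> borel_measurable lebesgue"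
    by (intro measurable_completion) auto
  show "(\<lambda>t. exp (- (e * \<bar>s - t\<bar>)) * p t) \<in> borel_measurable lebesgue" by measurable
  show "AE t in lebesgue. norm (exp (- (e * \<bar>s - t\<bar>)) * p t) \<le> norm (p t)"
    using assms by (auto simp: abs_mult intro!: mult_left_le_one_le)
qed


section \<open>The Volterra operator of the Jost equation\<close>

lemma absolutely_integrable_bounded_continuous_mult:
  fixes f g :: "real \<Rightarrow> 'a::{euclidean_space, real_normed_algebra}"
  assumes "continuous_on S f" "S \<in> sets lebesgue" "bounded (f ` S)" "g absolutely_integrable_on S"
  shows "(\<lambda>x. f x * g x) absolutely_integrable_on S"
proof -
  have "bilinear (\<lambda>x y::'a. x * y)"
    using bounded_bilinear_mult by (auto simp: bilinear_conv_bounded_bilinear)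
  from absolutely_integrable_bounded_measurable_product[OF this _ assms(2-4)] show ?thesis
    using assms(1,2) continuous_imp_measurable_on_sets_lebesgue by blast
qed

lemma integrable_bounded_continuous_mult:
  fixes f g :: "real \<Rightarrow> 'a::{euclidean_space, real_normed_algebra}"
  assumes "continuous_on UNIV f" "bounded (range f)" "integrable lebesgue g"
  shows "integrable lebesgue (\<lambda>x. f x * g x)"
  using absolutely_integrable_bounded_continuous_mult[of UNIV f g] assms
  by (simp add: absolutely_integrable_UNIV_iff)

lemma continuous_imp_lebesgue_measurable:
  fixes f :: "real \<Rightarrow> 'a::euclidean_space"
  assumes "continuous_on UNIV f"
  shows "f \<in> borel_measurable lebesgue"
  using continuous_imp_measurable_on_sets_lebesgue[OF assms] by simp

lemma has_vector_derivative_exp_of_real: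
  fixes c :: complex
  shows "((\<lambda>x. exp (c * of_real x)) has_vector_derivative c * exp (c * of_real x)) (at x)"
proof -
  have "((\<lambda>z. exp (c * z)) has_field_derivative c * exp (c * of_real x)) (at (of_real x))"
    by (auto intro!: derivative_eq_intros)
  from has_vector_derivative_real_field[OF this] show ?thesis .
qed

text \<open>Formally \<open>- exp (c * \<phi>) / c\<close> is an antiderivative of the integrand,
  which would give the constant \<open>1 / c\<close>. The weaker \<open>2 / c\<close> is reached
  without a chain rule: on intervals where \<open>c * \<phi>\<close> varies by less than
  \<open>ln 2\<close> the exponential varies by at most a factor 2, and
  \<open>1 + r \<le> exp r\<close> gives the bound there; bisection sums up.\<close>

lemma integral_exp_tail_le:
  fixes v :: "real \<Rightarrow> real"
  assumes v: "integrable lebesgue v" "\<And>x. v x \<ge> 0" and c: "c > 0"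
  defines "\<phi> \<equiv> \<lambda>x. integral {x..} v"
  shows "integral {x..} (\<lambda>t. v t * exp (c * \<phi> t)) \<le> 2 / c * exp (c * \<phi> x)"
proof -
  have va: "v absolutely_integrable_on S" if "S \<in> sets lebesgue" for S
    using v(1) that by (rule integrable_imp_absolutely_integrable)
  have vi: "v integrable_on S" if "S \<in> sets lebesgue" for S
    using va[OF that] by (rule set_lebesgue_integral_eq_integral(1))
  have \<phi>: "has_ac_derivative \<phi> (\<lambda>x. - v x)"
    unfolding \<phi>_def by (rule has_ac_derivative_tail_integral) (simp add: va)
  have \<phi>_diff: "integral {y..z} v = \<phi> y - \<phi> z" if "y \<le> z" for y z
    using has_ac_derivative_integral[OF \<phi> that] by simp
  have anti: "\<phi> z \<le> \<phi> y" if "y \<le> z" for y z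
    using \<phi>_diff[OF that] Henstock_Kurzweil_Integration.integral_nonneg[OF vi, of "{y..z}"] v(2) by simp
  have \<phi>0: "\<phi> y \<ge> 0" for y
    unfolding \<phi>_def using v(2) vi by (intro Henstock_Kurzweil_Integration.integral_nonneg) auto
  define q where "q = (\<lambda>t. v t * exp (c * \<phi> t))"
  have cont: "continuous_on S (\<lambda>t. exp (c * \<phi> t))" for S
    using has_ac_derivative_continuous_on[OF \<phi>] by (intro continuous_intros)
  have bd: "bounded ((\<lambda>t. exp (c * \<phi> t)) ` {x..})"
    unfolding bounded_iff using anti c by (auto intro!: exI[of _ "exp (c * \<phi> x)"])
  have qa: "q absolutely_integrable_on {x..}"
    using absolutely_integrable_bounded_continuous_mult[OF cont _ bd va] by (simp add: q_def mult.commute)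
  have qi: "q integrable_on {y..z}" if "x \<le> y" for y z
    using absolutely_integrable_on_subinterval[OF qa, of y z] that set_lebesgue_integral_eq_integral(1) by auto
  have part: "integral {x..y} q \<le> 2 / c * (exp (c * \<phi> x) - exp (c * \<phi> y))" if "x \<le> y" for y
  proof -
    \<comment> \<open>The premise \<open>x \<le> y\<close> in the induction predicate is there
      because bisection also asks about short intervals that stick out to the left of
      \<open>x\<close>, where \<open>q\<close> is not known to be integrable.\<close>
    have "x \<le> x \<longrightarrow> integral {x..y} q \<le> 2 / c * (exp (c * \<phi> x) - exp (c * \<phi> y))"
      using that
    proof (induction rule: Bolzano[where P = "\<lambda>y z. x \<le> y \<longrightarrow> integral {y..z} q \<le> 2 / c * (exp (c * \<phi> y) - exp (c * \<phi> z))"])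
      case (trans r s t)
      show ?case
      proof (cases "x \<le> r")
        case True
        have "integral {r..t} q = integral {r..s} q + integral {s..t} q"
          using trans(3,4) qi[OF True] by (simp add: Henstock_Kurzweil_Integration.integral_combine)
        with trans True show ?thesis by (simp add: algebra_simps)
      qed auto
    next
      case (local s)
      have "isCont \<phi> s" by (rule has_ac_derivative_continuous[OF \<phi>])
      \<comment> \<open>Both endpoints of a short interval lie this close to \<open>s\<close> in the
        value of \<open>\<phi>\<close>, so \<open>c * \<phi>\<close> varies by less than
        \<open>ln 2\<close> between them.\<close>
      moreover have "ln 2 / (2 * c) > 0" using c by simp
      ultimately obtain d where d: "d > 0" "\<And>t. \<bar>t - s\<bar> < d \<Longrightarrow> \<bar>\<phi> t - \<phi> s\<bar> < ln 2 / (2 * c)"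
        unfolding continuous_at_eps_delta dist_real_def by blast
      show ?case
      proof (intro exI[of _ d] conjI allI impI d(1))
        fix y z assume yz: "y \<le> s \<and> s \<le> z \<and> z - y < d" and True: "x \<le> y"
        have "y \<le> z" using yz by simp
        have "\<phi> y - \<phi> z < ln 2 / c"
        proof -
          have "\<bar>\<phi> y - \<phi> s\<bar> < ln 2 / (2 * c)" "\<bar>\<phi> z - \<phi> s\<bar> < ln 2 / (2 * c)"
            using d(2)[of y] d(2)[of z] yz by linarith+
          moreover have "ln 2 / c = ln 2 / (2 * c) + ln 2 / (2 * c)" by simp
          ultimately show ?thesis by linarith
        qed
        then have "c * \<phi> y \<le> ln 2 + c * \<phi> z" using c by (simp add: field_simps)
        then have "exp (c * \<phi> y) \<le> exp (ln 2 + c * \<phi> z)" by simp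
        then have e2: "exp (c * \<phi> y) \<le> 2 * exp (c * \<phi> z)" by (simp add: exp_add)
        have "integral {y..z} q \<le> integral {y..z} (\<lambda>t. v t * exp (c * \<phi> y))"
        proof (rule integral_le)
          show "q integrable_on {y..z}" by (rule qi[OF True])
          show "(\<lambda>t. v t * exp (c * \<phi> y)) integrable_on {y..z}"
            using vi by (intro integrable_on_mult_left) auto
        qed (use v(2) anti c in \<open>auto simp: q_def intro!: mult_left_mono\<close>)
        also have "\<dots> = exp (c * \<phi> y) * (\<phi> y - \<phi> z)"
          using \<phi>_diff[OF \<open>y \<le> z\<close>] by simp
        also have "\<dots> \<le> 2 * exp (c * \<phi> z) * (\<phi> y - \<phi> z)"
          using e2 anti[OF \<open>y \<le> z\<close>] by (intro mult_right_mono) auto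
        also have "\<dots> = 2 / c * (exp (c * \<phi> z) * (c * \<phi> y - c * \<phi> z))"
          using c by (simp add: field_simps)
        also have "\<dots> \<le> 2 / c * (exp (c * \<phi> y) - exp (c * \<phi> z))"
        proof (intro mult_left_mono)
          have "1 + (c * \<phi> y - c * \<phi> z) \<le> exp (c * \<phi> y - c * \<phi> z)" by (rule exp_ge_add_one_self)
          then have "exp (c * \<phi> z) * (1 + (c * \<phi> y - c * \<phi> z)) \<le> exp (c * \<phi> z) * exp (c * \<phi> y - c * \<phi> z)"
            by simp
          also have "\<dots> = exp (c * \<phi> y)" by (simp flip: exp_add)
          finally show "exp (c * \<phi> z) * (c * \<phi> y - c * \<phi> z) \<le> exp (c * \<phi> y) - exp (c * \<phi> z)"
            by (simp add: algebra_simps)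
        qed (use c in auto)
        finally show "integral {y..z} q \<le> 2 / c * (exp (c * \<phi> y) - exp (c * \<phi> z))" .
      qed
    qed
    then show ?thesis by simp
  qed
  have "((\<lambda>y. integral {x..} q - integral {y..} q) \<longlongrightarrow> integral {x..} q - 0) at_top"
    by (intro tendsto_intros tail_integral_tendsto_0[OF qa])
  moreover have "\<forall>\<^sub>F y in at_top. integral {x..} q - integral {y..} q \<le> 2 / c * exp (c * \<phi> x)"
    using eventually_ge_at_top[of x]
  proof eventually_elim
    case (elim y)
    have "integral {x..} q - integral {y..} q = integral {x..y} q"
      using integral_Ici_split[OF qa elim] by simp
    also have "\<dots> \<le> 2 / c * exp (c * \<phi> x)"
      using part[OF elim] c by (smt (verit) divide_nonneg_pos exp_ge_zero mult_left_mono)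
    finally show ?case .
  qed
  ultimately have "integral {x..} q - 0 \<le> 2 / c * exp (c * \<phi> x)"
    by (rule tendsto_upperbound) simp
  then show ?thesis by (simp add: q_def)
qed

text \<open>\<open>volterra \<kappa> p\<close> is the bounded solution vanishing at \<open>\<infinity>\<close> of \<open>y'' + 2 \<i> \<kappa> y' = p\<close>.\<close>

definition volterra_deriv :: "complex \<Rightarrow> (real \<Rightarrow> complex) \<Rightarrow> real \<Rightarrow> complex" where
  "volterra_deriv \<kappa> p x =
     - (exp (- (2 * \<i> * \<kappa> * of_real x)) * integral {x..} (\<lambda>t. exp (2 * \<i> * \<kappa> * of_real t) * p t))"

definition volterra :: "complex \<Rightarrow> (real \<Rightarrow> complex) \<Rightarrow> real \<Rightarrow> complex" where
  "volterra \<kappa> p x = \<i> / (2 * \<kappa>) * (volterra_deriv \<kappa> p x + integral {x..} p)"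

context
  fixes \<kappa> :: complex and p :: "real \<Rightarrow> complex"
  assumes \<kappa>: "Im \<kappa> > 0" and p: "integrable lebesgue p"
begin

lemma volterra_absolutely_integrable:
  "S \<in> sets lebesgue \<Longrightarrow> p absolutely_integrable_on S"
  "(\<lambda>t. exp (2 * \<i> * \<kappa> * of_real t) * p t) absolutely_integrable_on {x..}"
proof -
  show *: "S \<in> sets lebesgue \<Longrightarrow> p absolutely_integrable_on S" for S
    using p by (rule integrable_imp_absolutely_integrable)
  show "(\<lambda>t. exp (2 * \<i> * \<kappa> * of_real t) * p t) absolutely_integrable_on {x..}"
  proof (rule absolutely_integrable_bounded_continuous_mult)
    show "bounded ((\<lambda>t. exp (2 * \<i> * \<kappa> * complex_of_real t)) ` {x..})"
      unfolding bounded_iff using \<kappa> by (intro exI[of _ "exp (- 2 * Im \<kappa> * x)"]) auto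
  qed (auto intro!: continuous_intros *)
qed

lemma has_ac_derivative_volterra_deriv:
  "has_ac_derivative (volterra_deriv \<kappa> p) (\<lambda>x. p x - 2 * \<i> * \<kappa> * volterra_deriv \<kappa> p x)"
proof -
  have e: "has_ac_derivative (\<lambda>x. exp (- (2 * \<i> * \<kappa> * of_real x)))
      (\<lambda>x. - (2 * \<i> * \<kappa>) * exp (- (2 * \<i> * \<kappa> * of_real x)))"
    using has_ac_derivative_of_vector_derivative[OF has_vector_derivative_exp_of_real[of "- (2 * \<i> * \<kappa>)"]]
    by (simp add: continuous_intros)
  have "has_ac_derivative (\<lambda>x. - (exp (- (2 * \<i> * \<kappa> * of_real x)) *
          integral {x..} (\<lambda>t. exp (2 * \<i> * \<kappa> * of_real t) * p t)))
      (\<lambda>x. - (- (2 * \<i> * \<kappa>) * exp (- (2 * \<i> * \<kappa> * of_real x)) *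
            integral {x..} (\<lambda>t. exp (2 * \<i> * \<kappa> * of_real t) * p t) +
          exp (- (2 * \<i> * \<kappa> * of_real x)) * - (exp (2 * \<i> * \<kappa> * of_real x) * p x)))"
    by (intro has_ac_derivative_minus has_ac_derivative_mult e has_ac_derivative_tail_integral
        volterra_absolutely_integrable)
  moreover have "- (- (2 * \<i> * \<kappa>) * exp (- (2 * \<i> * \<kappa> * of_real x)) *
            integral {x..} (\<lambda>t. exp (2 * \<i> * \<kappa> * of_real t) * p t) +
          exp (- (2 * \<i> * \<kappa> * of_real x)) * - (exp (2 * \<i> * \<kappa> * of_real x) * p x))
      = p x - 2 * \<i> * \<kappa> * volterra_deriv \<kappa> p x" for x :: real
    by (simp add: volterra_deriv_def algebra_simps exp_minus)
  ultimately show ?thesis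
    unfolding volterra_deriv_def[abs_def] by (simp only:)
qed

text \<open>Integrating \<open>y'' + 2 * \<i> * \<kappa> * y' = p\<close> over
  \<open>[x, \<infinity>)\<close> gives
  \<open>y' + 2 * \<i> * \<kappa> * y = - integral {x..} p\<close>; solved for \<open>y\<close>,
  this is the definition of \<open>volterra\<close>. Only the derivative therefore involves the
  exponential kernel.\<close>

lemma has_vector_derivative_volterra:
  "(volterra \<kappa> p has_vector_derivative volterra_deriv \<kappa> p x) (at x)"
proof (rule has_ac_derivative_imp_vector_derivative)
  have "\<kappa> \<noteq> 0" using \<kappa> by auto
  have "has_ac_derivative (\<lambda>x. \<i> / (2 * \<kappa>) * (volterra_deriv \<kappa> p x + integral {x..} p))
      (\<lambda>x. \<i> / (2 * \<kappa>) * ((p x - 2 * \<i> * \<kappa> * volterra_deriv \<kappa> p x) + - p x))"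
    by (intro has_ac_derivative_linear[OF _ bounded_linear_mult_right] has_ac_derivative_add
        has_ac_derivative_volterra_deriv has_ac_derivative_tail_integral volterra_absolutely_integrable) simp
  then show "has_ac_derivative (volterra \<kappa> p) (volterra_deriv \<kappa> p)"
    using \<open>\<kappa> \<noteq> 0\<close> by (simp add: volterra_def[abs_def] algebra_simps)
  show "isCont (volterra_deriv \<kappa> p) x" for x
    by (rule has_ac_derivative_continuous[OF has_ac_derivative_volterra_deriv])
qed

text \<open>For \<open>t \<ge> x\<close> the kernel has modulus
  \<open>exp (- 2 * Im \<kappa> * (t - x))\<close>. Extending it evenly to all \<open>t\<close>
  yields a convolution on the line, which makes the derivative integrable. The cruder bound by the
  tail of \<open>norm p\<close> further below serves the fixed point argument and the limit at
  infinity.\<close>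

lemma norm_volterra_deriv_le_kernel:
  "norm (volterra_deriv \<kappa> p x) \<le> (LINT t|lebesgue. exp (- (2 * Im \<kappa> * \<bar>x - t\<bar>)) * norm (p t))"
proof -
  have i: "integrable lebesgue (\<lambda>t. exp (- (2 * Im \<kappa> * \<bar>x - t\<bar>)) * norm (p t))"
    using integrable_exp_mult[of "2 * Im \<kappa>" "\<lambda>t. norm (p t)" x] \<kappa> p by simp
  have ai: "(\<lambda>t. exp (- (2 * Im \<kappa> * \<bar>x - t\<bar>)) * norm (p t)) absolutely_integrable_on S"
    if "S \<in> sets lebesgue" for S
    using i that by (rule integrable_imp_absolutely_integrable)
  have "volterra_deriv \<kappa> p x = - integral {x..} (\<lambda>t. exp (- (2 * \<i> * \<kappa> * of_real x)) * (exp (2 * \<i> * \<kappa> * of_real t) * p t))"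
    by (simp add: volterra_deriv_def)
  also have "norm \<dots> \<le> integral {x..} (\<lambda>t. exp (- (2 * Im \<kappa> * \<bar>x - t\<bar>)) * norm (p t))"
    unfolding norm_minus_cancel
  proof (rule integral_norm_bound_integral)
    show "(\<lambda>t. exp (- (2 * \<i> * \<kappa> * of_real x)) * (exp (2 * \<i> * \<kappa> * of_real t) * p t)) integrable_on {x..}"
      using volterra_absolutely_integrable(2) set_lebesgue_integral_eq_integral(1)
      by (intro integrable_on_mult_right) blast
    show "(\<lambda>t. exp (- (2 * Im \<kappa> * \<bar>x - t\<bar>)) * norm (p t)) integrable_on {x..}"
      using ai[of "{x..}"] set_lebesgue_integral_eq_integral(1) by auto
    fix t assume "t \<in> {x..}"
    then show "norm (exp (- (2 * \<i> * \<kappa> * of_real x)) * (exp (2 * \<i> * \<kappa> * of_real t) * p t))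
        \<le> exp (- (2 * Im \<kappa> * \<bar>x - t\<bar>)) * norm (p t)"
      by (simp add: norm_mult algebra_simps flip: exp_add)
  qed
  also have "\<dots> \<le> integral UNIV (\<lambda>t. exp (- (2 * Im \<kappa> * \<bar>x - t\<bar>)) * norm (p t))"
    using ai[of "{x..}"] ai[of UNIV] set_lebesgue_integral_eq_integral(1)
    by (intro integral_subset_le) auto
  finally show ?thesis using integral_lebesgue[OF i] by simp
qed

lemma norm_volterra_deriv_le: "norm (volterra_deriv \<kappa> p x) \<le> integral {x..} (\<lambda>t. norm (p t))"
proof -
  have "volterra_deriv \<kappa> p x = - integral {x..} (\<lambda>t. exp (- (2 * \<i> * \<kappa> * of_real x)) * (exp (2 * \<i> * \<kappa> * of_real t) * p t))"
    by (simp add: volterra_deriv_def)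
  also have "norm \<dots> \<le> integral {x..} (\<lambda>t. norm (p t))"
    unfolding norm_minus_cancel
  proof (rule integral_norm_bound_integral)
    show "(\<lambda>t. exp (- (2 * \<i> * \<kappa> * of_real x)) * (exp (2 * \<i> * \<kappa> * of_real t) * p t)) integrable_on {x..}"
      using volterra_absolutely_integrable(2) set_lebesgue_integral_eq_integral(1)
      by (intro integrable_on_mult_right) blast
    show "(\<lambda>t. norm (p t)) integrable_on {x..}"
      using volterra_absolutely_integrable(1)[of "{x..}"] by (simp add: absolutely_integrable_on_def)
    fix t assume "t \<in> {x..}"
    then have "exp (- (2 * Im \<kappa> * (t - x))) \<le> 1" using \<kappa> by simp
    then have "exp (- (2 * Im \<kappa> * (t - x))) * norm (p t) \<le> 1 * norm (p t)"
      by (intro mult_right_mono) auto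
    moreover have "norm (exp (- (2 * \<i> * \<kappa> * of_real x)) * (exp (2 * \<i> * \<kappa> * of_real t) * p t))
        = exp (- (2 * Im \<kappa> * (t - x))) * norm (p t)"
      by (simp add: norm_mult algebra_simps flip: exp_add)
    ultimately show "norm (exp (- (2 * \<i> * \<kappa> * of_real x)) * (exp (2 * \<i> * \<kappa> * of_real t) * p t)) \<le> norm (p t)"
      by simp
  qed
  finally show ?thesis .
qed

lemma norm_volterra_le: "norm (volterra \<kappa> p x) \<le> integral {x..} (\<lambda>t. norm (p t)) / norm \<kappa>"
proof -
  have "norm (integral {x..} p) \<le> integral {x..} (\<lambda>t. norm (p t))"
    using volterra_absolutely_integrable(1)[of "{x..}"]
    by (intro integral_norm_bound_integral) (auto simp: absolutely_integrable_on_def)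
  then have "norm (volterra_deriv \<kappa> p x + integral {x..} p) \<le> 2 * integral {x..} (\<lambda>t. norm (p t))"
    using norm_volterra_deriv_le[of x] norm_triangle_ineq[of "volterra_deriv \<kappa> p x" "integral {x..} p"]
    by linarith
  then have "norm (volterra_deriv \<kappa> p x + integral {x..} p) / (2 * norm \<kappa>)
      \<le> 2 * integral {x..} (\<lambda>t. norm (p t)) / (2 * norm \<kappa>)"
    by (intro divide_right_mono) auto
  then show ?thesis
    by (simp add: volterra_def norm_divide norm_mult)
qed

lemma integrable_volterra_deriv: "integrable lebesgue (volterra_deriv \<kappa> p)"
proof (rule Bochner_Integration.integrable_bound)
  show "integrable lebesgue (\<lambda>s. LINT t|lebesgue. exp (- (2 * Im \<kappa> * \<bar>s - t\<bar>)) * norm (p t))"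
    using integrable_exp_convolution[of "2 * Im \<kappa>" "\<lambda>t. norm (p t)"] \<kappa> p by simp
  show "volterra_deriv \<kappa> p \<in> borel_measurable lebesgue"
    using has_ac_derivative_continuous_on[OF has_ac_derivative_volterra_deriv]
    by (rule continuous_imp_lebesgue_measurable)
  show "AE s in lebesgue. norm (volterra_deriv \<kappa> p s)
      \<le> norm (LINT t|lebesgue. exp (- (2 * Im \<kappa> * \<bar>s - t\<bar>)) * norm (p t))"
    using norm_volterra_deriv_le_kernel by (intro AE_I2) (smt (verit) real_norm_def)
qed

end

lemma volterra_diff:
  assumes "Im \<kappa> > 0" "integrable lebesgue p" "integrable lebesgue q"
  shows "volterra \<kappa> (\<lambda>t. p t - q t) x = volterra \<kappa> p x - volterra \<kappa> q x"
proof -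
  note i = set_lebesgue_integral_eq_integral(1)[OF volterra_absolutely_integrable(1)]
    set_lebesgue_integral_eq_integral(1)[OF volterra_absolutely_integrable(2)]
  have "integral {x..} (\<lambda>t. p t - q t) = integral {x..} p - integral {x..} q"
    using assms by (intro Henstock_Kurzweil_Integration.integral_diff i) auto
  moreover have "integral {x..} (\<lambda>t. exp (2 * \<i> * \<kappa> * of_real t) * p t - exp (2 * \<i> * \<kappa> * of_real t) * q t)
      = integral {x..} (\<lambda>t. exp (2 * \<i> * \<kappa> * of_real t) * p t) - integral {x..} (\<lambda>t. exp (2 * \<i> * \<kappa> * of_real t) * q t)"
    using assms by (intro Henstock_Kurzweil_Integration.integral_diff i) auto
  ultimately show ?thesis
    unfolding volterra_def volterra_deriv_def right_diff_distrib by (simp add: ring_distribs diff_divide_distrib)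
qed


section \<open>Jost solutions\<close>

text \<open>\<open>m\<close> and \<open>n = m'\<close> describe the Jost solution \<open>exp (\<i> \<kappa> x) m x\<close> of \<open>- f'' + V f = \<kappa>\<^sup>2 f\<close>.\<close>

definition jost_factor ::
    "(real \<Rightarrow> real) \<Rightarrow> complex \<Rightarrow> (real \<Rightarrow> complex) \<Rightarrow> (real \<Rightarrow> complex) \<Rightarrow> bool" where
  "jost_factor V \<kappa> m n \<longleftrightarrow>
     (\<forall>x. (m has_vector_derivative n x) (at x)) \<and>
     has_ac_derivative n (\<lambda>x. of_real (V x) * m x - 2 * \<i> * \<kappa> * n x) \<and>
     integrable lebesgue n \<and> bounded (range m) \<and> bounded (range n) \<and> (m \<longlongrightarrow> 1) at_top"

text \<open>
  The Volterra equation \<open>m = 1 + volterra \<kappa> (V m)\<close> is solved by Banach's fixed point theorem. The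
  weight \<open>exp (c \<phi>)\<close>, with \<open>\<phi> x\<close> the integral of \<open>\<bar>V\<bar>\<close> over \<open>[x, \<infinity>)\<close>, makes the operator a contraction.
\<close>

lemma jost_factor_exists:
  assumes V: "integrable lebesgue V" and \<kappa>: "Im \<kappa> > 0"
  shows "\<exists>m n. jost_factor V \<kappa> m n"
proof -
  define v where "v = (\<lambda>x. \<bar>V x\<bar>)"
  define \<phi> where "\<phi> = (\<lambda>x. integral {x..} v)"
  \<comment> \<open>With this \<open>c\<close> the constant \<open>2 / c\<close> of
    \<open>integral_exp_tail_le\<close>, divided by \<open>norm \<kappa>\<close>, equals
    \<open>1 / 2\<close>, the contraction factor.\<close>
  define c where "c = 4 / norm \<kappa>"
  have "\<kappa> \<noteq> 0" using \<kappa> by auto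
  then have c: "c > 0" by (simp add: c_def)
  have v: "integrable lebesgue v" "\<And>x. v x \<ge> 0" using V by (auto simp: v_def)
  have va: "v absolutely_integrable_on S" if "S \<in> sets lebesgue" for S
    using v(1) that by (rule integrable_imp_absolutely_integrable)
  have vi: "v integrable_on S" if "S \<in> sets lebesgue" for S
    using va[OF that] by (rule set_lebesgue_integral_eq_integral(1))
  have \<phi>_cont: "continuous_on S \<phi>" for S
    unfolding \<phi>_def
    by (rule has_ac_derivative_continuous_on[OF has_ac_derivative_tail_integral]) (simp add: va)
  define \<Phi> where "\<Phi> = integral UNIV v"
  have \<phi>_bounds: "0 \<le> \<phi> x" "\<phi> x \<le> \<Phi>" for x
    unfolding \<phi>_def \<Phi>_def using v(2) vi
    by (auto intro!: Henstock_Kurzweil_Integration.integral_nonneg integral_subset_le)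
  \<comment> \<open>The unknown is \<open>b = exp (- c * \<phi>) * m\<close>, so that the weighted
    norm of \<open>m\<close> becomes the supremum norm of \<open>b\<close>; \<open>pot b\<close> is
    \<open>V * m\<close> in terms of \<open>b\<close>.\<close>
  define pot where "pot b = (\<lambda>t. of_real (V t) * (exp (of_real (c * \<phi> t)) * b t))" for b :: "real \<Rightarrow> complex"
  have weight: "norm (exp (of_real (c * \<phi> t)) * z) \<le> exp (c * \<Phi>) * norm z" for t and z :: complex
  proof -
    have "c * \<phi> t \<le> c * \<Phi>" using c \<phi>_bounds by simp
    then show ?thesis by (auto simp: norm_mult intro!: mult_right_mono)
  qed
  have pot_int: "integrable lebesgue (pot b)" if b: "continuous_on UNIV b" "bounded (range b)" for b
  proof -
    obtain B where B: "\<And>x. norm (b x) \<le> B" using b(2) by (auto simp: bounded_iff)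
    have "norm (exp (of_real (c * \<phi> x)) * b x) \<le> exp (c * \<Phi>) * B" for x
      using weight[of x "b x"] B[of x] by (smt (verit) exp_ge_zero mult_left_mono)
    then have bd: "bounded (range (\<lambda>x. exp (of_real (c * \<phi> x)) * b x))"
      by (auto simp: bounded_iff)
    have "continuous_on UNIV (\<lambda>x. exp (of_real (c * \<phi> x)) * b x)"
      using \<phi>_cont b(1) by (intro continuous_intros)
    moreover note bd
    moreover have "integrable lebesgue (\<lambda>x. complex_of_real (V x))" using V by simp
    ultimately have "integrable lebesgue (\<lambda>x. exp (of_real (c * \<phi> x)) * b x * of_real (V x))"
      by (rule integrable_bounded_continuous_mult)
    then show ?thesis by (simp add: pot_def mult_ac)
  qed
  have pot_norm: "norm (volterra \<kappa> (pot b) x) \<le> exp (c * \<phi> x) * (D / 2)"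
    if b: "continuous_on UNIV b" "\<And>x. norm (b x) \<le> D" for b D x
  proof -
    have bb: "bounded (range b)" using b(2) by (auto simp: bounded_iff)
    have bounded: "bounded ((\<lambda>t. exp (c * \<phi> t)) ` {x..})"
      unfolding bounded_iff using \<phi>_bounds c by (auto intro!: exI[of _ "exp (c * \<Phi>)"])
    have "(\<lambda>t. exp (c * \<phi> t) * v t) absolutely_integrable_on {x..}"
      using \<phi>_cont
      by (intro absolutely_integrable_bounded_continuous_mult[OF _ _ bounded] va continuous_intros) auto
    then have "(\<lambda>t. v t * exp (c * \<phi> t)) integrable_on {x..}"
      by (simp add: mult.commute set_lebesgue_integral_eq_integral(1))
    then have vexp: "(\<lambda>t. v t * exp (c * \<phi> t) * D) integrable_on {x..}"
      by (rule integrable_on_mult_left)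
    have "norm (volterra \<kappa> (pot b) x) \<le> integral {x..} (\<lambda>t. norm (pot b t)) / norm \<kappa>"
      by (rule norm_volterra_le[OF \<kappa> pot_int[OF b(1) bb]])
    also have "integral {x..} (\<lambda>t. norm (pot b t)) \<le> integral {x..} (\<lambda>t. v t * exp (c * \<phi> t) * D)"
    proof (rule integral_le[OF _ vexp])
      show "(\<lambda>t. norm (pot b t)) integrable_on {x..}"
        using integrable_imp_absolutely_integrable[OF pot_int[OF b(1) bb], of "{x..}"]
        by (simp add: absolutely_integrable_on_def)
    qed (use b(2) in \<open>auto simp: pot_def v_def norm_mult mult.assoc intro!: mult_left_mono\<close>)
    also have "\<dots> = integral {x..} (\<lambda>t. v t * exp (c * \<phi> t)) * D"
      by simp
    also have "\<dots> \<le> 2 / c * exp (c * \<phi> x) * D"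
      using integral_exp_tail_le[OF v c, of x] order_trans[OF norm_ge_zero b(2)]
      by (intro mult_right_mono) (auto simp: \<phi>_def)
    finally show ?thesis
      using \<open>\<kappa> \<noteq> 0\<close> by (simp add: c_def field_simps)
  qed
  \<comment> \<open>The Volterra equation for \<open>m\<close>, rewritten as \<open>b = T b\<close>.
    The outer factor cancels the growth \<open>exp (c * \<phi> x)\<close> in
    \<open>pot_norm\<close>, so \<open>T\<close> maps bounded continuous functions to such
    functions.\<close>
  define T where "T b = (\<lambda>x. exp (- of_real (c * \<phi> x)) * (1 + volterra \<kappa> (pot b) x))" for b
  have volt_cont: "continuous_on UNIV (volterra \<kappa> p)" if "integrable lebesgue p" for p
    using has_vector_derivative_volterra[OF \<kappa> that] has_vector_derivative_continuous
    by (blast intro: continuous_at_imp_continuous_on)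
  have T_bcontfun: "T b \<in> bcontfun" if b: "continuous_on UNIV b" "\<And>x. norm (b x) \<le> D" for b D
  proof (rule bcontfun_normI)
    have "bounded (range b)" using b(2) by (auto simp: bounded_iff)
    then show "continuous_on UNIV (T b)"
      unfolding T_def using \<phi>_cont volt_cont[OF pot_int[OF b(1)]] by (intro continuous_intros)
    fix x
    have "norm (T b x) = exp (- (c * \<phi> x)) * norm (1 + volterra \<kappa> (pot b) x)"
      by (simp add: T_def norm_mult)
    also have "\<dots> \<le> exp (- (c * \<phi> x)) * (1 + exp (c * \<phi> x) * (D / 2))"
      using norm_triangle_ineq[of 1 "volterra \<kappa> (pot b) x"] pot_norm[OF b, of x] 
      by (intro mult_left_mono) auto
    also have "\<dots> = exp (- (c * \<phi> x)) + D / 2"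
      by (simp add: distrib_left exp_minus)
    also have "\<dots> \<le> 1 + D / 2"
      using c \<phi>_bounds by simp
    finally show "norm (T b x) \<le> 1 + D / 2" .
  qed
  define F where "F b = Bcontfun (T (apply_bcontfun b))" for b :: "real \<Rightarrow>\<^sub>C complex"
  have F: "apply_bcontfun (F b) = T (apply_bcontfun b)" for b
    unfolding F_def using T_bcontfun[of "apply_bcontfun b" "norm b"]
    by (subst Bcontfun_inverse) (auto simp: norm_bounded)
  have "\<exists>!b. F b = b"
  proof (rule banach_fix_type[of "1/2"])
    show "\<forall>b b'. dist (F b) (F b') \<le> 1 / 2 * dist b b'"
    proof (intro allI dist_bound)
      fix b b' :: "real \<Rightarrow>\<^sub>C complex" and x
      let ?d = "\<lambda>t. apply_bcontfun b t - apply_bcontfun b' t"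
      have bb: "bounded (range (apply_bcontfun b))" for b :: "real \<Rightarrow>\<^sub>C complex"
        using norm_bounded[of b] by (auto simp: bounded_iff)
      have d: "norm (?d t) \<le> dist b b'" for t
        using dist_bounded[of b t b'] by (simp add: dist_norm)
      have "pot (apply_bcontfun b) t - pot (apply_bcontfun b') t = pot ?d t" for t
        by (simp add: pot_def algebra_simps)
      then have "volterra \<kappa> (pot (apply_bcontfun b)) x - volterra \<kappa> (pot (apply_bcontfun b')) x
          = volterra \<kappa> (pot ?d) x"
        using volterra_diff[OF \<kappa> pot_int pot_int, of "apply_bcontfun b" "apply_bcontfun b'" x] bb by simp
      then have "dist (apply_bcontfun (F b) x) (apply_bcontfun (F b') x)
          = exp (- (c * \<phi> x)) * norm (volterra \<kappa> (pot ?d) x)"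
        by (simp add: F T_def dist_norm norm_mult flip: right_diff_distrib)
      also have "\<dots> \<le> exp (- (c * \<phi> x)) * (exp (c * \<phi> x) * (dist b b' / 2))"
        using d by (intro mult_left_mono pot_norm continuous_intros) auto
      also have "\<dots> = 1 / 2 * dist b b'"
        by (simp add: exp_minus)
      finally show "dist (apply_bcontfun (F b) x) (apply_bcontfun (F b') x) \<le> 1 / 2 * dist b b'" .
    qed
  qed auto
  then obtain b where "F b = b" by blast
  then have b: "T (apply_bcontfun b) = apply_bcontfun b" using F by metis
  define m where "m = (\<lambda>x. exp (of_real (c * \<phi> x)) * apply_bcontfun b x)"
  define p where "p = (\<lambda>t. of_real (V t) * m t)"
  have p_pot: "p = pot (apply_bcontfun b)" by (simp add: p_def m_def pot_def)
  have p: "integrable lebesgue p"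
    unfolding p_pot using norm_bounded[of b] by (intro pot_int) (auto simp: bounded_iff)
  have m: "m x = 1 + volterra \<kappa> p x" for x
    using fun_cong[OF b, of x] by (simp add: m_def T_def p_pot exp_minus field_simps)
  have 1: "(m has_vector_derivative volterra_deriv \<kappa> p x) (at x)" for x
  proof -
    have "((\<lambda>x. 1 + volterra \<kappa> p x) has_vector_derivative 0 + volterra_deriv \<kappa> p x) (at x)"
      using has_vector_derivative_volterra[OF \<kappa> p] by (intro derivative_intros)
    then show ?thesis using m by (simp add: m[abs_def])
  qed
  have 2: "has_ac_derivative (volterra_deriv \<kappa> p)
      (\<lambda>x. of_real (V x) * m x - 2 * \<i> * \<kappa> * volterra_deriv \<kappa> p x)"
    using has_ac_derivative_volterra_deriv[OF \<kappa> p] by (simp add: p_def)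
  have 3: "integrable lebesgue (volterra_deriv \<kappa> p)"
    by (rule integrable_volterra_deriv[OF \<kappa> p])
  have "norm (m x) \<le> exp (c * \<Phi>) * norm b" for x
    unfolding m_def using weight[of x "apply_bcontfun b x"] norm_bounded[of b x]
    by (smt (verit) exp_ge_zero mult_left_mono)
  then have 4: "bounded (range m)" by (auto simp: bounded_iff)
  have np: "(\<lambda>t. norm (p t)) absolutely_integrable_on S" if "S \<in> sets lebesgue" for S
    using p that by (intro integrable_imp_absolutely_integrable) auto
  have "norm (volterra_deriv \<kappa> p x) \<le> integral UNIV (\<lambda>t. norm (p t))" for x
  proof -
    have "norm (volterra_deriv \<kappa> p x) \<le> integral {x..} (\<lambda>t. norm (p t))"
      by (rule norm_volterra_deriv_le[OF \<kappa> p])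
    also have "\<dots> \<le> integral UNIV (\<lambda>t. norm (p t))"
      using np[of "{x..}"] np[of UNIV] by (intro integral_subset_le) (auto dest: set_lebesgue_integral_eq_integral(1))
    finally show ?thesis .
  qed
  then have 5: "bounded (range (volterra_deriv \<kappa> p))" by (auto simp: bounded_iff)
  have "((\<lambda>x. integral {x..} (\<lambda>t. norm (p t)) / norm \<kappa>) \<longlongrightarrow> 0 / norm \<kappa>) at_top"
    using np[of "{0..}"] \<open>\<kappa> \<noteq> 0\<close> by (intro tendsto_intros tail_integral_tendsto_0) auto
  then have "(volterra \<kappa> p \<longlongrightarrow> 0) at_top"
    using norm_volterra_le[OF \<kappa> p] by (intro Lim_null_comparison[of "volterra \<kappa> p"]) auto
  then have "((\<lambda>x. 1 + volterra \<kappa> p x) \<longlongrightarrow> 1 + 0) at_top"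
    by (intro tendsto_intros)
  then have 6: "(m \<longlongrightarrow> 1) at_top" using m by (simp add: m[abs_def])
  show ?thesis
    using 1 2 3 4 5 6 unfolding jost_factor_def by blast
qed

lemma jost_factor_continuous:
  assumes "jost_factor V \<kappa> m n"
  shows "isCont m x" "isCont n x"
  using assms unfolding jost_factor_def
  by (auto intro: has_vector_derivative_continuous has_ac_derivative_continuous)

text \<open>As \<open>m\<close> is bounded, \<open>n'\<close> is integrable, so \<open>n\<close>
  converges at both ends; as \<open>n\<close> itself is integrable, the limits are 0. Integrability
  of \<open>n = m'\<close> makes \<open>m\<close> converge at the far end as well, where its limit
  is not normalised.\<close>

lemma jost_factor_limits:
  assumes V: "integrable lebesgue V" and j: "jost_factor V \<kappa> m n"
  shows "(n \<longlongrightarrow> 0) at_top" "(n \<longlongrightarrow> 0) at_bot" "\<exists>L. (m \<longlongrightarrow> L) at_bot"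
proof -
  have cm: "continuous_on UNIV m"
    using jost_factor_continuous(1)[OF j] continuous_at_imp_continuous_on by blast
  have n: "integrable lebesgue n" using j by (simp add: jost_factor_def)
  have n': "has_ac_derivative n (\<lambda>x. of_real (V x) * m x - 2 * \<i> * \<kappa> * n x)"
    using j by (simp add: jost_factor_def)
  have "integrable lebesgue (\<lambda>x. m x * of_real (V x))"
    using V j cm by (intro integrable_bounded_continuous_mult) (auto simp: jost_factor_def)
  then have i: "integrable lebesgue (\<lambda>x. of_real (V x) * m x - 2 * \<i> * \<kappa> * n x)"
    using n by (simp add: mult.commute)
  obtain L where L: "(n \<longlongrightarrow> L) at_top"
    using ac_tendsto_at_top[OF n' integrable_imp_absolutely_integrable[OF i], of 0] by auto
  with integrable_limit_0[OF n L] show "(n \<longlongrightarrow> 0) at_top" by simp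
  have nr: "integrable lebesgue (\<lambda>x. n (- x))"
    using n integrable_lebesgue_reflect(1) by blast
  have ir: "integrable lebesgue (\<lambda>x. - (of_real (V (- x)) * m (- x) - 2 * \<i> * \<kappa> * n (- x)))"
    using integrable_lebesgue_reflect(1)[THEN iffD2, OF i] by (rule Bochner_Integration.integrable_minus)
  obtain M where M: "((\<lambda>x. n (- x)) \<longlongrightarrow> M) at_top"
    using ac_tendsto_at_top[OF has_ac_derivative_reflect[OF n'] integrable_imp_absolutely_integrable[OF ir], of 0]
    by auto
  with integrable_limit_0[OF nr M] show "(n \<longlongrightarrow> 0) at_bot" by (simp add: tendsto_at_bot_reflect)
  have m': "has_ac_derivative m n"
    using j jost_factor_continuous[OF j] unfolding jost_factor_def
    by (intro has_ac_derivative_of_vector_derivative) auto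
  have "integrable lebesgue (\<lambda>x. - n (- x))" using nr by simp
  then show "\<exists>L. (m \<longlongrightarrow> L) at_bot"
    using ac_tendsto_at_top[OF has_ac_derivative_reflect[OF m'] integrable_imp_absolutely_integrable, of 0]
    by (auto simp: tendsto_at_bot_reflect)
qed


section \<open>Green functions from decaying solutions\<close>

lemma L2_D:
  assumes "g \<in> L2"
  shows "g \<in> borel_measurable lebesgue" "integrable lebesgue (\<lambda>x. (cmod (g x))\<^sup>2)"
  using assms by (auto simp: L2_def)

lemma L2_I:
  "g \<in> borel_measurable lebesgue \<Longrightarrow> integrable lebesgue (\<lambda>x. (cmod (g x))\<^sup>2) \<Longrightarrow> g \<in> L2"
  by (simp add: L2_def)

lemma cmod_measurable:
  "f \<in> borel_measurable M \<Longrightarrow> (\<lambda>x. cmod (f x)) \<in> borel_measurable M"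
  by measurable

lemma L2_mult: "f \<in> L2 \<Longrightarrow> (\<lambda>x. c * f x) \<in> L2"
  by (auto simp: L2_def norm_mult power_mult_distrib)

lemma L2_add:
  assumes "f \<in> L2" "g \<in> L2"
  shows "(\<lambda>x. f x + g x) \<in> L2"
proof (rule L2_I)
  note fg = L2_D[OF assms(1)] L2_D[OF assms(2)]
  show m: "(\<lambda>x. f x + g x) \<in> borel_measurable lebesgue"
    using fg by (intro borel_measurable_add)
  show "integrable lebesgue (\<lambda>x. (cmod (f x + g x))\<^sup>2)"
  proof (rule Bochner_Integration.integrable_bound)
    show "integrable lebesgue (\<lambda>x. 2 * (cmod (f x))\<^sup>2 + 2 * (cmod (g x))\<^sup>2)"
      using fg by simp
    show "(\<lambda>x. (cmod (f x + g x))\<^sup>2) \<in> borel_measurable lebesgue"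
      using m by (intro borel_measurable_power cmod_measurable)
    have "(cmod (f x + g x))\<^sup>2 \<le> 2 * (cmod (f x))\<^sup>2 + 2 * (cmod (g x))\<^sup>2" for x
    proof -
      have "(cmod (f x + g x))\<^sup>2 \<le> (cmod (f x) + cmod (g x))\<^sup>2"
        by (intro power_mono norm_triangle_ineq) auto
      also have "\<dots> \<le> 2 * (cmod (f x))\<^sup>2 + 2 * (cmod (g x))\<^sup>2"
        using sum_squares_bound[of "cmod (f x)" "cmod (g x)"] by (simp add: power2_sum)
      finally show ?thesis .
    qed
    then show "AE x in lebesgue. norm ((cmod (f x + g x))\<^sup>2) \<le> norm (2 * (cmod (f x))\<^sup>2 + 2 * (cmod (g x))\<^sup>2)"
      by simp
  qed
qed

lemma integral_exp_minus_abs_lebesgue: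
  assumes "e > (0::real)"
  shows "integrable lebesgue (\<lambda>t. exp (- (e * \<bar>s - t\<bar>)))"
    and "(LINT t|lebesgue. exp (- (e * \<bar>s - t\<bar>))) = (LINT t|lebesgue. exp (- (e * \<bar>t\<bar>)))"
proof -
  have i: "integrable lebesgue (\<lambda>t. exp (- (e * \<bar>t\<bar>)))"
    using integrable_exp_minus_abs[OF assms] by (subst integrable_completion) auto
  show "integrable lebesgue (\<lambda>t. exp (- (e * \<bar>s - t\<bar>)))"
    using lebesgue_integrable_real_affine[OF i, of "-1" s] by simp
  show "(LINT t|lebesgue. exp (- (e * \<bar>s - t\<bar>))) = (LINT t|lebesgue. exp (- (e * \<bar>t\<bar>)))"
    using lebesgue_integral_real_affine[of "-1" "\<lambda>t. exp (- (e * \<bar>t\<bar>))" s] by simp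
qed

text \<open>The kernel is bounded by 1, which settles the square. For the first power,
  \<open>cmod (g t) \<le> 1 + (cmod (g t))^2\<close>, and the kernel alone is integrable.\<close>

lemma L2_exp_kernel_integrable:
  assumes e: "e > 0" and g: "g \<in> L2"
  shows "integrable lebesgue (\<lambda>t. exp (- (e * \<bar>s - t\<bar>)) * (cmod (g t))\<^sup>2)"
    and "integrable lebesgue (\<lambda>t. exp (- (e * \<bar>s - t\<bar>)) * cmod (g t))"
proof -
  show 2: "integrable lebesgue (\<lambda>t. exp (- (e * \<bar>s - t\<bar>)) * (cmod (g t))\<^sup>2)"
    using integrable_exp_mult[OF _ L2_D(2)[OF g], of e s] e by simp
  show "integrable lebesgue (\<lambda>t. exp (- (e * \<bar>s - t\<bar>)) * cmod (g t))"
  proof (rule Bochner_Integration.integrable_bound)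
    show "integrable lebesgue (\<lambda>t. exp (- (e * \<bar>s - t\<bar>)) + exp (- (e * \<bar>s - t\<bar>)) * (cmod (g t))\<^sup>2)"
      using 2 integral_exp_minus_abs_lebesgue(1)[OF e] by (intro Bochner_Integration.integrable_add)
    have "(\<lambda>t. exp (- (e * \<bar>s - t\<bar>))) \<in> borel_measurable lebesgue"
      using integral_exp_minus_abs_lebesgue(1)[OF e] by (rule borel_measurable_integrable)
    then show "(\<lambda>t. exp (- (e * \<bar>s - t\<bar>)) * cmod (g t)) \<in> borel_measurable lebesgue"
      using L2_D(1)[OF g] by (intro borel_measurable_times cmod_measurable)
    have "exp (- (e * \<bar>s - t\<bar>)) * cmod (g t) \<le> exp (- (e * \<bar>s - t\<bar>)) * (1 + (cmod (g t))\<^sup>2)" for t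
    proof (intro mult_left_mono)
      show "cmod (g t) \<le> 1 + (cmod (g t))\<^sup>2"
        using sum_squares_bound[of "cmod (g t)" 1] norm_ge_zero[of "g t"]
        unfolding power2_eq_square by linarith
    qed auto
    then show "AE t in lebesgue. norm (exp (- (e * \<bar>s - t\<bar>)) * cmod (g t))
        \<le> norm (exp (- (e * \<bar>s - t\<bar>)) + exp (- (e * \<bar>s - t\<bar>)) * (cmod (g t))\<^sup>2)"
      by (intro AE_I2) (simp add: distrib_left)
  qed
qed

text \<open>Schur's test, by Cauchy--Schwarz with the weight \<open>exp (- e \<bar>s - t\<bar>)\<close>.\<close>

lemma L2_exp_kernel_bound:
  assumes e: "e > 0" and g: "g \<in> L2" and f: "continuous_on UNIV f"
    and le: "\<And>s. cmod (f s) \<le> C * (LINT t|lebesgue. exp (- (e * \<bar>s - t\<bar>)) * cmod (g t))"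
  shows "f \<in> L2"
proof (rule L2_I)
  show m: "f \<in> borel_measurable lebesgue" by (rule continuous_imp_lebesgue_measurable[OF f])
  define k where "k s t = exp (- (e * \<bar>s - t\<bar>))" for s t :: real
  \<comment> \<open>The 1 is added only to make \<open>A\<close> visibly positive, so that one can
    divide by it.\<close>
  define A where "A = (LINT t|lebesgue. exp (- (e * \<bar>t\<bar>))) + 1"
  define B where "B s = (LINT t|lebesgue. k s t * (cmod (g t))\<^sup>2)" for s
  define P where "P s = (LINT t|lebesgue. k s t * cmod (g t))" for s
  have "(LINT t|lebesgue. exp (- (e * \<bar>t\<bar>))) \<ge> 0" by simp
  then have A: "A > 0" unfolding A_def by (rule add_nonneg_pos) simp
  note i = L2_exp_kernel_integrable[OF e g, folded k_def] integral_exp_minus_abs_lebesgue[OF e, folded k_def]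
  have PB: "(P s)\<^sup>2 \<le> A * B s" for s
  proof -
    \<comment> \<open>The value minimising the quadratic \<open>B s - 2 * c * P s + c^2 * A\<close>;
      nonnegativity of the minimum is the Cauchy--Schwarz inequality.\<close>
    define c where "c = P s / A"
    have "0 \<le> (LINT t|lebesgue. k s t * (cmod (g t) - c)\<^sup>2)"
      by (simp add: k_def)
    also have "(\<lambda>t. k s t * (cmod (g t) - c)\<^sup>2)
        = (\<lambda>t. k s t * (cmod (g t))\<^sup>2 - 2 * c * (k s t * cmod (g t)) + c\<^sup>2 * k s t)"
      by (simp add: power2_eq_square algebra_simps)
    also have "(LINT t|lebesgue. k s t * (cmod (g t))\<^sup>2 - 2 * c * (k s t * cmod (g t)) + c\<^sup>2 * k s t)
        = B s - 2 * c * P s + c\<^sup>2 * (A - 1)"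
      using i by (simp add: B_def P_def A_def)
    also have "\<dots> \<le> B s - 2 * c * P s + c\<^sup>2 * A" by (simp add: algebra_simps)
    also have "\<dots> = B s - (P s)\<^sup>2 / A"
      using A by (simp add: c_def power2_eq_square field_simps)
    finally show ?thesis using A by (simp add: field_simps)
  qed
  show "integrable lebesgue (\<lambda>x. (cmod (f x))\<^sup>2)"
  proof (rule Bochner_Integration.integrable_bound)
    show "integrable lebesgue (\<lambda>s. C\<^sup>2 * (A * B s))"
      using integrable_exp_convolution[OF e L2_D(2)[OF g]] by (simp add: B_def k_def)
    show "(\<lambda>x. (cmod (f x))\<^sup>2) \<in> borel_measurable lebesgue"
      using m by (intro borel_measurable_power cmod_measurable)
    have "(cmod (f s))\<^sup>2 \<le> C\<^sup>2 * (A * B s)" for s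
    proof -
      have "(cmod (f s))\<^sup>2 \<le> (C * P s)\<^sup>2"
        using le[of s] by (intro power_mono) (auto simp: P_def k_def)
      also have "\<dots> \<le> C\<^sup>2 * (A * B s)"
        using PB[of s] by (simp add: power_mult_distrib mult_left_mono)
      finally show ?thesis .
    qed
    then show "AE s in lebesgue. norm ((cmod (f s))\<^sup>2) \<le> norm (C\<^sup>2 * (A * B s))"
      by (intro AE_I2) (smt (verit) real_norm_def zero_le_power2)
  qed
qed

lemma has_ac_derivative_initial_integral:
  fixes p :: "real \<Rightarrow> 'a::euclidean_space"
  assumes p: "\<And>s. p absolutely_integrable_on {..s}"
  shows "has_ac_derivative (\<lambda>s. integral {..s} p) p"
proof (rule has_ac_derivativeI)
  show ab: "p absolutely_integrable_on {a..b}" for a b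
    using p[of b] by (rule absolutely_integrable_on_subinterval) auto
  fix a b :: real assume "a \<le> b"
  then have "{..b} = {..a} \<union> {a..b}" "{..a} \<inter> {a..b} = {a}" by auto
  then have "integral {..b} p = integral {..a} p + integral {a..b} p"
    using p[of a] ab[of a b] by (simp add: integral_Un set_lebesgue_integral_eq_integral(1))
  then show "integral {a..b} p = integral {..b} p - integral {..a} p" by simp
qed

text \<open>Testing with the conjugate of \<open>D s\<close> cut off to a compact interval around
  \<open>t\<close> shows that \<open>D s\<close> vanishes there in the mean square, and continuity
  turns this into a pointwise statement. This is why joint continuity fixes the Green function on
  the diagonal.\<close>

lemma continuous_kernel_eq_0:
  fixes D :: "real \<Rightarrow> real \<Rightarrow> complex"
  assumes D: "continuous_on UNIV (\<lambda>(s, t). D s t)"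
    and zero: "\<And>g s. g \<in> L2 \<Longrightarrow> (LINT t|lebesgue. D s t * g t) = 0"
  shows "D s t = 0"
proof -
  define S where "S = {t - 1..t + 1}"
  have Ds: "continuous_on T (\<lambda>t. D s t)" for T
    using continuous_on_compose2[OF D continuous_on_Pair[OF continuous_on_const continuous_on_id, of T s]] by simp
  define g where "g = (\<lambda>r. indicator S r *\<^sub>R cnj (D s r))"
  have g_sq: "(cmod (g r))\<^sup>2 = indicator S r *\<^sub>R (cmod (D s r))\<^sup>2" for r
    by (simp add: g_def indicator_def)
  have "(\<lambda>r. (cmod (D s r))\<^sup>2) absolutely_integrable_on S"
    unfolding S_def by (intro absolutely_integrable_continuous_real continuous_intros Ds)
  then have int: "integrable lebesgue (\<lambda>r. indicator S r *\<^sub>R (cmod (D s r))\<^sup>2)"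
    by (simp add: set_integrable_def)
  have "(\<lambda>r. cnj (D s r)) absolutely_integrable_on S"
    unfolding S_def by (intro absolutely_integrable_continuous_real continuous_intros Ds)
  then have "integrable lebesgue g"
    by (simp add: set_integrable_def g_def)
  then have "g \<in> L2"
    using int by (intro L2_I) (auto simp: g_sq borel_measurable_integrable)
  have Dg: "D s r * g r = complex_of_real (indicator S r *\<^sub>R (cmod (D s r))\<^sup>2)" for r
    by (simp add: g_def indicator_def complex_norm_square flip: of_real_power)
  have "complex_of_real (LINT r|lebesgue. indicator S r *\<^sub>R (cmod (D s r))\<^sup>2) = 0"
    using zero[OF \<open>g \<in> L2\<close>, of s] unfolding Dg integral_complex_of_real .
  then have "(LINT r|lebesgue. indicator S r *\<^sub>R (cmod (D s r))\<^sup>2) = 0"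
    by simp
  then have "integral S (\<lambda>r. (cmod (D s r))\<^sup>2) = 0"
    using set_lebesgue_integral_eq_integral(2)[of S "\<lambda>r. (cmod (D s r))\<^sup>2"] int
    by (simp add: set_integrable_def set_lebesgue_integral_def)
  moreover have "(\<lambda>r. (cmod (D s r))\<^sup>2) integrable_on S"
    using \<open>(\<lambda>r. (cmod (D s r))\<^sup>2) absolutely_integrable_on S\<close> by (rule set_lebesgue_integral_eq_integral(1))
  ultimately have "((\<lambda>r. (cmod (D s r))\<^sup>2) has_integral 0) (cbox (t - 1) (t + 1))"
    by (simp add: S_def has_integral_iff)
  then have "(cmod (D s t))\<^sup>2 = 0"
    by (rule has_integral_0_cbox_imp_0[rotated 2]) (auto intro!: continuous_intros Ds)
  then show ?thesis by simp
qed

lemma continuous_kernel_unique: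
  fixes G H :: "real \<Rightarrow> real \<Rightarrow> complex"
  assumes "continuous_on UNIV (\<lambda>(s, t). G s t)" "continuous_on UNIV (\<lambda>(s, t). H s t)"
    and G: "\<And>g s. g \<in> L2 \<Longrightarrow> integrable lebesgue (\<lambda>t. G s t * g t) \<and> (LINT t|lebesgue. G s t * g t) = R g s"
    and H: "\<And>g s. g \<in> L2 \<Longrightarrow> integrable lebesgue (\<lambda>t. H s t * g t) \<and> (LINT t|lebesgue. H s t * g t) = R g s"
  shows "G = H"
proof -
  have "G s t - H s t = 0" for s t
  proof (rule continuous_kernel_eq_0[where D = "\<lambda>s t. G s t - H s t"])
    show "continuous_on UNIV (\<lambda>(s, t). G s t - H s t)"
      using assms(1,2) by (auto simp: case_prod_unfold intro: continuous_intros)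
    show "(LINT t|lebesgue. (G s t - H s t) * g t) = 0" if "g \<in> L2" for g s
      using G[OF that, of s] H[OF that, of s] by (simp add: left_diff_distrib)
  qed
  then show ?thesis by (auto simp: fun_eq_iff)
qed

lemma green_eqI:
  assumes "continuous_on UNIV (\<lambda>(s, t). G s t)"
    and "\<And>g s. g \<in> L2 \<Longrightarrow> integrable lebesgue (\<lambda>t. G s t * g t)"
    and "\<And>g s. g \<in> L2 \<Longrightarrow> resolvent V z g s = (LINT t|lebesgue. G s t * g t)"
  shows "green V x y z = G x y"
proof -
  have "(THE G :: real \<Rightarrow> real \<Rightarrow> complex.
      continuous_on UNIV (\<lambda>(s, t). G s t) \<and>
      (\<forall>g\<in>L2. \<forall>s. integrable lebesgue (\<lambda>t. G s t * g t) \<and>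
                   resolvent V z g s = (LINT t|lebesgue. G s t * g t))) = G"
  proof (rule the_equality)
    fix H :: "real \<Rightarrow> real \<Rightarrow> complex"
    assume H: "continuous_on UNIV (\<lambda>(s, t). H s t) \<and>
      (\<forall>g\<in>L2. \<forall>s. integrable lebesgue (\<lambda>t. H s t * g t) \<and>
                   resolvent V z g s = (LINT t|lebesgue. H s t * g t))"
    show "H = G"
      by (rule continuous_kernel_unique[where R = "resolvent V z"]) (use H assms in auto)
  qed (use assms in auto)
  then show ?thesis by (simp add: green_def)
qed

lemma resolvent_eqI:
  assumes z: "z \<notin> spec V" and g: "g \<in> L2" and f: "(f, \<lambda>x. g x + z * f x) \<in> schroedinger V"
  shows "resolvent V z g = f"
proof -
  have "\<exists>!f. (f, \<lambda>x. g x + z * f x) \<in> schroedinger V"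
    using z g by (simp add: spec_def)
  then show ?thesis
    unfolding resolvent_def using f by (intro the_equality) blast+
qed

text \<open>Collects what the construction of a resolvent kernel uses about an operator, so that it
  can be carried out once and instantiated both for \<open>V0\<close> and for its partner. Each
  bound prescribes decay at one end and limits growth at the other; the common rate \<open>e\<close>
  makes the product of the two solutions decay in the distance of their arguments.\<close>

locale decaying_solutions =
  fixes V :: "real \<Rightarrow> real" and z W :: complex and fp fp' fm fm' :: "real \<Rightarrow> complex" and C e :: real
  assumes e: "e > 0"
    and fp: "(fp has_vector_derivative fp' x) (at x)"
    and fm: "(fm has_vector_derivative fm' x) (at x)"
    and fp': "has_ac_derivative fp' (\<lambda>x. (of_real (V x) - z) * fp x)"
    and fm': "has_ac_derivative fm' (\<lambda>x. (of_real (V x) - z) * fm x)"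
    and fp_le: "cmod (fp x) \<le> C * exp (- (e * x))"
    and fm_le: "cmod (fm x) \<le> C * exp (e * x)"
    and W: "fm x * fp' x - fm' x * fp x = W" and W_nonzero: "W \<noteq> 0"
begin

text \<open>The minus sign belongs to the Wronskian convention
  \<open>W = fm * fp' - fm' * fp\<close>: the derivative of \<open>G s t\<close> in \<open>s\<close>
  then jumps by -1 across \<open>s = t\<close>, as \<open>- f'' + V f - z f = g\<close>
  demands.\<close>

definition G :: "real \<Rightarrow> real \<Rightarrow> complex" where
  "G s t = - (fm (min s t) * fp (max s t) / W)"

lemma C_nonneg: "C \<ge> 0"
  using order_trans[OF norm_ge_zero fp_le[of 0]] by simp

lemma ac_fp: "has_ac_derivative fp fp'"
  using fp has_ac_derivative_continuous[OF fp'] by (rule has_ac_derivative_of_vector_derivative)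

lemma ac_fm: "has_ac_derivative fm fm'"
  using fm has_ac_derivative_continuous[OF fm'] by (rule has_ac_derivative_of_vector_derivative)

lemma continuous_G: "continuous_on UNIV (\<lambda>(s, t). G s t)"
proof -
  have "continuous_on UNIV (\<lambda>x. fm (min (fst x) (snd x)))" "continuous_on UNIV (\<lambda>x. fp (max (fst x) (snd x)))"
    by (rule continuous_on_compose2[OF has_ac_derivative_continuous_on[OF ac_fm, of UNIV]]
        continuous_on_compose2[OF has_ac_derivative_continuous_on[OF ac_fp, of UNIV]];
        auto intro!: continuous_intros)+
  then show ?thesis
    unfolding G_def case_prod_unfold using W_nonzero by (intro continuous_intros) auto
qed

lemma G_le: "cmod (G s t) \<le> C\<^sup>2 / cmod W * exp (- (e * \<bar>s - t\<bar>))"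
proof -
  have "cmod (fm (min s t)) * cmod (fp (max s t)) \<le> (C * exp (e * min s t)) * (C * exp (- (e * max s t)))"
    by (intro mult_mono fm_le fp_le) (auto simp: C_nonneg)
  also have "\<dots> = C\<^sup>2 * exp (e * min s t - e * max s t)"
    by (simp add: power2_eq_square exp_diff exp_minus field_simps)
  also have "e * min s t - e * max s t = - (e * \<bar>s - t\<bar>)"
    by (auto simp: min_def max_def algebra_simps)
  finally have "cmod (fm (min s t)) * cmod (fp (max s t)) / cmod W \<le> C\<^sup>2 * exp (- (e * \<bar>s - t\<bar>)) / cmod W"
    by (intro divide_right_mono) auto
  then show ?thesis
    by (simp add: G_def norm_mult norm_divide)
qed

context
  fixes g assumes g: "g \<in> L2"
begin

lemma integrable_G: "integrable lebesgue (\<lambda>t. G s t * g t)"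
proof (rule Bochner_Integration.integrable_bound)
  show "integrable lebesgue (\<lambda>t. C\<^sup>2 / cmod W * (exp (- (e * \<bar>s - t\<bar>)) * cmod (g t)))"
    using L2_exp_kernel_integrable(2)[OF e g] by simp
  have "continuous_on UNIV (\<lambda>t. G s t)"
    using continuous_on_compose2[OF continuous_G continuous_on_Pair[OF continuous_on_const continuous_on_id, of UNIV s]]
    by simp
  then show "(\<lambda>t. G s t * g t) \<in> borel_measurable lebesgue"
    using L2_D(1)[OF g] continuous_imp_lebesgue_measurable by (intro borel_measurable_times) blast+
  have "cmod (G s t * g t) \<le> C\<^sup>2 / cmod W * (exp (- (e * \<bar>s - t\<bar>)) * cmod (g t))" for t
    using mult_right_mono[OF G_le[of s t] norm_ge_zero[of "g t"]] by (simp add: norm_mult mult.assoc)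
  then show "AE t in lebesgue. norm (G s t * g t) \<le> norm (C\<^sup>2 / cmod W * (exp (- (e * \<bar>s - t\<bar>)) * cmod (g t)))"
    by (intro AE_I2) (smt (verit) real_norm_def)
qed

lemma G_integral_le:
  "cmod (LINT t|lebesgue. G s t * g t)
    \<le> C\<^sup>2 / cmod W * (LINT t|lebesgue. exp (- (e * \<bar>s - t\<bar>)) * cmod (g t))"
proof -
  have "cmod (LINT t|lebesgue. G s t * g t) \<le> (LINT t|lebesgue. cmod (G s t * g t))"
    by (rule integral_norm_bound)
  also have "\<dots> \<le> (LINT t|lebesgue. C\<^sup>2 / cmod W * (exp (- (e * \<bar>s - t\<bar>)) * cmod (g t)))"
  proof (rule integral_mono)
    show "integrable lebesgue (\<lambda>t. cmod (G s t * g t))" using integrable_G by simp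
    show "integrable lebesgue (\<lambda>t. C\<^sup>2 / cmod W * (exp (- (e * \<bar>s - t\<bar>)) * cmod (g t)))"
      using L2_exp_kernel_integrable(2)[OF e g] by simp
    show "cmod (G s t * g t) \<le> C\<^sup>2 / cmod W * (exp (- (e * \<bar>s - t\<bar>)) * cmod (g t))" for t
      using mult_right_mono[OF G_le[of s t] norm_ge_zero[of "g t"]] by (simp add: norm_mult mult.assoc)
  qed
  finally show ?thesis by simp
qed

lemma absolutely_integrable_fp_g: "(\<lambda>t. fp t * g t) absolutely_integrable_on {s..}"
  unfolding set_integrable_def
proof (rule Bochner_Integration.integrable_bound)
  show "integrable lebesgue (\<lambda>t. C * exp (- (e * s)) * (exp (- (e * \<bar>s - t\<bar>)) * cmod (g t)))"
    using L2_exp_kernel_integrable(2)[OF e g] by simp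
  show "(\<lambda>t. indicator {s..} t *\<^sub>R (fp t * g t)) \<in> borel_measurable lebesgue"
    using L2_D(1)[OF g] continuous_imp_lebesgue_measurable[OF has_ac_derivative_continuous_on[OF ac_fp]]
    by (intro borel_measurable_scaleR borel_measurable_times borel_measurable_indicator) auto
  have "cmod (fp t * g t) \<le> C * exp (- (e * s)) * (exp (- (e * \<bar>s - t\<bar>)) * cmod (g t))" if "t \<ge> s" for t
  proof -
    have "cmod (fp t) * cmod (g t) \<le> C * exp (- (e * t)) * cmod (g t)"
      by (intro mult_right_mono fp_le) auto
    also have "- (e * t) = - (e * s) + - (e * \<bar>s - t\<bar>)"
      using that by (simp add: algebra_simps)
    finally show ?thesis unfolding exp_add by (simp add: norm_mult mult.assoc)
  qed
  then show "AE t in lebesgue. norm (indicator {s..} t *\<^sub>R (fp t * g t))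
      \<le> norm (C * exp (- (e * s)) * (exp (- (e * \<bar>s - t\<bar>)) * cmod (g t)))"
    using C_nonneg by (intro AE_I2) (auto simp: indicator_def abs_mult)
qed

lemma absolutely_integrable_fm_g: "(\<lambda>t. fm t * g t) absolutely_integrable_on {..s}"
  unfolding set_integrable_def
proof (rule Bochner_Integration.integrable_bound)
  show "integrable lebesgue (\<lambda>t. C * exp (e * s) * (exp (- (e * \<bar>s - t\<bar>)) * cmod (g t)))"
    using L2_exp_kernel_integrable(2)[OF e g] by simp
  show "(\<lambda>t. indicator {..s} t *\<^sub>R (fm t * g t)) \<in> borel_measurable lebesgue"
    using L2_D(1)[OF g] continuous_imp_lebesgue_measurable[OF has_ac_derivative_continuous_on[OF ac_fm]]
    by (intro borel_measurable_scaleR borel_measurable_times borel_measurable_indicator) auto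
  have "cmod (fm t * g t) \<le> C * exp (e * s) * (exp (- (e * \<bar>s - t\<bar>)) * cmod (g t))" if "t \<le> s" for t
  proof -
    have "cmod (fm t) * cmod (g t) \<le> C * exp (e * t) * cmod (g t)"
      by (intro mult_right_mono fm_le) auto
    also have "e * t = e * s + - (e * \<bar>s - t\<bar>)"
      using that by (simp add: algebra_simps)
    finally show ?thesis unfolding exp_add by (simp add: norm_mult mult.assoc)
  qed
  then show "AE t in lebesgue. norm (indicator {..s} t *\<^sub>R (fm t * g t))
      \<le> norm (C * exp (e * s) * (exp (- (e * \<bar>s - t\<bar>)) * cmod (g t)))"
    using C_nonneg by (intro AE_I2) (auto simp: indicator_def abs_mult)
qed

text \<open>Resolves \<open>min\<close> and \<open>max\<close>, so that the dependence on
  \<open>s\<close> consists of solutions times integrals with a moving endpoint, and the product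
  rule applies.\<close>

lemma G_integral_split:
  "(LINT t|lebesgue. G s t * g t) =
     - (1 / W) * (fp s * integral {..s} (\<lambda>t. fm t * g t) + fm s * integral {s..} (\<lambda>t. fp t * g t))"
proof -
  have Gi: "(\<lambda>t. G s t * g t) integrable_on S" if "S \<in> sets lebesgue" for S
    using integrable_imp_absolutely_integrable[OF integrable_G that] by (rule set_lebesgue_integral_eq_integral(1))
  have "(LINT t|lebesgue. G s t * g t) = integral UNIV (\<lambda>t. G s t * g t)"
    using integral_lebesgue[OF integrable_G] by simp
  also have "UNIV = {..s} \<union> {s..}" by auto
  also have "integral ({..s} \<union> {s..}) (\<lambda>t. G s t * g t)
      = integral {..s} (\<lambda>t. G s t * g t) + integral {s..} (\<lambda>t. G s t * g t)"
  proof (rule integral_Un)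
    have "{..s} \<inter> {s..} = {s}" by auto
    then show "negligible ({..s} \<inter> {s..})" by simp
  qed (auto intro: Gi)
  also have "integral {..s} (\<lambda>t. G s t * g t) = integral {..s} (\<lambda>t. - (fp s / W) * (fm t * g t))"
    by (intro Henstock_Kurzweil_Integration.integral_cong) (simp add: G_def min_absorb2 max_absorb1)
  also have "integral {s..} (\<lambda>t. G s t * g t) = integral {s..} (\<lambda>t. - (fm s / W) * (fp t * g t))"
    by (intro Henstock_Kurzweil_Integration.integral_cong) (simp add: G_def min_absorb1 max_absorb2)
  finally show ?thesis
    unfolding Henstock_Kurzweil_Integration.integral_mult_right by (simp add: ring_distribs)
qed

lemma G_integral_schroedinger:
  defines "f \<equiv> \<lambda>s. LINT t|lebesgue. G s t * g t"
  shows "(f, \<lambda>x. g x + z * f x) \<in> schroedinger V"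
proof -
  define q where "q = 1 / W"
  define I where "I = (\<lambda>s. integral {..s} (\<lambda>t. fm t * g t))"
  define J where "J = (\<lambda>s. integral {s..} (\<lambda>t. fp t * g t))"
  define f' where "f' = (\<lambda>s. - q * (fp' s * I s + fm' s * J s))"
  have f: "f = (\<lambda>s. - q * (fp s * I s + fm s * J s))"
    by (simp add: f_def G_integral_split I_def J_def q_def)
  have I: "has_ac_derivative I (\<lambda>t. fm t * g t)"
    unfolding I_def by (intro has_ac_derivative_initial_integral absolutely_integrable_fm_g)
  have J: "has_ac_derivative J (\<lambda>t. - (fp t * g t))"
    unfolding J_def by (intro has_ac_derivative_tail_integral absolutely_integrable_fp_g)
  have "has_ac_derivative f (\<lambda>s. - q * ((fp' s * I s + fp s * (fm s * g s)) + (fm' s * J s + fm s * - (fp s * g s))))"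
    unfolding f
    by (intro has_ac_derivative_linear[OF _ bounded_linear_mult_right] has_ac_derivative_add
        has_ac_derivative_mult ac_fp ac_fm I J)
  \<comment> \<open>Variation of constants: the two terms containing \<open>g\<close> cancel in the
    first derivative. In the second derivative they combine to the Wronskian and leave
    \<open>- g\<close>.\<close>
  then have acf: "has_ac_derivative f f'"
    by (simp add: f'_def algebra_simps)
  have "has_ac_derivative f' (\<lambda>s. - q * (((of_real (V s) - z) * fp s * I s + fp' s * (fm s * g s))
       + ((of_real (V s) - z) * fm s * J s + fm' s * - (fp s * g s))))"
    unfolding f'_def
    by (intro has_ac_derivative_linear[OF _ bounded_linear_mult_right] has_ac_derivative_add
        has_ac_derivative_mult fp' fm' I J)
  moreover have "- q * (((of_real (V s) - z) * fp s * I s + fp' s * (fm s * g s))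
       + ((of_real (V s) - z) * fm s * J s + fm' s * - (fp s * g s)))
      = of_real (V s) * f s - (g s + z * f s)" for s
  proof -
    have "- q * (((of_real (V s) - z) * fp s * I s + fp' s * (fm s * g s))
       + ((of_real (V s) - z) * fm s * J s + fm' s * - (fp s * g s)))
       = (of_real (V s) - z) * f s - q * ((fm s * fp' s - fm' s * fp s) * g s)"
      by (simp add: f algebra_simps)
    also have "\<dots> = (of_real (V s) - z) * f s - g s"
      using W_nonzero by (simp add: W q_def)
    finally show ?thesis by (simp add: algebra_simps)
  qed
  ultimately have acf': "has_ac_derivative f' (\<lambda>s. of_real (V s) * f s - (g s + z * f s))"
    by (simp only:)
  have "f \<in> L2"
    unfolding f_def
    by (rule L2_exp_kernel_bound[OF e g _ G_integral_le])
       (use has_ac_derivative_continuous_on[OF acf] in \<open>simp add: f_def\<close>)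
  moreover from this have "(\<lambda>x. g x + z * f x) \<in> L2"
    using g by (intro L2_add L2_mult)
  moreover have "(f has_vector_derivative f' x) (at x)" for x
    by (rule has_ac_derivative_imp_vector_derivative[OF acf has_ac_derivative_continuous[OF acf']])
  ultimately show ?thesis
    using acf' by (auto simp: schroedinger_def)
qed

end

lemma green_eq:
  assumes "z \<notin> spec V"
  shows "green V x y z = G x y"
proof (rule green_eqI[OF continuous_G integrable_G])
  show "resolvent V z g s = (LINT t|lebesgue. G s t * g t)" if "g \<in> L2" for g s
    by (simp add: resolvent_eqI[OF assms that G_integral_schroedinger[OF that]])
qed

end


section \<open>Asymptotics of the superpotential\<close>

text \<open>Dominated convergence: for fixed \<open>t\<close> the kernel vanishes as
  \<open>s\<close> grows, and \<open>norm p\<close> is a majorant for all \<open>s\<close>.\<close>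

lemma exp_convolution_tendsto_0:
  fixes p :: "real \<Rightarrow> real"
  assumes e: "e > 0" and p: "integrable lebesgue p"
  shows "((\<lambda>s. LINT t|lebesgue. exp (- (e * \<bar>s - t\<bar>)) * p t) \<longlongrightarrow> 0) at_top"
proof -
  have "((\<lambda>s. LINT t|lebesgue. exp (- (e * \<bar>s - t\<bar>)) * p t) \<longlongrightarrow> (LINT t::real|lebesgue. (0::real))) at_top"
  proof (rule integral_dominated_convergence_at_top[where w = "\<lambda>t. \<bar>p t\<bar>" and f = "\<lambda>t::real. 0::real"
        and s = "\<lambda>s t. exp (- (e * \<bar>s - t\<bar>)) * p t"])
    show "(\<lambda>t. exp (- (e * \<bar>s - t\<bar>)) * p t) \<in> borel_measurable lebesgue" for s
      using integrable_exp_mult[OF _ p, of e s] e by (intro borel_measurable_integrable) simp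
    show "integrable lebesgue (\<lambda>t. \<bar>p t\<bar>)" using p by simp
    show "\<forall>\<^sub>F s in at_top. AE t in lebesgue. norm (exp (- (e * \<bar>s - t\<bar>)) * p t) \<le> \<bar>p t\<bar>"
      using e by (auto simp: abs_mult intro!: always_eventually mult_left_le_one_le)
    have "((\<lambda>s. exp (- (e * \<bar>s - t\<bar>)) * p t) \<longlongrightarrow> 0 * p t) at_top" for t
      using e by (intro tendsto_mult tendsto_const) real_asymp
    then show "AE t in lebesgue. ((\<lambda>s. exp (- (e * \<bar>s - t\<bar>)) * p t) \<longlongrightarrow> 0) at_top"
      by simp
  qed simp
  then show ?thesis by simp
qed

lemma has_ac_derivative_zero_const:
  assumes "has_ac_derivative f (\<lambda>x. 0)"
  shows "f x = f y"
proof -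
  have "f x = f y" if "x \<le> y" for x y
    using has_ac_derivative_integral[OF assms that] by simp
  then show ?thesis by (metis linear)
qed

lemma absolutely_integrable_on_Ici_continuous:
  fixes f :: "real \<Rightarrow> 'a::euclidean_space"
  assumes "f absolutely_integrable_on {a..}" "continuous_on UNIV f"
  shows "f absolutely_integrable_on {b..}"
proof (cases "a \<le> b")
  case True
  with assms show ?thesis by (blast intro: absolutely_integrable_subset_Ici)
next
  case False
  have "f absolutely_integrable_on {b..a}"
    using assms(2) by (intro absolutely_integrable_continuous_real) (auto intro: continuous_on_subset)
  from absolutely_integrable_Un[OF this assms(1)] have "f absolutely_integrable_on ({b..a} \<union> {a..})" .
  moreover have "{b..a} \<union> {a..} = {b..}" using False by auto
  ultimately show ?thesis by simp
qed

text \<open>Eventually \<open>f' / f > s / 2\<close>, hence \<open>(f^2)' \<ge> s * f^2\<close> and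
  \<open>f^2 * exp (- s * x)\<close> is nondecreasing. Passing to the square disposes of the sign of
  \<open>f\<close> and turns the rate \<open>s / 2\<close> into \<open>s\<close>.\<close>

lemma exp_growth_of_log_derivative:
  fixes f f' :: "real \<Rightarrow> real"
  assumes f: "\<And>x. (f has_real_derivative f' x) (at x)" and nz: "\<And>x. f x \<noteq> 0"
    and lim: "((\<lambda>x. f' x / f x) \<longlongrightarrow> s) at_top" and s: "s > 0"
  shows "\<exists>X c. c > 0 \<and> (\<forall>x\<ge>X. c * exp (s * x) \<le> (f x)\<^sup>2)"
proof -
  have "\<forall>\<^sub>F x in at_top. s / 2 < f' x / f x"
    using lim s by (intro order_tendstoD) auto
  then obtain X where X: "\<And>x. x \<ge> X \<Longrightarrow> s / 2 < f' x / f x"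
    by (auto simp: eventually_at_top_linorder)
  define q where "q x = (f x)\<^sup>2 * exp (- (s * x))" for x
  have "q X \<le> q x" if "x \<ge> X" for x
  proof (rule DERIV_nonneg_imp_nondecreasing[OF that])
    fix t assume "X \<le> t"
    have "(q has_real_derivative (f t)\<^sup>2 * exp (- (s * t)) * (2 * (f' t / f t) - s)) (at t)"
      unfolding q_def using nz
      by (auto intro!: derivative_eq_intros f simp: power2_eq_square field_simps)
    moreover have "(f t)\<^sup>2 * exp (- (s * t)) * (2 * (f' t / f t) - s) \<ge> 0"
    proof (intro mult_nonneg_nonneg)
      show "2 * (f' t / f t) - s \<ge> 0" using X[OF \<open>X \<le> t\<close>] by linarith
    qed auto
    ultimately show "\<exists>y. (q has_real_derivative y) (at t) \<and> 0 \<le> y" by blast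
  qed
  then have "q X * exp (s * x) \<le> q x * exp (s * x)" if "x \<ge> X" for x
    using that by simp
  moreover have "q x * exp (s * x) = (f x)\<^sup>2" for x
    by (simp add: q_def mult.assoc flip: exp_add)
  ultimately have "q X * exp (s * x) \<le> (f x)\<^sup>2" if "x \<ge> X" for x
    using that by metis
  moreover have "q X > 0" using nz by (simp add: q_def)
  ultimately show ?thesis by blast
qed

text \<open>
  With the Jost factor \<open>m\<close> at \<open>\<kappa> = \<i> a\<close> and the constant Wronskian \<open>c\<close> of \<open>u\<close> and \<open>exp (- a x) m x\<close>,
  either \<open>c = 0\<close> and \<open>w = - a + n / m\<close>, or \<open>r = exp (- a x) u / m\<close> solves \<open>r' = - 2 a r - c / m\<^sup>2\<close>.
  In the latter case \<open>y = r + c / (2 a m\<^sup>2)\<close> is integrable at \<open>\<infinity>\<close> and \<open>w = a + n / m - 2 a y / r\<close>.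
\<close>

lemma superpotential_asymptotics:
  fixes V u u' :: "real \<Rightarrow> real"
  assumes V: "integrable lebesgue V" and a: "a > 0"
    and u: "\<And>x. (u has_real_derivative u' x) (at x)"
    and u': "has_ac_derivative u' (\<lambda>x. (V x + a\<^sup>2) * u x)"
    and nz: "\<And>x. u x \<noteq> 0"
  defines "w \<equiv> \<lambda>x. u' x / u x"
  shows "\<exists>s. \<bar>s\<bar> = a \<and> (w \<longlongrightarrow> s) at_top \<and> (\<lambda>x. a\<^sup>2 - (w x)\<^sup>2) absolutely_integrable_on {b..}"
proof -
  \<comment> \<open>For \<open>\<kappa> = \<i> * a\<close> one has
    \<open>\<kappa>^2 = - a^2\<close>, the factorization constant, and
    \<open>exp (\<i> * \<kappa> * x)\<close> is the decaying \<open>exp (- a * x)\<close>.\<close>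
  obtain m n where j: "jost_factor V (\<i> * a) m n"
    using jost_factor_exists[OF V, of "\<i> * a"] a by auto
  have m: "(m has_vector_derivative n x) (at x)" for x
    using j by (auto simp: jost_factor_def)
  have n: "has_ac_derivative n (\<lambda>x. of_real (V x) * m x + 2 * of_real a * n x)"
    and n_int: "integrable lebesgue n" and m_lim: "(m \<longlongrightarrow> 1) at_top"
    using j by (auto simp: jost_factor_def algebra_simps)
  note mn_cont = jost_factor_continuous[OF j]
  have m_ac: "has_ac_derivative m n"
    using m mn_cont(2) by (rule has_ac_derivative_of_vector_derivative)
  have n_lim: "(n \<longlongrightarrow> 0) at_top" by (rule jost_factor_limits(1)[OF V j])
  have u'_cont: "isCont u' x" for x by (rule has_ac_derivative_continuous[OF u'])
  have u_cont: "isCont u x" for x using u DERIV_isCont by blast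
  have w_cont: "continuous_on UNIV w"
    unfolding w_def using u'_cont u_cont nz by (intro continuous_at_imp_continuous_on ballI continuous_intros) auto
  define U U' E where "U = (\<lambda>x. complex_of_real (u x))" and "U' = (\<lambda>x. complex_of_real (u' x))"
    and "E = (\<lambda>x. exp (- of_real a * complex_of_real x))"
  have U_nz: "U x \<noteq> 0" for x using nz by (simp add: U_def)
  have U: "has_ac_derivative U U'"
  proof -
    have "has_ac_derivative u u'"
      using u u'_cont
      by (intro has_ac_derivative_of_vector_derivative) (auto simp: has_real_derivative_iff_has_vector_derivative)
    then show ?thesis unfolding U_def U'_def by (rule has_ac_derivative_linear) (rule bounded_linear_of_real)
  qed
  have U': "has_ac_derivative U' (\<lambda>x. (of_real (V x) + (of_real a)\<^sup>2) * U x)"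
    using has_ac_derivative_linear[OF u' bounded_linear_of_real[where 'a=complex]] by (simp add: U_def U'_def)
  have E_deriv: "(E has_vector_derivative - of_real a * E x) (at x)" for x
    using has_vector_derivative_exp_of_real[of "- of_real a"] by (simp add: E_def)
  have E: "has_ac_derivative E (\<lambda>x. - of_real a * E x)"
    using E_deriv by (rule has_ac_derivative_of_vector_derivative) (auto simp: E_def intro!: continuous_intros)
  have E_nz: "E x \<noteq> 0" for x by (simp add: E_def)
  define c where "c = E 0 * (U 0 * (n 0 - of_real a * m 0) - U' 0 * m 0)"
  have c: "E x * (U x * (n x - of_real a * m x) - U' x * m x) = c" for x
  proof -
    have "has_ac_derivative (\<lambda>x. E x * (U x * (n x - of_real a * m x) - U' x * m x))
        (\<lambda>x. - of_real a * E x * (U x * (n x - of_real a * m x) - U' x * m x) +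
           E x * ((U' x * (n x - of_real a * m x) +
                     U x * ((of_real (V x) * m x + 2 * of_real a * n x) - of_real a * n x))
                   - ((of_real (V x) + (of_real a)\<^sup>2) * U x * m x + U' x * n x)))"
      by (intro has_ac_derivative_mult has_ac_derivative_diff E U U' m_ac n
          has_ac_derivative_linear[OF _ bounded_linear_mult_right])
    also have "(\<lambda>x. - of_real a * E x * (U x * (n x - of_real a * m x) - U' x * m x) +
           E x * ((U' x * (n x - of_real a * m x) +
                     U x * ((of_real (V x) * m x + 2 * of_real a * n x) - of_real a * n x))
                   - ((of_real (V x) + (of_real a)\<^sup>2) * U x * m x + U' x * n x))) = (\<lambda>x. 0)"
      by (simp add: algebra_simps power2_eq_square)
    finally show ?thesis unfolding c_def by (rule has_ac_derivative_zero_const)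
  qed
  have "\<forall>\<^sub>F x in at_top. dist (m x) 1 < 1/2"
    using m_lim by (rule tendstoD) simp
  then obtain X where X: "\<And>x. x \<ge> X \<Longrightarrow> dist (m x) 1 < 1/2"
    by (auto simp: eventually_at_top_linorder)
  have m_ge: "norm (m x) \<ge> 1/2" if "x \<ge> X" for x
    using X[OF that] norm_triangle_ineq2[of 1 "1 - m x"] by (simp add: dist_norm norm_minus_commute)
  have m_nz: "m x \<noteq> 0" if "x \<ge> X" for x using m_ge[OF that] by auto
  define i where "i x = inverse (m x)" for x
  have m_i: "m x * i x = 1" if "x \<ge> X" for x using m_nz[OF that] by (simp add: i_def)
  have i_le: "norm (i x) \<le> 2" if "x \<ge> X" for x
    using le_imp_inverse_le[OF m_ge[OF that]] by (simp add: i_def norm_inverse)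
  have i_cont: "continuous_on {X..} i"
    unfolding i_def using m_nz continuous_at_imp_continuous_on[of _ m] mn_cont(1) by (intro continuous_intros) auto
  have "(\<lambda>x. i x * n x) absolutely_integrable_on {X..}"
  proof (rule absolutely_integrable_bounded_continuous_mult[OF i_cont])
    show "bounded (i ` {X..})" using i_le by (auto simp: bounded_iff)
  qed (use n_int in \<open>auto intro: integrable_imp_absolutely_integrable\<close>)
  then have nm_int: "(\<lambda>x. n x * i x) absolutely_integrable_on {X..}" by (simp add: mult.commute)
  have i_lim: "(i \<longlongrightarrow> 1) at_top"
    using tendsto_inverse[OF m_lim] by (simp add: i_def[abs_def])
  have nm_lim: "((\<lambda>x. n x * i x) \<longlongrightarrow> 0) at_top"
    using tendsto_mult[OF n_lim i_lim] by simp
  have a0: "complex_of_real a \<noteq> 0" using a by simp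
  \<comment> \<open>The constant Wronskian solved for \<open>U'\<close>; division by
    \<open>m\<close> is written as multiplication by \<open>i\<close>, its inverse near
    infinity.\<close>
  have EU': "E x * U' x = E x * U x * (n x * i x - of_real a) - c * i x" if "x \<ge> X" for x
  proof -
    have "E x * U' x = E x * U' x * (m x * i x)" by (simp add: m_i[OF that])
    also have "\<dots> = (E x * U x * (n x - of_real a * m x) - c) * i x"
      unfolding c[of x, symmetric] by (simp add: algebra_simps)
    also have "\<dots> = E x * U x * (n x * i x - of_real a * (m x * i x)) - c * i x"
      by (simp add: algebra_simps)
    finally show ?thesis by (simp add: m_i[OF that])
  qed
  \<comment> \<open>In both cases \<open>w - s\<close> itself is integrable at infinity and tends to
    0. This implies the claim because \<open>a^2 - w^2\<close> is \<open>- (w + s)\<close> times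
    \<open>w - s\<close> and \<open>w + s\<close> is bounded.\<close>
  have "\<exists>s Y d. \<bar>s\<bar> = a \<and> d absolutely_integrable_on {Y..} \<and> (d \<longlongrightarrow> 0) at_top \<and>
          (\<forall>x\<ge>Y. complex_of_real (w x - s) = d x)"
  proof (cases "c = 0")
    case True
    have "complex_of_real (w x - - a) = n x * i x" if "x \<ge> X" for x
    proof -
      have "U' x = U x * (n x * i x - of_real a)"
        using EU'[OF that] E_nz[of x] True by simp
      then show ?thesis using nz[of x] by (simp add: w_def U_def U'_def field_simps)
    qed
    then show ?thesis using nm_int nm_lim a by (intro exI[of _ "-a"] exI[of _ X] exI[of _ "\<lambda>x. n x * i x"]) auto
  next
    case False
    define b where "b = c / (2 * of_real a)"
    have b: "c = 2 * of_real a * b" using a0 by (simp add: b_def)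
    define r where "r x = E x * U x * i x" for x
    define y where "y x = r x + b * (i x * i x)" for x
    \<comment> \<open>The correction \<open>b * i^2\<close> in \<open>y\<close> removes the term
      \<open>c * i^2\<close> from the equation of \<open>r\<close> and leaves
      \<open>y' = - 2 * a * y - 2 * b * n * i^3\<close>, whose inhomogeneity is integrable since
      \<open>n\<close> is. The factor \<open>exp (2 * a * x)\<close> is the integrating
      factor.\<close>
    define q where "q x = exp (2 * of_real a * of_real x) * y x" for x
    have Uv: "(U has_vector_derivative U' x) (at x)" for x
      by (rule has_ac_derivative_imp_vector_derivative[OF U has_ac_derivative_continuous[OF U']])
    have Ev: "((\<lambda>x. exp (2 * of_real a * complex_of_real x)) has_vector_derivative
        2 * of_real a * exp (2 * of_real a * of_real x)) (at x)" for x
      by (rule has_vector_derivative_exp_of_real)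
    have i_deriv: "(i has_vector_derivative - (n x * (i x * i x))) (at x)" if "x \<ge> X" for x
    proof -
      have "(inverse has_field_derivative - (inverse (m x) ^ Suc (Suc 0))) (at (m x))"
        using m_nz[OF that] by (intro DERIV_inverse)
      from field_vector_diff_chain_at[OF m[of x] this] show ?thesis
        by (simp add: o_def i_def[abs_def])
    qed
    have q_deriv: "(q has_vector_derivative - (2 * b * exp (2 * of_real a * of_real x) * n x * (i x * i x * i x))) (at x)"
      if "x \<ge> X" for x
    proof -
      have "(q has_vector_derivative
          exp (2 * of_real a * of_real x) *
            ((E x * U x * - (n x * (i x * i x)) + (E x * U' x + - of_real a * E x * U x) * i x)
             + b * (i x * - (n x * (i x * i x)) + - (n x * (i x * i x)) * i x))
          + 2 * of_real a * exp (2 * of_real a * of_real x) *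
            (E x * U x * i x + b * (i x * i x))) (at x)"
        unfolding q_def y_def r_def
        by (intro has_vector_derivative_mult has_vector_derivative_add Ev E_deriv Uv i_deriv[OF that]
            has_vector_derivative_mult_right)
      then show ?thesis
        unfolding EU'[OF that] b by (simp add: algebra_simps)
    qed
    \<comment> \<open>The coefficient \<open>2 * norm b\<close> of \<open>q'\<close> times the bound
      8 for \<open>norm (i t)^3\<close>.\<close>
    define K where "K = 16 * norm b"
    define N where "N s = (LINT t|lebesgue. exp (- (2 * a * \<bar>s - t\<bar>)) * norm (n t))" for s
    have kn_int: "integrable lebesgue (\<lambda>t. exp (- (2 * a * \<bar>s - t\<bar>)) * norm (n t))" for s
      using integrable_exp_mult[of "2 * a" "\<lambda>t. norm (n t)" s] a n_int by simp
    \<comment> \<open>An exponential plus a convolution of \<open>norm n\<close> with the two-sided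
      kernel: both are integrable at infinity and both tend to 0, which yields \<open>y_int\<close>
      and \<open>y_lim\<close> at once.\<close>
    have y_le: "norm (y x) \<le> exp (- (2 * a * (x - X))) * norm (y X) + K * N x" if "x \<ge> X" for x
    proof -
      let ?q' = "\<lambda>t. - (2 * b * exp (2 * of_real a * of_real t) * n t * (i t * i t * i t))"
      let ?e = "complex_of_real (exp (- (2 * a * x)))"
      have "(?q' has_integral q x - q X) {X..x}"
        using that q_deriv by (intro fundamental_theorem_of_calculus) (auto intro: has_vector_derivative_at_within)
      then have I: "((\<lambda>t. ?e * ?q' t) has_integral ?e * (q x - q X)) {X..x}"
        by (rule has_integral_mult_right)
      have "norm (?e * (q x - q X)) \<le> integral {X..x} (\<lambda>t. K * (exp (- (2 * a * \<bar>x - t\<bar>)) * norm (n t)))"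
        unfolding integral_unique[OF I, symmetric]
      proof (rule integral_norm_bound_integral)
        show "(\<lambda>t. K * (exp (- (2 * a * \<bar>x - t\<bar>)) * norm (n t))) integrable_on {X..x}"
          using integrable_imp_absolutely_integrable[OF kn_int, of "{X..x}" x]
          by (intro integrable_on_mult_right set_lebesgue_integral_eq_integral(1)) auto
        fix t assume t: "t \<in> {X..x}"
        have "norm (i t) * norm (i t) * norm (i t) \<le> 2 * 2 * 2"
          using i_le[of t] t by (intro mult_mono) auto
        then have "exp (- (2 * a * \<bar>x - t\<bar>)) * (2 * norm b) * norm (n t) * (norm (i t) * norm (i t) * norm (i t))
            \<le> exp (- (2 * a * \<bar>x - t\<bar>)) * (2 * norm b) * norm (n t) * 8"
          by (intro mult_left_mono) auto
        moreover have "norm (?e * ?q' t) = exp (- (2 * a * x)) * exp (2 * a * t) * (2 * norm b) * norm (n t) *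
            (norm (i t) * norm (i t) * norm (i t))"
          by (simp add: norm_mult)
        moreover have "exp (- (2 * a * x)) * exp (2 * a * t) = exp (- (2 * a * \<bar>x - t\<bar>))"
          using t by (simp add: algebra_simps flip: exp_add)
        ultimately show "norm (?e * ?q' t) \<le> K * (exp (- (2 * a * \<bar>x - t\<bar>)) * norm (n t))"
          by (simp add: K_def mult_ac)
      qed (use I in blast)
      also have "\<dots> \<le> integral UNIV (\<lambda>t. K * (exp (- (2 * a * \<bar>x - t\<bar>)) * norm (n t)))"
        using integrable_imp_absolutely_integrable[OF kn_int, of "{X..x}" x]
          integrable_imp_absolutely_integrable[OF kn_int, of UNIV x] a
        by (intro integral_subset_le integrable_on_mult_right set_lebesgue_integral_eq_integral(1)) (auto simp: K_def)
      also have "\<dots> = K * N x"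
        using integral_lebesgue[OF kn_int] by (simp add: N_def)
      finally have le: "norm (?e * (q x - q X)) \<le> K * N x" .
      have "?e * exp (2 * of_real a * of_real x) = 1"
        by (simp add: exp_of_real[symmetric] flip: exp_add)
      then have "?e * q x = y x" by (simp add: q_def mult.assoc[symmetric])
      then have "norm (y x) \<le> norm (?e * q X) + norm (?e * (q x - q X))"
        using norm_triangle_ineq[of "?e * q X" "?e * (q x - q X)"] by (simp add: algebra_simps)
      moreover have "norm (?e * q X) = exp (- (2 * a * (x - X))) * norm (y X)"
        by (simp add: q_def norm_mult algebra_simps flip: exp_add)
      ultimately show ?thesis using le by simp
    qed
    have r_cont: "continuous_on {X..} r" and y_cont: "continuous_on {X..} y"
      unfolding r_def y_def
      using has_ac_derivative_continuous_on[OF E] has_ac_derivative_continuous_on[OF U] i_cont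
      by (auto intro!: continuous_intros)
    have y_int: "y absolutely_integrable_on {X..}"
    proof (rule measurable_bounded_by_integrable_imp_absolutely_integrable)
      show "y \<in> borel_measurable (lebesgue_on {X..})"
        using y_cont by (intro continuous_imp_measurable_on_sets_lebesgue) auto
      have "(\<lambda>x. exp (- (2 * a) * x) * (exp (2 * a * X) * norm (y X))) integrable_on {X..}"
        using a by (intro integrable_on_mult_left integrable_on_exp_minus_to_infinity) auto
      moreover have "exp (- (2 * a) * x) * (exp (2 * a * X) * norm (y X)) = exp (- (2 * a * (x - X))) * norm (y X)" for x
        by (simp add: algebra_simps exp_diff exp_minus field_simps)
      ultimately have "(\<lambda>x. exp (- (2 * a * (x - X))) * norm (y X)) integrable_on {X..}"
        by (simp only:)
      moreover have "N integrable_on {X..}"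
        unfolding N_def using integrable_exp_convolution[of "2 * a" "\<lambda>t. norm (n t)"] a n_int
        by (intro set_lebesgue_integral_eq_integral(1) integrable_imp_absolutely_integrable) auto
      ultimately show "(\<lambda>x. exp (- (2 * a * (x - X))) * norm (y X) + K * N x) integrable_on {X..}"
        by (intro integrable_add integrable_on_mult_right)
    qed (use y_le in auto)
    have y_lim: "(y \<longlongrightarrow> 0) at_top"
    proof (rule Lim_null_comparison)
      show "\<forall>\<^sub>F x in at_top. norm (y x) \<le> exp (- (2 * a * (x - X))) * norm (y X) + K * N x"
        using eventually_ge_at_top[of X] by eventually_elim (rule y_le)
      have "((\<lambda>x. exp (- (2 * a * (x - X)))) \<longlongrightarrow> 0) at_top" using a by real_asymp
      moreover have "(N \<longlongrightarrow> 0) at_top"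
        unfolding N_def using exp_convolution_tendsto_0[of "2 * a" "\<lambda>t. norm (n t)"] a n_int by simp
      ultimately have "((\<lambda>x. exp (- (2 * a * (x - X))) * norm (y X) + K * N x) \<longlongrightarrow> 0 * norm (y X) + K * 0) at_top"
        by (intro tendsto_intros)
      then show "((\<lambda>x. exp (- (2 * a * (x - X))) * norm (y X) + K * N x) \<longlongrightarrow> 0) at_top" by simp
    qed
    \<comment> \<open>The limit of \<open>r = y - b * i^2\<close>, as \<open>y\<close> tends to 0
      and \<open>i\<close> to 1. It is nonzero because \<open>c\<close> is, so \<open>1 / r\<close>
      is bounded near infinity.\<close>
    define r0 where "r0 = - b"
    have r0: "r0 \<noteq> 0" using False a0 by (simp add: r0_def b_def)
    have "((\<lambda>x. y x - b * (i x * i x)) \<longlongrightarrow> 0 - b * (1 * 1)) at_top"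
      by (intro tendsto_intros y_lim i_lim)
    then have r_lim: "(r \<longlongrightarrow> r0) at_top"
      by (simp add: y_def[abs_def] r0_def)
    have "((\<lambda>x. norm (r x)) \<longlongrightarrow> norm r0) at_top" by (intro tendsto_intros r_lim)
    then have "\<forall>\<^sub>F x in at_top. norm r0 / 2 < norm (r x)"
      by (rule order_tendstoD) (use r0 in auto)
    then obtain X' where X': "\<And>x. x \<ge> X' \<Longrightarrow> norm r0 / 2 < norm (r x)"
      by (auto simp: eventually_at_top_linorder)
    define Y where "Y = max X X'"
    have r_nz: "r x \<noteq> 0" if "x \<ge> Y" for x
      using X'[of x] that by (auto simp: Y_def)
    define d where "d x = n x * i x - 2 * of_real a * (1 / r x * y x)" for x
    have "(\<lambda>x. 1 / r x * y x) absolutely_integrable_on {Y..}"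
    proof (rule absolutely_integrable_bounded_continuous_mult)
      show "continuous_on {Y..} (\<lambda>x. 1 / r x)"
        using r_nz continuous_on_subset[OF r_cont, of "{Y..}"] by (intro continuous_intros) (auto simp: Y_def)
      have "norm (1 / r x) \<le> 2 / norm r0" if "x \<ge> Y" for x
        using le_imp_inverse_le[of "norm r0 / 2" "norm (r x)"] X'[of x] that r0
        by (simp add: norm_divide inverse_eq_divide Y_def)
      then show "bounded ((\<lambda>x. 1 / r x) ` {Y..})" by (auto simp: bounded_iff)
      show "y absolutely_integrable_on {Y..}"
        using y_int by (rule absolutely_integrable_subset_Ici) (simp add: Y_def)
    qed simp
    moreover have "(\<lambda>x. n x * i x) absolutely_integrable_on {Y..}"
      using nm_int by (rule absolutely_integrable_subset_Ici) (simp add: Y_def)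
    ultimately have d_int: "d absolutely_integrable_on {Y..}"
      unfolding d_def by (intro set_integral_diff set_integrable_mult_right) auto
    have "(d \<longlongrightarrow> 0 - 2 * of_real a * (1 / r0 * 0)) at_top"
      unfolding d_def by (intro tendsto_intros nm_lim r_lim r0 y_lim)
    then have d_lim: "(d \<longlongrightarrow> 0) at_top" by simp
    have "complex_of_real (w x - a) = d x" if "x \<ge> Y" for x
    proof -
      have "x \<ge> X" using that by (simp add: Y_def)
      have yr: "b * (i x * i x) / r x = 1 / r x * y x - 1"
        using r_nz[OF that] by (simp add: y_def field_simps)
      have i_r: "i x / (E x * U x) = i x * i x / r x"
        using r_nz[OF that] by (simp add: r_def)
      have "U' x / U x = E x * U' x / (E x * U x)"
        using E_nz[of x] by simp
      also have "\<dots> = n x * i x - of_real a - c * (i x / (E x * U x))"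
        unfolding EU'[OF \<open>x \<ge> X\<close>] using E_nz[of x] U_nz[of x] by (simp add: diff_divide_distrib)
      also have "c * (i x / (E x * U x)) = 2 * of_real a * (b * (i x * i x) / r x)"
        unfolding i_r b by simp
      also have "\<dots> = 2 * of_real a * (1 / r x * y x) - 2 * of_real a"
        unfolding yr by (simp add: right_diff_distrib)
      finally show ?thesis
        by (simp add: w_def U_def U'_def d_def)
    qed
    then show ?thesis using d_int d_lim a by (intro exI[of _ a] exI[of _ Y] exI[of _ d]) auto
  qed
  then obtain s Y d where s: "\<bar>s\<bar> = a" and d: "d absolutely_integrable_on {Y..}" "(d \<longlongrightarrow> 0) at_top"
    and wd: "\<And>x. x \<ge> Y \<Longrightarrow> complex_of_real (w x - s) = d x"
    by blast
  have Re_d: "Re (d x) = w x - s" if "x \<ge> Y" for x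
    using wd[OF that] by (metis Re_complex_of_real)
  have "((\<lambda>x. Re (d x) + s) \<longlongrightarrow> Re 0 + s) at_top" by (intro tendsto_intros d(2))
  then have "((\<lambda>x. Re (d x) + s) \<longlongrightarrow> s) at_top" by simp
  then have w_lim: "(w \<longlongrightarrow> s) at_top"
  proof (rule Lim_transform_eventually)
    show "\<forall>\<^sub>F x in at_top. Re (d x) + s = w x"
      using eventually_ge_at_top[of Y] by eventually_elim (simp add: Re_d)
  qed
  have "\<forall>\<^sub>F x in at_top. dist (w x) s < 1" using w_lim by (rule tendstoD) simp
  then obtain Z where Z: "\<And>x. x \<ge> Z \<Longrightarrow> dist (w x) s < 1" by (auto simp: eventually_at_top_linorder)
  define T where "T = max Y Z"
  have "(\<lambda>x. Re (d x)) absolutely_integrable_on {Y..}"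
    using absolutely_integrable_linear[OF d(1) bounded_linear_Re] by (simp add: o_def)
  then have "(\<lambda>x. Re (d x)) absolutely_integrable_on {T..}"
    by (rule absolutely_integrable_subset_Ici) (simp add: T_def)
  then have "(\<lambda>x. w x - s) absolutely_integrable_on {T..}"
    by (rule absolutely_integrable_spike[where S = "{}"]) (auto simp: Re_d T_def)
  then have "(\<lambda>x. - (w x + s) * (w x - s)) absolutely_integrable_on {T..}"
  proof (rule absolutely_integrable_bounded_continuous_mult[rotated 3])
    show "continuous_on {T..} (\<lambda>x. - (w x + s))"
      using w_cont by (intro continuous_intros) (auto intro: continuous_on_subset)
    have "norm (- (w x + s)) \<le> 2 * \<bar>s\<bar> + 1" if "x \<ge> T" for x
      using Z[of x] that by (simp add: T_def dist_real_def)
    then show "bounded ((\<lambda>x. - (w x + s)) ` {T..})" by (auto simp: bounded_iff)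
  qed simp
  moreover have "- (w x + s) * (w x - s) = a\<^sup>2 - (w x)\<^sup>2" for x
    unfolding s[symmetric] power2_abs by (simp add: power2_eq_square algebra_simps)
  ultimately have "(\<lambda>x. a\<^sup>2 - (w x)\<^sup>2) absolutely_integrable_on {T..}" by simp
  then have "(\<lambda>x. a\<^sup>2 - (w x)\<^sup>2) absolutely_integrable_on {b..}"
    by (rule absolutely_integrable_on_Ici_continuous) (intro continuous_intros w_cont)
  then show ?thesis using s w_lim by blast
qed


section \<open>Solutions under the supersymmetric transformation\<close>

lemma integrable_of_halves:
  fixes h :: "real \<Rightarrow> 'a::euclidean_space"
  assumes "h absolutely_integrable_on {0..}" "(\<lambda>x. h (- x)) absolutely_integrable_on {0..}"
  shows "integrable lebesgue h"
proof -
  have "integrable lebesgue (\<lambda>x. indicator {0..} x *\<^sub>R h (- x))"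
    using assms(2) by (simp add: set_integrable_def)
  then have "integrable lebesgue (\<lambda>x. indicator {0..} (- x) *\<^sub>R h x)"
    using integrable_lebesgue_reflect(1)[of "\<lambda>x. indicator {0..} (- x) *\<^sub>R h x"] by simp
  also have "(\<lambda>x. indicator {0..} (- x) *\<^sub>R h x) = (\<lambda>x. indicator {..0} x *\<^sub>R h x)"
    by (auto simp: indicator_def)
  finally have "h absolutely_integrable_on {..0}" by (simp add: set_integrable_def)
  from absolutely_integrable_Un[OF this assms(1)] have "h absolutely_integrable_on ({..0} \<union> {0..})" .
  moreover have "{..0} \<union> {0..} = (UNIV :: real set)" by auto
  ultimately show ?thesis by (simp add: absolutely_integrable_UNIV_iff)
qed

lemma not_square_integrable_of_log_derivative:
  fixes f f' :: "real \<Rightarrow> real"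
  assumes f: "\<And>x. (f has_real_derivative f' x) (at x)" and nz: "\<And>x. f x \<noteq> 0"
    and lim: "((\<lambda>x. f' x / f x) \<longlongrightarrow> s) at_top" and s: "s > 0"
  shows "\<not> integrable lebesgue (\<lambda>x. (f x)\<^sup>2)"
proof
  assume i: "integrable lebesgue (\<lambda>x. (f x)\<^sup>2)"
  obtain X c where c: "c > 0" and X: "\<And>x. x \<ge> X \<Longrightarrow> c * exp (s * x) \<le> (f x)\<^sup>2"
    using exp_growth_of_log_derivative[OF f nz lim s] by blast
  have "\<forall>\<^sub>F x in at_top. c * exp (s * X) \<le> norm ((f x)\<^sup>2)"
    using eventually_ge_at_top[of X]
  proof eventually_elim
    case (elim x)
    have "c * exp (s * X) \<le> c * exp (s * x)" using elim s c by simp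
    with X[OF elim] show ?case by simp
  qed
  from integrable_not_eventually_ge[OF i this] c show False
    by (simp add: mult_le_0_iff not_le)
qed

text \<open>The reciprocal of \<open>f\<close> has a logarithmic derivative tending to
  \<open>s > 0\<close>, so it grows exponentially, and the growth bound inverted dominates
  \<open>f^2\<close> by a decaying exponential.\<close>

lemma half_square_integrable_of_log_derivative:
  fixes f f' :: "real \<Rightarrow> real"
  assumes f: "\<And>x. (f has_real_derivative f' x) (at x)" and nz: "\<And>x. f x \<noteq> 0"
    and lim: "((\<lambda>x. f' x / f x) \<longlongrightarrow> - s) at_top" and s: "s > 0"
  shows "(\<lambda>x. (f x)\<^sup>2) absolutely_integrable_on {0..}"
proof -
  have inv: "((\<lambda>x. inverse (f x)) has_real_derivative - (f' x / (f x)\<^sup>2)) (at x)" for x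
    using nz by (auto intro!: derivative_eq_intros f simp: power2_eq_square divide_inverse)
  have "- (f' x / (f x)\<^sup>2) / inverse (f x) = - (f' x / f x)" for x
    using nz by (simp add: power2_eq_square field_simps)
  then have inv_lim: "((\<lambda>x. - (f' x / (f x)\<^sup>2) / inverse (f x)) \<longlongrightarrow> s) at_top"
    using tendsto_minus[OF lim] by (simp only: minus_minus)
  have inv_nz: "inverse (f x) \<noteq> 0" for x using nz by simp
  obtain X c where c: "c > 0" and X: "\<And>x. x \<ge> X \<Longrightarrow> c * exp (s * x) \<le> (inverse (f x))\<^sup>2"
    using exp_growth_of_log_derivative[OF inv inv_nz inv_lim s] by blast
  have cf: "continuous_on S (\<lambda>x. (f x)\<^sup>2)" for S
    using f DERIV_isCont by (intro continuous_intros continuous_at_imp_continuous_on) blast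
  have "(\<lambda>x. (f x)\<^sup>2) absolutely_integrable_on {X..}"
  proof (rule measurable_bounded_by_integrable_imp_absolutely_integrable)
    show "(\<lambda>x. (f x)\<^sup>2) \<in> borel_measurable (lebesgue_on {X..})"
      by (intro continuous_imp_measurable_on_sets_lebesgue cf) auto
    show "(\<lambda>x. exp (- s * x) * inverse c) integrable_on {X..}"
      using s by (intro integrable_on_mult_left integrable_on_exp_minus_to_infinity)
    show "norm ((f x)\<^sup>2) \<le> exp (- s * x) * inverse c" if "x \<in> {X..}" for x
    proof -
      have "inverse ((inverse (f x))\<^sup>2) \<le> inverse (c * exp (s * x))"
        using X[of x] that c by (intro le_imp_inverse_le) auto
      then show ?thesis by (simp add: power_inverse exp_minus mult.commute)
    qed
  qed auto
  then show ?thesis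
    by (rule absolutely_integrable_on_Ici_continuous) (rule cf)
qed

lemma has_real_derivative_reflect:
  fixes f f' :: "real \<Rightarrow> real"
  assumes "\<And>x. (f has_real_derivative f' x) (at x)"
  shows "((\<lambda>x. f (- x)) has_real_derivative - f' (- x)) (at x)"
  using DERIV_mirror[of f "f' (- x)" x] assms by simp

lemma square_integrable_of_log_derivative:
  fixes f f' :: "real \<Rightarrow> real"
  assumes f: "\<And>x. (f has_real_derivative f' x) (at x)" and nz: "\<And>x. f x \<noteq> 0" and s: "s > 0"
    and top: "((\<lambda>x. f' x / f x) \<longlongrightarrow> - s) at_top" and bot: "((\<lambda>x. f' x / f x) \<longlongrightarrow> s) at_bot"
  shows "integrable lebesgue (\<lambda>x. (f x)\<^sup>2)"
proof (rule integrable_of_halves)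
  show "(\<lambda>x. (f x)\<^sup>2) absolutely_integrable_on {0..}"
    by (rule half_square_integrable_of_log_derivative[OF f nz top s])
  have "((\<lambda>x. - (f' (- x) / f (- x))) \<longlongrightarrow> - s) at_top"
    using bot unfolding tendsto_at_bot_reflect by (rule tendsto_minus)
  then show "(\<lambda>x. (f (- x))\<^sup>2) absolutely_integrable_on {0..}"
    using nz by (intro half_square_integrable_of_log_derivative[OF has_real_derivative_reflect[OF f] _ _ s]) auto
qed

lemma bounded_range_of_limits:
  fixes f :: "real \<Rightarrow> real"
  assumes c: "continuous_on UNIV f" and "(f \<longlongrightarrow> p) at_top" "(f \<longlongrightarrow> q) at_bot"
  shows "bounded (range f)"
proof -
  have "\<forall>\<^sub>F x in at_top. dist (f x) p < 1" "\<forall>\<^sub>F x in at_bot. dist (f x) q < 1"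
    by (rule tendstoD[OF assms(2) zero_less_one], rule tendstoD[OF assms(3) zero_less_one])
  then obtain X Y where XY: "\<And>x. x \<ge> X \<Longrightarrow> dist (f x) p < 1" "\<And>x. x \<le> Y \<Longrightarrow> dist (f x) q < 1"
    by (auto simp: eventually_at_top_linorder eventually_at_bot_linorder)
  have "range f \<subseteq> ball p 1 \<union> ball q 1 \<union> f ` {Y..X}"
  proof
    fix y assume "y \<in> range f"
    then obtain x where x: "y = f x" by blast
    consider "x \<ge> X" | "x \<le> Y" | "x \<in> {Y..X}" by fastforce
    then show "y \<in> ball p 1 \<union> ball q 1 \<union> f ` {Y..X}"
      by cases (use XY[of x] x in \<open>auto simp: dist_commute\<close>)
  qed
  moreover have "bounded (f ` {Y..X})"
    by (intro compact_imp_bounded compact_continuous_image continuous_on_subset[OF c]) auto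
  ultimately show ?thesis
    by (meson bounded_Un bounded_ball bounded_subset)
qed

text \<open>For the right-hand side 0 both \<open>f\<close> and the zero function solve the
  resolvent equation, so uniqueness fails at \<open>z\<close>.\<close>

lemma homogeneous_solution_in_spec:
  assumes f: "(f, \<lambda>x. z * f x) \<in> schroedinger V" and nz: "f x0 \<noteq> 0"
  shows "z \<in> spec V"
proof (rule ccontr)
  have zero: "(\<lambda>x. 0) \<in> L2" by (simp add: L2_def)
  have zero_sol: "((\<lambda>x. 0), \<lambda>x. 0 + z * 0) \<in> schroedinger V"
    using zero by (auto simp: schroedinger_def intro!: exI[of _ "\<lambda>x. 0"] has_ac_derivative_const)
  assume "z \<notin> spec V"
  then have *: "\<forall>g\<in>L2. \<exists>!f. (f, \<lambda>x. g x + z * f x) \<in> schroedinger V"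
    by (simp add: spec_def)
  define P where "P h \<longleftrightarrow> (h, \<lambda>x. 0 + z * h x) \<in> schroedinger V" for h
  have "\<exists>!h. P h" using bspec[OF * zero] by (simp add: P_def)
  moreover have "P f" "P (\<lambda>x. 0)" using f zero_sol by (simp_all add: P_def)
  ultimately have "f = (\<lambda>x. 0)" by metis
  with nz show False by simp
qed

lemma L2_of_real:
  assumes "continuous_on UNIV f" "integrable lebesgue (\<lambda>x. (f x)\<^sup>2)"
  shows "(\<lambda>x. complex_of_real (f x)) \<in> L2"
  using assms by (intro L2_I continuous_imp_lebesgue_measurable continuous_intros) auto

text \<open>Makes a real square-integrable solution an element of the operator graph; in the
  isospectral case it is applied to \<open>u\<close> and to \<open>1 / u\<close>, each time towards
  a contradiction.\<close>

lemma schroedinger_of_real: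
  assumes f: "\<And>x. (f has_real_derivative f' x) (at x)" and f': "has_ac_derivative f' (\<lambda>x. (V x - \<mu>) * f x)"
    and i: "integrable lebesgue (\<lambda>x. (f x)\<^sup>2)"
  shows "((\<lambda>x. of_real (f x)), \<lambda>x. of_real \<mu> * of_real (f x)) \<in> schroedinger V"
proof -
  have "continuous_on UNIV f"
    using f DERIV_isCont continuous_at_imp_continuous_on by blast
  then have L: "(\<lambda>x. complex_of_real (f x)) \<in> L2"
    using i by (rule L2_of_real)
  have "((\<lambda>x. complex_of_real (f x)) has_vector_derivative of_real (f' x)) (at x)" for x
    using f[of x] by (intro has_vector_derivative_of_real) (simp add: has_real_derivative_iff_has_vector_derivative)
  moreover have "has_ac_derivative (\<lambda>x. complex_of_real (f' x))
      (\<lambda>x. of_real (V x) * of_real (f x) - of_real \<mu> * of_real (f x))"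
    using has_ac_derivative_linear[OF f' bounded_linear_of_real[where 'a=complex]]
    by (simp add: algebra_simps)
  ultimately show ?thesis
    unfolding schroedinger_def using L L2_mult[OF L]
    by (auto intro!: exI[of _ "\<lambda>x. complex_of_real (f' x)"])
qed

section \<open>Jost solutions and their images under the intertwining operator\<close>

definition jost_solution :: "complex \<Rightarrow> (real \<Rightarrow> complex) \<Rightarrow> real \<Rightarrow> complex" where
  "jost_solution \<kappa> m x = exp (\<i> * \<kappa> * of_real x) * m x"

definition jost_solution' :: "complex \<Rightarrow> (real \<Rightarrow> complex) \<Rightarrow> (real \<Rightarrow> complex) \<Rightarrow> real \<Rightarrow> complex" where
  "jost_solution' \<kappa> m n x = exp (\<i> * \<kappa> * of_real x) * (\<i> * \<kappa> * m x + n x)"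

lemma jost_solution:
  assumes j: "jost_factor V \<kappa> m n"
  shows "(jost_solution \<kappa> m has_vector_derivative jost_solution' \<kappa> m n x) (at x)"
    and "has_ac_derivative (jost_solution' \<kappa> m n) (\<lambda>x. (of_real (V x) - \<kappa>\<^sup>2) * jost_solution \<kappa> m x)"
    and "\<exists>B. \<forall>x. cmod (jost_solution \<kappa> m x) \<le> B * exp (- (Im \<kappa> * x)) \<and>
               cmod (jost_solution' \<kappa> m n x) \<le> B * exp (- (Im \<kappa> * x))"
proof -
  have m: "\<And>x. (m has_vector_derivative n x) (at x)"
    and n: "has_ac_derivative n (\<lambda>x. of_real (V x) * m x - 2 * \<i> * \<kappa> * n x)"
    and "bounded (range m)" "bounded (range n)"
    using j by (auto simp: jost_factor_def)
  note e = has_vector_derivative_exp_of_real[of "\<i> * \<kappa>"]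
  have "(jost_solution \<kappa> m has_vector_derivative
      exp (\<i> * \<kappa> * of_real x) * n x + \<i> * \<kappa> * exp (\<i> * \<kappa> * of_real x) * m x) (at x)"
    unfolding jost_solution_def[abs_def] by (intro has_vector_derivative_mult e m)
  then show "(jost_solution \<kappa> m has_vector_derivative jost_solution' \<kappa> m n x) (at x)"
    by (simp add: jost_solution'_def algebra_simps)
  have m_ac: "has_ac_derivative m n"
    using m jost_factor_continuous(2)[OF j] by (rule has_ac_derivative_of_vector_derivative)
  have e_ac: "has_ac_derivative (\<lambda>x. exp (\<i> * \<kappa> * of_real x)) (\<lambda>x. \<i> * \<kappa> * exp (\<i> * \<kappa> * of_real x))"
    using e by (rule has_ac_derivative_of_vector_derivative) (auto intro!: continuous_intros)
  have "has_ac_derivative (jost_solution' \<kappa> m n) (\<lambda>x. \<i> * \<kappa> * exp (\<i> * \<kappa> * of_real x) * (\<i> * \<kappa> * m x + n x) +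
      exp (\<i> * \<kappa> * of_real x) * (\<i> * \<kappa> * n x + (of_real (V x) * m x - 2 * \<i> * \<kappa> * n x)))"
    unfolding jost_solution'_def[abs_def]
    by (intro has_ac_derivative_mult has_ac_derivative_add e_ac n
        has_ac_derivative_linear[OF m_ac bounded_linear_mult_right])
  also have "(\<lambda>x. \<i> * \<kappa> * exp (\<i> * \<kappa> * of_real x) * (\<i> * \<kappa> * m x + n x) +
      exp (\<i> * \<kappa> * of_real x) * (\<i> * \<kappa> * n x + (of_real (V x) * m x - 2 * \<i> * \<kappa> * n x)))
      = (\<lambda>x. (of_real (V x) - \<kappa>\<^sup>2) * jost_solution \<kappa> m x)"
  proof
    fix x
    show "\<i> * \<kappa> * exp (\<i> * \<kappa> * of_real x) * (\<i> * \<kappa> * m x + n x) +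
      exp (\<i> * \<kappa> * of_real x) * (\<i> * \<kappa> * n x + (of_real (V x) * m x - 2 * \<i> * \<kappa> * n x))
      = (of_real (V x) - \<kappa>\<^sup>2) * jost_solution \<kappa> m x"
      by (simp add: jost_solution_def algebra_simps power2_eq_square)
  qed
  finally show "has_ac_derivative (jost_solution' \<kappa> m n) (\<lambda>x. (of_real (V x) - \<kappa>\<^sup>2) * jost_solution \<kappa> m x)" .
  obtain M N where M: "\<And>x. cmod (m x) \<le> M" and N: "\<And>x. cmod (n x) \<le> N"
    using \<open>bounded (range m)\<close> \<open>bounded (range n)\<close> by (auto simp: bounded_iff)
  have "M \<ge> 0" "N \<ge> 0" using order_trans[OF norm_ge_zero M[of 0]] order_trans[OF norm_ge_zero N[of 0]] by auto
  define B where "B = M + cmod \<kappa> * M + N"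
  have "cmod (m x) \<le> B" for x
    using M[of x] \<open>M \<ge> 0\<close> \<open>N \<ge> 0\<close> unfolding B_def by (smt (verit) mult_nonneg_nonneg norm_ge_zero)
  moreover have "cmod (\<i> * \<kappa> * m x + n x) \<le> B" for x
  proof -
    have "cmod (\<i> * \<kappa> * m x + n x) \<le> cmod \<kappa> * cmod (m x) + cmod (n x)"
      using norm_triangle_ineq[of "\<i> * \<kappa> * m x" "n x"] by (simp add: norm_mult)
    also have "\<dots> \<le> cmod \<kappa> * M + N" using M N by (intro add_mono mult_left_mono) auto
    finally show ?thesis using \<open>M \<ge> 0\<close> by (simp add: B_def)
  qed
  ultimately show "\<exists>B. \<forall>x. cmod (jost_solution \<kappa> m x) \<le> B * exp (- (Im \<kappa> * x)) \<and>
               cmod (jost_solution' \<kappa> m n x) \<le> B * exp (- (Im \<kappa> * x))"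
    by (intro exI[of _ B]) (auto simp: jost_solution_def jost_solution'_def norm_mult mult.commute[of B] intro!: mult_left_mono)
qed

text \<open>\<open>F = L f\<close> with the intertwining operator \<open>L = - d/dx + w\<close>.\<close>

lemma susy_transformed_solution:
  fixes V w w' :: "real \<Rightarrow> real" and f f' :: "real \<Rightarrow> complex" and a :: real
  assumes f: "\<And>x. (f has_vector_derivative f' x) (at x)"
    and f': "has_ac_derivative f' (\<lambda>x. (of_real (V x) - z) * f x)"
    and w: "has_ac_derivative w w'" and riccati: "AE x in lebesgue. w' x = V x + a\<^sup>2 - (w x)\<^sup>2"
  defines "F \<equiv> \<lambda>x. of_real (w x) * f x - f' x"
  defines "F' \<equiv> \<lambda>x. (z + (of_real a)\<^sup>2) * f x - of_real (w x) * F x"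
  shows "(F has_vector_derivative F' x) (at x)"
    and "has_ac_derivative F' (\<lambda>x. (of_real (V x - 2 * w' x) - z) * F x)"
proof -
  have w_ac: "has_ac_derivative (\<lambda>x. complex_of_real (w x)) (\<lambda>x. of_real (w' x))"
    by (rule has_ac_derivative_linear[OF w bounded_linear_of_real])
  have f_ac: "has_ac_derivative f f'"
    using f has_ac_derivative_continuous[OF f'] by (rule has_ac_derivative_of_vector_derivative)
  have V_eq: "AE x in lebesgue. complex_of_real (V x) = of_real (w' x) + (of_real (w x))\<^sup>2 - (of_real a)\<^sup>2"
    using riccati
  proof eventually_elim
    case (elim x)
    then have "V x = w' x + (w x)\<^sup>2 - a\<^sup>2" by simp
    then show ?case by simp
  qed
  have "has_ac_derivative F
     (\<lambda>x. (of_real (w' x) * f x + of_real (w x) * f' x) - (of_real (V x) - z) * f x)"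
    unfolding F_def by (intro has_ac_derivative_diff has_ac_derivative_mult w_ac f_ac f')
  \<comment> \<open>The definition of \<open>F'\<close> encodes the factorization: the adjoint of
    \<open>L\<close> applied to \<open>F\<close> is \<open>F' + w * F = (z + a^2) * f\<close>. Thus
    \<open>F'\<close> contains \<open>w\<close> but not \<open>w'\<close>, so it is again absolutely
    continuous; eliminating \<open>V\<close> by the Riccati equation confirms it.\<close>
  then have F_ac: "has_ac_derivative F F'"
  proof (rule has_ac_derivative_AE)
    show "AE x in lebesgue. (of_real (w' x) * f x + of_real (w x) * f' x) - (of_real (V x) - z) * f x = F' x"
      using V_eq
    proof eventually_elim
      case (elim x)
      show ?case unfolding F_def F'_def elim by (simp add: algebra_simps power2_eq_square)
    qed
  qed
  have "has_ac_derivative F' (\<lambda>x. (z + (of_real a)\<^sup>2) * f' x - (of_real (w' x) * F x + of_real (w x) * F' x))"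
    unfolding F'_def
    by (intro has_ac_derivative_diff has_ac_derivative_mult w_ac F_ac[unfolded F'_def]
        has_ac_derivative_linear[OF f_ac bounded_linear_mult_right])
  then show F'_ac: "has_ac_derivative F' (\<lambda>x. (of_real (V x - 2 * w' x) - z) * F x)"
  proof (rule has_ac_derivative_AE)
    show "AE x in lebesgue. (z + (of_real a)\<^sup>2) * f' x - (of_real (w' x) * F x + of_real (w x) * F' x)
        = (of_real (V x - 2 * w' x) - z) * F x"
      using V_eq
    proof eventually_elim
      case (elim x)
      show ?case
        unfolding F_def F'_def of_real_diff elim by (simp add: algebra_simps power2_eq_square)
    qed
  qed
  show "(F has_vector_derivative F' x) (at x)"
    by (rule has_ac_derivative_imp_vector_derivative[OF F_ac has_ac_derivative_continuous[OF F'_ac]])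
qed


section \<open>The difference of the Green functions\<close>

lemma bounded_range_mult:
  fixes f g :: "'a \<Rightarrow> 'b::real_normed_algebra"
  assumes "bounded (range f)" "bounded (range g)"
  shows "bounded (range (\<lambda>x. f x * g x))"
proof -
  obtain A B where A: "\<And>x. norm (f x) \<le> A" and B: "\<And>x. norm (g x) \<le> B"
    using assms by (auto simp: bounded_iff)
  have "norm (f x * g x) \<le> A * B" for x
    by (rule order_trans[OF norm_mult_ineq])
       (intro mult_mono A B norm_ge_zero order_trans[OF norm_ge_zero A])
  then show ?thesis by (auto simp: bounded_iff)
qed

lemma bounded_range_reflect:
  fixes f :: "real \<Rightarrow> 'a::metric_space"
  shows "bounded (range f) \<Longrightarrow> bounded (range (\<lambda>x. f (- x)))"
  by (erule bounded_subset) auto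

lemma has_vector_derivative_reflect:
  assumes "\<And>x. (f has_vector_derivative f' x) (at x)"
  shows "((\<lambda>x. f (- x)) has_vector_derivative - f' (- x)) (at x)"
proof -
  have "((\<lambda>x. - x) has_vector_derivative - 1) (at x)"
    by (auto intro!: derivative_eq_intros)
  from vector_diff_chain_at[OF this assms[of "- x"]] show ?thesis by (simp add: o_def)
qed

text \<open>The solution decaying at the left end is the mirrored Jost solution of the mirrored
  potential, so one existence theorem and one set of estimates serve both ends.\<close>

locale jost_pair =
  fixes V :: "real \<Rightarrow> real" and \<kappa> :: complex and m n mr nr :: "real \<Rightarrow> complex"
  assumes V: "integrable lebesgue V" and \<kappa>: "Im \<kappa> > 0"
    and j: "jost_factor V \<kappa> m n" and jr: "jost_factor (\<lambda>x. V (- x)) \<kappa> mr nr"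
begin

definition fp :: "real \<Rightarrow> complex" where "fp = jost_solution \<kappa> m"
definition fp' :: "real \<Rightarrow> complex" where "fp' = jost_solution' \<kappa> m n"
definition fm :: "real \<Rightarrow> complex" where "fm x = jost_solution \<kappa> mr (- x)"
definition fm' :: "real \<Rightarrow> complex" where "fm' x = - jost_solution' \<kappa> mr nr (- x)"
definition W :: complex where "W = fm 0 * fp' 0 - fm' 0 * fp 0"

lemma Vr: "integrable lebesgue (\<lambda>x. V (- x))"
  using V integrable_lebesgue_reflect(1) by blast

lemma fp_deriv: "(fp has_vector_derivative fp' x) (at x)"
  unfolding fp_def fp'_def by (rule jost_solution(1)[OF j])

lemma fp'_ac: "has_ac_derivative fp' (\<lambda>x. (of_real (V x) - \<kappa>\<^sup>2) * fp x)"
  unfolding fp_def fp'_def by (rule jost_solution(2)[OF j])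

lemma fm_deriv: "(fm has_vector_derivative fm' x) (at x)"
  unfolding fm_def fm'_def by (rule has_vector_derivative_reflect) (rule jost_solution(1)[OF jr])

lemma fm'_ac: "has_ac_derivative fm' (\<lambda>x. (of_real (V x) - \<kappa>\<^sup>2) * fm x)"
  using has_ac_derivative_minus[OF has_ac_derivative_reflect[OF jost_solution(2)[OF jr]]]
  by (simp add: fm_def[abs_def] fm'_def[abs_def])

lemma fp_ac: "has_ac_derivative fp fp'"
  using fp_deriv has_ac_derivative_continuous[OF fp'_ac] by (rule has_ac_derivative_of_vector_derivative)

lemma fm_ac: "has_ac_derivative fm fm'"
  using fm_deriv has_ac_derivative_continuous[OF fm'_ac] by (rule has_ac_derivative_of_vector_derivative)

lemma solution_bounds:
  "\<exists>B. \<forall>x. cmod (fp x) \<le> B * exp (- (Im \<kappa> * x)) \<and> cmod (fp' x) \<le> B * exp (- (Im \<kappa> * x)) \<and>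
           cmod (fm x) \<le> B * exp (Im \<kappa> * x) \<and> cmod (fm' x) \<le> B * exp (Im \<kappa> * x)"
proof -
  obtain B1 where B1: "\<And>x. cmod (fp x) \<le> B1 * exp (- (Im \<kappa> * x))" "\<And>x. cmod (fp' x) \<le> B1 * exp (- (Im \<kappa> * x))"
    using jost_solution(3)[OF j] unfolding fp_def fp'_def by blast
  obtain B2 where B2: "\<And>x. cmod (jost_solution \<kappa> mr x) \<le> B2 * exp (- (Im \<kappa> * x))"
      "\<And>x. cmod (jost_solution' \<kappa> mr nr x) \<le> B2 * exp (- (Im \<kappa> * x))"
    using jost_solution(3)[OF jr] by blast
  have B2': "cmod (fm x) \<le> B2 * exp (Im \<kappa> * x)" "cmod (fm' x) \<le> B2 * exp (Im \<kappa> * x)" for x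
    using B2[of "- x"] by (simp_all add: fm_def fm'_def)
  have le: "B1 * exp r \<le> max B1 B2 * exp r" "B2 * exp r \<le> max B1 B2 * exp r" for r
    by (auto intro!: mult_right_mono)
  show ?thesis
    using B1 B2' le order_trans by (intro exI[of _ "max B1 B2"]) blast
qed

lemma wronskian: "fm x * fp' x - fm' x * fp x = W"
proof -
  have "has_ac_derivative (\<lambda>x. fm x * fp' x - fm' x * fp x)
     (\<lambda>x. (fm' x * fp' x + fm x * ((of_real (V x) - \<kappa>\<^sup>2) * fp x))
        - ((of_real (V x) - \<kappa>\<^sup>2) * fm x * fp x + fm' x * fp' x))"
    by (intro has_ac_derivative_diff has_ac_derivative_mult fm_ac fp_ac fm'_ac fp'_ac)
  then have "has_ac_derivative (\<lambda>x. fm x * fp' x - fm' x * fp x) (\<lambda>x. 0)"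
    by (simp add: algebra_simps)
  from has_ac_derivative_zero_const[OF this] show ?thesis by (simp add: W_def)
qed

lemma exp_cancel: "exp (\<i> * \<kappa> * of_real (- x)) * exp (\<i> * \<kappa> * of_real x) = 1"
  by (simp flip: exp_add)

text \<open>The exponentials of the two Jost solutions cancel at equal arguments. What remains are
  products of the bounded factors \<open>m\<close>, \<open>mr\<close>, \<open>n\<close>,
  \<open>nr\<close>, whose limits at both ends are known to exist.\<close>

lemma fm_times:
  "fm x * fp x = mr (- x) * m x"
  "fm' x * fp x = - ((\<i> * \<kappa> * mr (- x) + nr (- x)) * m x)"
  "fm x * fp' x = mr (- x) * (\<i> * \<kappa> * m x + n x)"
  "fm' x * fp' x = - ((\<i> * \<kappa> * mr (- x) + nr (- x)) * (\<i> * \<kappa> * m x + n x))"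
proof -
  have *: "(exp (\<i> * \<kappa> * of_real (- x)) * p) * (exp (\<i> * \<kappa> * of_real x) * q) = p * q" for p q
  proof -
    have "(exp (\<i> * \<kappa> * of_real (- x)) * p) * (exp (\<i> * \<kappa> * of_real x) * q)
        = (exp (\<i> * \<kappa> * of_real (- x)) * exp (\<i> * \<kappa> * of_real x)) * (p * q)"
      by (simp only: mult_ac)
    then show ?thesis by (simp only: exp_cancel mult_1)
  qed
  show "fm x * fp x = mr (- x) * m x"
    "fm' x * fp x = - ((\<i> * \<kappa> * mr (- x) + nr (- x)) * m x)"
    "fm x * fp' x = mr (- x) * (\<i> * \<kappa> * m x + n x)"
    "fm' x * fp' x = - ((\<i> * \<kappa> * mr (- x) + nr (- x)) * (\<i> * \<kappa> * m x + n x))"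
    unfolding fm_def fm'_def fp_def fp'_def jost_solution_def jost_solution'_def
    by (simp_all only: mult_minus_left *)
qed

lemma W_eq: "W = 2 * \<i> * \<kappa> * (m x * mr (- x)) + mr (- x) * n x + nr (- x) * m x"
  unfolding wronskian[of x, symmetric] fm_times by (simp add: algebra_simps)

text \<open>Limits of the constant \<open>W_eq\<close> at either end, where one of \<open>m\<close>,
  \<open>mr\<close> tends to 1 and the terms with \<open>n\<close>, \<open>nr\<close> vanish. Both
  statements identify the same number \<open>W / (2 * \<i> * \<kappa>)\<close>, the reciprocal of
  the transmission coefficient.\<close>

lemma transmission_limits:
  shows "\<exists>A. ((\<lambda>x. mr (- x)) \<longlongrightarrow> A) at_top \<and> W = 2 * \<i> * \<kappa> * A"
    and "\<exists>A. (m \<longlongrightarrow> A) at_bot \<and> W = 2 * \<i> * \<kappa> * A"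
proof -
  note lim = jost_factor_limits[OF V j] and limr = jost_factor_limits[OF Vr jr]
  have W_fun: "(\<lambda>x::real. W) = (\<lambda>x. 2 * \<i> * \<kappa> * (m x * mr (- x)) + mr (- x) * n x + nr (- x) * m x)"
    by (rule ext) (rule W_eq)
  have m1: "(m \<longlongrightarrow> 1) at_top" and mr1: "((\<lambda>x. mr (- x)) \<longlongrightarrow> 1) at_bot"
    using j jr by (auto simp: jost_factor_def tendsto_at_bot_reflect)
  have nr0: "((\<lambda>x. nr (- x)) \<longlongrightarrow> 0) at_bot" "((\<lambda>x. nr (- x)) \<longlongrightarrow> 0) at_top"
    using limr(1,2) by (auto simp: tendsto_at_bot_reflect)
  obtain A where A: "((\<lambda>x. mr (- x)) \<longlongrightarrow> A) at_top"
    using limr(3) by (auto simp: tendsto_at_bot_reflect)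
  have "((\<lambda>x::real. W) \<longlongrightarrow> 2 * \<i> * \<kappa> * (1 * A) + A * 0 + 0 * 1) at_top"
    unfolding W_fun by (intro tendsto_intros m1 A lim nr0)
  then have "W = 2 * \<i> * \<kappa> * A" by (simp add: tendsto_const_iff)
  with A show "\<exists>A. ((\<lambda>x. mr (- x)) \<longlongrightarrow> A) at_top \<and> W = 2 * \<i> * \<kappa> * A" by blast
  obtain B where B: "(m \<longlongrightarrow> B) at_bot" using lim(3) by blast
  have "((\<lambda>x::real. W) \<longlongrightarrow> 2 * \<i> * \<kappa> * (B * 1) + 1 * 0 + 0 * B) at_bot"
    unfolding W_fun by (intro tendsto_intros mr1 B lim nr0)
  then have "W = 2 * \<i> * \<kappa> * B" by (simp add: tendsto_const_iff)
  with B show "\<exists>A. (m \<longlongrightarrow> A) at_bot \<and> W = 2 * \<i> * \<kappa> * A" by blast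
qed

text \<open>If \<open>W = 0\<close>, then \<open>fm\<close> is a multiple of \<open>fp\<close> near \<open>\<infinity>\<close>, so it decays on both sides.\<close>

lemma W_nonzero:
  assumes "\<kappa>\<^sup>2 \<notin> spec V"
  shows "W \<noteq> 0"
proof
  assume "W = 0"
  define e where "e = Im \<kappa>"
  have e: "e > 0" using \<kappa> by (simp add: e_def)
  obtain B where B: "\<And>x. cmod (fp x) \<le> B * exp (- (e * x))" "\<And>x. cmod (fm x) \<le> B * exp (e * x)"
    using solution_bounds unfolding e_def by blast
  have B0: "B \<ge> 0" using order_trans[OF norm_ge_zero B(1)[of 0]] by simp
  have "(m \<longlongrightarrow> 1) at_top" "(mr \<longlongrightarrow> 1) at_top" using j jr by (auto simp: jost_factor_def)
  then have "\<forall>\<^sub>F x in at_top. m x \<noteq> 0" "\<forall>\<^sub>F x in at_top. mr x \<noteq> 0"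
    by (auto intro: tendsto_imp_eventually_ne)
  then obtain X1 X2 where X1: "\<And>x. x \<ge> X1 \<Longrightarrow> m x \<noteq> 0" and X2: "\<And>x. x \<ge> X2 \<Longrightarrow> mr x \<noteq> 0"
    by (auto simp: eventually_at_top_linorder)
  \<comment> \<open>Far to the left \<open>mr\<close> is close to 1, so \<open>fm\<close> is not the
    zero function, as is needed to place \<open>\<kappa>^2\<close> in the spectrum.\<close>
  have fm_nz: "fm (- X2) \<noteq> 0" using X2[of X2] by (simp add: fm_def jost_solution_def)
  define X where "X = max X1 0"
  have fp_nz: "fp x \<noteq> 0" if "x \<ge> X" for x
    using X1[of x] that by (simp add: fp_def jost_solution_def X_def)
  \<comment> \<open>The derivative of \<open>fm / fp\<close> is \<open>- W / fp^2\<close>, so the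
    quotient is constant wherever \<open>fp\<close> does not vanish.\<close>
  define q where "q x = fm x * inverse (fp x)" for x
  have q': "(q has_vector_derivative 0) (at x within {X..})" if "x \<in> {X..}" for x
  proof -
    have nz: "fp x \<noteq> 0" using fp_nz that by simp
    have "(inverse has_field_derivative - (inverse (fp x) ^ Suc (Suc 0))) (at (fp x))"
      using nz by (intro DERIV_inverse)
    from field_vector_diff_chain_at[OF fp_deriv this]
    have "((\<lambda>x. inverse (fp x)) has_vector_derivative fp' x * - (inverse (fp x) ^ Suc (Suc 0))) (at x)"
      by (simp add: o_def)
    from has_vector_derivative_mult[OF fm_deriv this]
    have "(q has_vector_derivative fm x * (fp' x * - (inverse (fp x) ^ Suc (Suc 0))) + fm' x * inverse (fp x)) (at x)"
      by (simp add: q_def[abs_def])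
    moreover have "fm x * (fp' x * - (inverse (fp x) ^ Suc (Suc 0))) + fm' x * inverse (fp x)
        = - ((fm x * fp' x - fm' x * fp x) * (inverse (fp x))\<^sup>2)"
      using nz by (simp add: field_simps power2_eq_square)
    ultimately have "(q has_vector_derivative - ((fm x * fp' x - fm' x * fp x) * (inverse (fp x))\<^sup>2)) (at x)"
      by (simp only:)
    then show ?thesis
      unfolding wronskian \<open>W = 0\<close> by (simp add: has_vector_derivative_at_within)
  qed
  obtain k where k: "\<And>x. x \<in> {X..} \<Longrightarrow> q x = k"
    using has_vector_derivative_zero_constant[of "{X..}" q] q' by auto
  \<comment> \<open>The second summand serves \<open>x \<ge> X\<close>, where
    \<open>fm = k * fp\<close>. The first serves \<open>x < X\<close>, where
    \<open>e * x \<le> 2 * e * X - e * \<bar>x\<bar>\<close>; this uses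
    \<open>X \<ge> 0\<close>.\<close>
  define D where "D = B * exp (2 * e * X) + cmod k * B"
  have fm_le: "cmod (fm x) \<le> D * exp (- (e * \<bar>x\<bar>))" for x
  proof (cases "x \<ge> X")
    case True
    have "fm x = k * fp x" using k[of x] fp_nz[OF True] True by (simp add: q_def field_simps)
    then have "cmod (fm x) \<le> cmod k * (B * exp (- (e * x)))"
      using B(1)[of x] by (simp add: norm_mult mult_left_mono)
    also have "\<dots> \<le> D * exp (- (e * x))"
      using B0 by (simp add: D_def algebra_simps)
    finally show ?thesis using True by (simp add: X_def)
  next
    case False
    have "e * x \<le> 2 * e * X + - (e * \<bar>x\<bar>)"
      using False e by (cases "x \<ge> 0") (auto simp: X_def)
    then have "exp (e * x) \<le> exp (2 * e * X) * exp (- (e * \<bar>x\<bar>))"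
      by (simp flip: exp_add)
    then have "B * exp (e * x) \<le> B * (exp (2 * e * X) * exp (- (e * \<bar>x\<bar>)))"
      using B0 by (rule mult_left_mono)
    also have "\<dots> \<le> D * exp (- (e * \<bar>x\<bar>))"
      using B0 by (simp add: D_def algebra_simps)
    finally show ?thesis using B(2)[of x] by simp
  qed
  have fm_cont: "fm \<in> borel_measurable lebesgue"
    by (intro continuous_imp_lebesgue_measurable has_ac_derivative_continuous_on[OF fm_ac])
  have "fm \<in> L2"
  proof (rule L2_I[OF fm_cont Bochner_Integration.integrable_bound])
    show "integrable lebesgue (\<lambda>x. D\<^sup>2 * exp (- (2 * e * \<bar>0 - x\<bar>)))"
      using integral_exp_minus_abs_lebesgue(1)[of "2 * e" 0] e by simp
    show "(\<lambda>x. (cmod (fm x))\<^sup>2) \<in> borel_measurable lebesgue"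
      using fm_cont by (intro borel_measurable_power cmod_measurable)
    have "(cmod (fm x))\<^sup>2 \<le> D\<^sup>2 * exp (- (2 * e * \<bar>0 - x\<bar>))" for x
    proof -
      have "(cmod (fm x))\<^sup>2 \<le> (D * exp (- (e * \<bar>x\<bar>)))\<^sup>2"
        by (intro power_mono fm_le) auto
      also have "(exp (- (e * \<bar>x\<bar>)))\<^sup>2 = exp (- (2 * e * \<bar>0 - x\<bar>))"
        by (simp add: power2_eq_square flip: exp_add)
      then have "(D * exp (- (e * \<bar>x\<bar>)))\<^sup>2 = D\<^sup>2 * exp (- (2 * e * \<bar>0 - x\<bar>))"
        by (simp add: power_mult_distrib)
      finally show ?thesis .
    qed
    then show "AE x in lebesgue. norm ((cmod (fm x))\<^sup>2) \<le> norm (D\<^sup>2 * exp (- (2 * e * \<bar>0 - x\<bar>)))"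
      by simp
  qed
  moreover have "has_ac_derivative fm' (\<lambda>x. of_real (V x) * fm x - \<kappa>\<^sup>2 * fm x)"
    using fm'_ac by (simp add: left_diff_distrib)
  ultimately have "(fm, \<lambda>x. \<kappa>\<^sup>2 * fm x) \<in> schroedinger V"
    using L2_mult fm_deriv unfolding schroedinger_def by blast
  from homogeneous_solution_in_spec[where f = fm and z = "\<kappa>\<^sup>2", OF this fm_nz] assms show False by blast
qed

text \<open>
  With \<open>F = L f\<close> one has \<open>(Fm fp)' = (\<kappa>\<^sup>2 + a\<^sup>2) fm fp - Fm Fp\<close>, which is a multiple of the
  difference of the two Green functions on the diagonal.
\<close>

lemma green_difference:
  fixes a sp sm :: real and w w' :: "real \<Rightarrow> real"
  assumes spec: "\<kappa>\<^sup>2 \<notin> spec V" "\<kappa>\<^sup>2 \<notin> spec (\<lambda>x. V x - 2 * w' x)"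
    and \<alpha>: "\<kappa>\<^sup>2 + (of_real a)\<^sup>2 \<noteq> 0"
    and w: "has_ac_derivative w w'" and riccati: "AE x in lebesgue. w' x = V x + a\<^sup>2 - (w x)\<^sup>2"
    and sp: "(w \<longlongrightarrow> sp) at_top" and sm: "(w \<longlongrightarrow> sm) at_bot"
    and w_int: "integrable lebesgue (\<lambda>x. a\<^sup>2 - (w x)\<^sup>2)"
  defines "D \<equiv> \<lambda>x. green V x x (\<kappa>\<^sup>2) - green (\<lambda>x. V x - 2 * w' x) x x (\<kappa>\<^sup>2)"
  shows "integrable lebesgue D"
    and "(LINT x|lebesgue. D x) = - (of_real (sp - sm) / (2 * \<i> * \<kappa> * (\<kappa>\<^sup>2 + (of_real a)\<^sup>2)))"
proof -
  define \<epsilon> where "\<epsilon> = \<kappa>\<^sup>2 + (of_real a)\<^sup>2"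
  have \<epsilon>: "\<epsilon> \<noteq> 0" using \<alpha> by (simp add: \<epsilon>_def)
  have W: "W \<noteq> 0" by (rule W_nonzero[OF spec(1)])
  have \<kappa>0: "\<kappa> \<noteq> 0" using \<kappa> by auto
  define Fp Fp' Fm Fm' where
    "Fp = (\<lambda>x. of_real (w x) * fp x - fp' x)" and "Fp' = (\<lambda>x. \<epsilon> * fp x - of_real (w x) * Fp x)" and
    "Fm = (\<lambda>x. of_real (w x) * fm x - fm' x)" and "Fm' = (\<lambda>x. \<epsilon> * fm x - of_real (w x) * Fm x)"
  have Fp: "(Fp has_vector_derivative Fp' x) (at x)"
      "has_ac_derivative Fp' (\<lambda>x. (of_real (V x - 2 * w' x) - \<kappa>\<^sup>2) * Fp x)" for x
    unfolding Fp_def Fp'_def \<epsilon>_def by (rule susy_transformed_solution[OF fp_deriv fp'_ac w riccati])+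
  have Fm: "(Fm has_vector_derivative Fm' x) (at x)"
      "has_ac_derivative Fm' (\<lambda>x. (of_real (V x - 2 * w' x) - \<kappa>\<^sup>2) * Fm x)" for x
    unfolding Fm_def Fm'_def \<epsilon>_def by (rule susy_transformed_solution[OF fm_deriv fm'_ac w riccati])+
  have w_cont: "continuous_on S w" for S by (rule has_ac_derivative_continuous_on[OF w])
  have w_bd: "bounded (range w)" by (rule bounded_range_of_limits[OF w_cont sp sm])
  then obtain M where M: "\<And>x. \<bar>w x\<bar> \<le> M" by (auto simp: bounded_iff)
  obtain B where B: "\<And>x. cmod (fp x) \<le> B * exp (- (Im \<kappa> * x))" "\<And>x. cmod (fp' x) \<le> B * exp (- (Im \<kappa> * x))"
      "\<And>x. cmod (fm x) \<le> B * exp (Im \<kappa> * x)" "\<And>x. cmod (fm' x) \<le> B * exp (Im \<kappa> * x)"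
    using solution_bounds by blast
  have F_le: "cmod (of_real (w x) * p - q) \<le> (M * B + B) * r"
    if "cmod p \<le> B * r" "cmod q \<le> B * r" for x p q r
  proof -
    have "cmod (of_real (w x) * p - q) \<le> \<bar>w x\<bar> * cmod p + cmod q"
      using norm_triangle_ineq4[of "of_real (w x) * p" q] by (simp add: norm_mult)
    also have "\<dots> \<le> M * (B * r) + B * r"
      using M[of x] that order_trans[OF abs_ge_zero M[of x]] by (intro add_mono mult_mono) auto
    finally show ?thesis by (simp add: algebra_simps)
  qed
  interpret G0: decaying_solutions V "\<kappa>\<^sup>2" W fp fp' fm fm' B "Im \<kappa>"
    by unfold_locales (use \<kappa> W B wronskian fp_deriv fp'_ac fm_deriv fm'_ac in auto)
  have W1: "Fm x * Fp' x - Fm' x * Fp x = \<epsilon> * W" for x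
  proof -
    have "Fm x * Fp' x - Fm' x * Fp x = \<epsilon> * (fm x * fp' x - fm' x * fp x)"
      by (simp add: Fp_def Fp'_def Fm_def Fm'_def algebra_simps)
    then show ?thesis by (simp add: wronskian)
  qed
  \<comment> \<open>The factor \<open>w\<close> is bounded because it is continuous with limits at
    both ends, so \<open>Fp\<close> and \<open>Fm\<close> inherit the exponential rate
    \<open>Im \<kappa>\<close>.\<close>
  interpret G1: decaying_solutions "\<lambda>x. V x - 2 * w' x" "\<kappa>\<^sup>2" "\<epsilon> * W" Fp Fp' Fm Fm' "M * B + B" "Im \<kappa>"
  proof unfold_locales
    show "cmod (Fp x) \<le> (M * B + B) * exp (- (Im \<kappa> * x))" for x
      unfolding Fp_def by (intro F_le B)
    show "cmod (Fm x) \<le> (M * B + B) * exp (Im \<kappa> * x)" for x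
      unfolding Fm_def by (intro F_le B)
  qed (use \<kappa> W \<epsilon> W1 Fp Fm in auto)
  \<comment> \<open>The two kernels have the denominators \<open>W\<close> and
    \<open>\<epsilon> * W\<close>; over the common one, \<open>h\<close> is the numerator up to
    sign, and it is the derivative of \<open>H\<close> below.\<close>
  define h where "h x = \<epsilon> * (fm x * fp x) - Fm x * Fp x" for x
  have D_eq: "D = (\<lambda>x. - (1 / (\<epsilon> * W)) * h x)"
    using W \<epsilon> unfolding D_def G0.green_eq[OF spec(1)] G1.green_eq[OF spec(2)] G0.G_def G1.G_def
    by (auto simp: h_def field_simps)
  define H where "H x = Fm x * fp x" for x
  have Fm_ac: "has_ac_derivative Fm Fm'"
    using Fm(1) has_ac_derivative_continuous[OF Fm(2)] by (rule has_ac_derivative_of_vector_derivative)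
  have "has_ac_derivative H (\<lambda>x. Fm' x * fp x + Fm x * fp' x)"
    unfolding H_def by (intro has_ac_derivative_mult Fm_ac fp_ac)
  also have "(\<lambda>x. Fm' x * fp x + Fm x * fp' x) = h"
    by (simp add: h_def[abs_def] Fm'_def Fp_def algebra_simps)
  finally have H_ac: "has_ac_derivative H h" .
  note lim = jost_factor_limits[OF V j] and limr = jost_factor_limits[OF Vr jr]
  have props: "integrable lebesgue n" "bounded (range m)" "bounded (range n)" "(m \<longlongrightarrow> 1) at_top"
      "integrable lebesgue (\<lambda>x. nr (- x))" "bounded (range (\<lambda>x. mr (- x)))" "((\<lambda>x. mr (- x)) \<longlongrightarrow> 1) at_bot"
    using j jr integrable_lebesgue_reflect(1)[of nr] bounded_range_reflect[of mr]
    by (auto simp: jost_factor_def tendsto_at_bot_reflect)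
  have nr_lim: "((\<lambda>x. nr (- x)) \<longlongrightarrow> 0) at_top" "((\<lambda>x. nr (- x)) \<longlongrightarrow> 0) at_bot"
    using limr(1,2) by (auto simp: tendsto_at_bot_reflect)
  have cont: "continuous_on UNIV m" "continuous_on UNIV n" "continuous_on UNIV (\<lambda>x. mr (- x))"
  proof -
    show "continuous_on UNIV m" "continuous_on UNIV n"
      using jost_factor_continuous[OF j] continuous_at_imp_continuous_on by blast+
    have "continuous_on UNIV mr"
      using jost_factor_continuous[OF jr] continuous_at_imp_continuous_on by blast
    then show "continuous_on UNIV (\<lambda>x. mr (- x))"
      by (rule continuous_on_compose2) (auto intro: continuous_intros)
  qed
  have wc_bd: "bounded (range (\<lambda>x. complex_of_real (w x)))"
    using w_bd by (auto simp: bounded_iff)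
  have wc_cont: "continuous_on UNIV (\<lambda>x. complex_of_real (w x))"
    by (intro continuous_intros w_cont)
  have const_bd: "bounded (range (\<lambda>x::real. \<i> * \<kappa>))" by simp
  \<comment> \<open>Each summand is a bounded continuous function times one of the integrable
    functions \<open>a^2 - w^2\<close>, \<open>n\<close> and the reflected \<open>nr\<close>. The
    coefficient of \<open>m x * mr (- x)\<close> is
    \<open>\<epsilon> - w^2 + (\<i> * \<kappa>)^2\<close>, in which \<open>\<kappa>^2\<close>
    cancels.\<close>
  have h_eq: "h = (\<lambda>x. (m x * mr (- x)) * of_real (a\<^sup>2 - (w x)\<^sup>2)
      + (of_real (w x) + \<i> * \<kappa>) * mr (- x) * n x
      + ((\<i> * \<kappa> - of_real (w x)) * m x + n x) * nr (- x))"
  proof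
    fix x
    have "h x = (\<epsilon> - (of_real (w x))\<^sup>2) * (fm x * fp x) + of_real (w x) * (fm x * fp' x)
        + of_real (w x) * (fm' x * fp x) - fm' x * fp' x"
      by (simp add: h_def Fm_def Fp_def algebra_simps power2_eq_square)
    then show "h x = (m x * mr (- x)) * of_real (a\<^sup>2 - (w x)\<^sup>2)
      + (of_real (w x) + \<i> * \<kappa>) * mr (- x) * n x
      + ((\<i> * \<kappa> - of_real (w x)) * m x + n x) * nr (- x)"
      unfolding fm_times \<epsilon>_def by (simp add: algebra_simps power2_eq_square)
  qed
  have "integrable lebesgue (\<lambda>x. (m x * mr (- x)) * complex_of_real (a\<^sup>2 - (w x)\<^sup>2))"
    by (intro integrable_bounded_continuous_mult continuous_intros cont bounded_range_mult props
        integrable_of_real[OF w_int])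
  moreover have "integrable lebesgue (\<lambda>x. (of_real (w x) + \<i> * \<kappa>) * mr (- x) * n x)"
    by (intro integrable_bounded_continuous_mult continuous_on_mult continuous_on_add continuous_on_const
        cont wc_cont bounded_range_mult bounded_plus_comp wc_bd const_bd props)
  moreover have "integrable lebesgue (\<lambda>x. ((\<i> * \<kappa> - of_real (w x)) * m x + n x) * nr (- x))"
    by (intro integrable_bounded_continuous_mult continuous_on_mult continuous_on_add continuous_on_diff
        continuous_on_const cont wc_cont bounded_range_mult bounded_plus_comp bounded_minus_comp wc_bd const_bd props)
  ultimately have h_int: "integrable lebesgue h"
    unfolding h_eq by (intro Bochner_Integration.integrable_add)
  then show "integrable lebesgue D"
    unfolding D_eq by simp
  have H_eq: "H x = ((of_real (w x) + \<i> * \<kappa>) * mr (- x) + nr (- x)) * m x" for x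
  proof -
    have "H x = of_real (w x) * (fm x * fp x) - fm' x * fp x"
      by (simp add: H_def Fm_def algebra_simps)
    then show ?thesis unfolding fm_times by (simp add: algebra_simps)
  qed
  \<comment> \<open>At each end one of the two factors in \<open>H\<close> tends to 1 and the other
    to the constant determined by \<open>W\<close>, so the limits of \<open>H\<close> differ only in
    the limit of \<open>w\<close>.\<close>
  obtain A where A: "((\<lambda>x. mr (- x)) \<longlongrightarrow> A) at_top" "W = 2 * \<i> * \<kappa> * A"
    using transmission_limits(1) by blast
  obtain A' where A': "(m \<longlongrightarrow> A') at_bot" "W = 2 * \<i> * \<kappa> * A'"
    using transmission_limits(2) by blast
  have "A' = A" using A(2) A'(2) \<kappa>0 by simp
  have "(H \<longlongrightarrow> ((of_real sp + \<i> * \<kappa>) * A + 0) * 1) at_top"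
    unfolding H_eq[abs_def] by (intro tendsto_intros sp A nr_lim props)
  moreover have "(H \<longlongrightarrow> ((of_real sm + \<i> * \<kappa>) * 1 + 0) * A') at_bot"
    unfolding H_eq[abs_def] by (intro tendsto_intros sm A' nr_lim props)
  ultimately have "(LINT x|lebesgue. h x) = ((of_real sp + \<i> * \<kappa>) * A + 0) * 1 - ((of_real sm + \<i> * \<kappa>) * 1 + 0) * A'"
    by (rule integral_ac_derivative[OF H_ac h_int])
  then have h_val: "(LINT x|lebesgue. h x) = of_real (sp - sm) * A"
    by (simp add: \<open>A' = A\<close> algebra_simps)
  have "(LINT x|lebesgue. D x) = - (1 / (\<epsilon> * W)) * (LINT x|lebesgue. h x)"
    unfolding D_eq by (rule integral_mult_right_zero)
  also have "\<dots> = - (of_real (sp - sm) / (2 * \<i> * \<kappa> * \<epsilon>))"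
    using W \<epsilon> \<kappa>0 unfolding h_val A(2) by (simp add: field_simps)
  finally show "(LINT x|lebesgue. D x) = - (of_real (sp - sm) / (2 * \<i> * \<kappa> * (\<kappa>\<^sup>2 + (of_real a)\<^sup>2)))"
    by (simp add: \<epsilon>_def)
qed

end


section \<open>The three types of transformation\<close>

theorem corollary2:
  fixes V0 V1 u :: "real \<Rightarrow> real" and a :: real and E \<kappa> \<delta> :: complex
  assumes "V0 \<in> borel_measurable lebesgue"
    and "integrable lebesgue (\<lambda>x. (1 + \<bar>x\<bar>) * \<bar>V0 x\<bar>)"
    and "a > 0"
    and "susy_partner V0 (- (a\<^sup>2)) u V1"
    and "deletes_ground_state V0 (- (a\<^sup>2)) u V1 \<and> \<delta> = 1 \<or>
         creates_ground_state V0 (- (a\<^sup>2)) u V1 \<and> \<delta> = - 1 \<or>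
         isospectral V0 (- (a\<^sup>2)) V1 \<and> \<delta> = 0"
    and "E = \<kappa>\<^sup>2" and "Im \<kappa> > 0"
    and "E \<notin> spec V0" and "E \<noteq> of_real (- (a\<^sup>2))"
  shows "integrable lebesgue (\<lambda>x. green V0 x x E - green V1 x x E) \<and>
         (LINT x|lebesgue. green V0 x x E - green V1 x x E) =
           \<delta> / (\<kappa>\<^sup>2 + \<i> * of_real a * \<kappa>) - \<delta> / (\<kappa>\<^sup>2 + of_real (a\<^sup>2))"
proof -
  note a = \<open>a > 0\<close> and \<kappa> = \<open>Im \<kappa> > 0\<close> and types = assms(5)
  have V0: "integrable lebesgue V0"
  proof (rule Bochner_Integration.integrable_bound[OF assms(2) assms(1)])
    show "AE x in lebesgue. norm (V0 x) \<le> norm ((1 + \<bar>x\<bar>) * \<bar>V0 x\<bar>)"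
      by (simp add: abs_mult mult_le_cancel_right1)
  qed
  define w where "w = superpotential u"
  obtain w' where w_ac: "has_ac_derivative w w'" and V1: "V1 = (\<lambda>x. V0 x - 2 * w' x)"
    using assms(4) unfolding susy_partner_def w_def by blast
  have u: "(u has_real_derivative deriv u x) (at x)" for x
    using assms(4) DERIV_deriv_iff_real_differentiable unfolding susy_partner_def by blast
  have nz: "u x \<noteq> 0" for x using assms(4) unfolding susy_partner_def by blast
  have u': "has_ac_derivative (deriv u) (\<lambda>x. (V0 x + a\<^sup>2) * u x)"
    using assms(4) unfolding susy_partner_def by (simp add: algebra_simps)
  have w_eq: "w = (\<lambda>x. deriv u x / u x)" by (simp add: w_def superpotential_def fun_eq_iff)
  have u_ac: "has_ac_derivative u (deriv u)"
    using u has_ac_derivative_continuous[OF u']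
    by (intro has_ac_derivative_of_vector_derivative) (auto simp: has_real_derivative_iff_has_vector_derivative)
  have u_cont: "continuous_on UNIV u" by (rule has_ac_derivative_continuous_on[OF u_ac])
  have w_cont: "isCont w x" for x by (rule has_ac_derivative_continuous[OF w_ac])
  \<comment> \<open>Differentiating \<open>w * u = u'\<close> by the product rule gives a second
    almost-everywhere derivative of \<open>u'\<close>; comparing it with the one in the equation of
    \<open>u\<close> and dividing by \<open>u\<close> yields the Riccati equation for whichever
    representative \<open>w'\<close> was chosen.\<close>
  have riccati: "AE x in lebesgue. w' x = V0 x + a\<^sup>2 - (w x)\<^sup>2"
  proof -
    have "has_ac_derivative (\<lambda>x. w x * u x) (\<lambda>x. w' x * u x + w x * deriv u x)"
      by (rule has_ac_derivative_mult[OF w_ac u_ac])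
    also have "(\<lambda>x. w x * u x) = deriv u" using nz by (simp add: w_eq fun_eq_iff)
    finally have "AE x in lebesgue. w' x * u x + w x * deriv u x = (V0 x + a\<^sup>2) * u x"
      by (rule has_ac_derivative_unique_AE[OF _ u'])
    then show ?thesis
    proof eventually_elim
      case (elim x)
      have "w x * deriv u x = (w x)\<^sup>2 * u x" using nz[of x] by (simp add: w_eq power2_eq_square)
      with elim have "(w' x + (w x)\<^sup>2) * u x = (V0 x + a\<^sup>2) * u x" by (simp add: distrib_right)
      then show ?case using nz[of x] by simp
    qed
  qed
  obtain sp where sp: "\<bar>sp\<bar> = a" "(w \<longlongrightarrow> sp) at_top" "(\<lambda>x. a\<^sup>2 - (w x)\<^sup>2) absolutely_integrable_on {0..}"
    using superpotential_asymptotics[OF V0 a u u' nz, of 0] unfolding w_eq by blast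
  have ur': "has_ac_derivative (\<lambda>x. - deriv u (- x)) (\<lambda>x. (V0 (- x) + a\<^sup>2) * u (- x))"
    using has_ac_derivative_minus[OF has_ac_derivative_reflect[OF u']] by simp
  have V0r: "integrable lebesgue (\<lambda>x. V0 (- x))" using V0 integrable_lebesgue_reflect(1) by blast
  have nzr: "u (- x) \<noteq> 0" for x using nz by blast
  \<comment> \<open>The left end is the right end for \<open>u (- x)\<close>, whose logarithmic
    derivative is \<open>- w (- x)\<close>; this accounts for \<open>sm = - s\<close>.\<close>
  obtain s where s: "\<bar>s\<bar> = a" "((\<lambda>x. - deriv u (- x) / u (- x)) \<longlongrightarrow> s) at_top"
      "(\<lambda>x. a\<^sup>2 - (- deriv u (- x) / u (- x))\<^sup>2) absolutely_integrable_on {0..}"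
    using superpotential_asymptotics[OF V0r a has_real_derivative_reflect[OF u] ur' nzr, of 0] by blast
  define sm where "sm = - s"
  have "((\<lambda>x. - (- deriv u (- x) / u (- x))) \<longlongrightarrow> sm) at_top"
    unfolding sm_def by (intro tendsto_minus s(2))
  then have sm: "\<bar>sm\<bar> = a" "(w \<longlongrightarrow> sm) at_bot"
    using s(1) by (simp_all add: sm_def w_eq tendsto_at_bot_reflect)
  have w_int: "integrable lebesgue (\<lambda>x. a\<^sup>2 - (w x)\<^sup>2)"
    using sp(3) s(3) by (intro integrable_of_halves) (simp_all add: w_eq)
  have \<alpha>: "\<kappa>\<^sup>2 + (of_real a)\<^sup>2 \<noteq> 0"
    using assms(6,9) by (simp add: add_eq_0_iff2)
  \<comment> \<open>The partner can gain only the point \<open>\<alpha> = - a^2\<close>, in the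
    second type, and \<open>E\<close> differs from it.\<close>
  have spec: "\<kappa>\<^sup>2 \<notin> spec V0" "\<kappa>\<^sup>2 \<notin> spec (\<lambda>x. V0 x - 2 * w' x)"
    using types assms(6,8,9)
    unfolding deletes_ground_state_def creates_ground_state_def isospectral_def V1 by auto
  obtain m n where j: "jost_factor V0 \<kappa> m n" using jost_factor_exists[OF V0 \<kappa>] by blast
  obtain mr nr where jr: "jost_factor (\<lambda>x. V0 (- x)) \<kappa> mr nr" using jost_factor_exists[OF V0r \<kappa>] by blast
  interpret jost_pair V0 \<kappa> m n mr nr
    by unfold_locales (rule V0 \<kappa> j jr)+
  note diff = green_difference[OF spec \<alpha> w_ac riccati sp(2) sm(2) w_int, folded V1 assms(6)]
  define v where "v x = 1 / u x" for x
  have v: "(v has_real_derivative - (w x * v x)) (at x)" for x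
    unfolding v_def w_eq using nz by (auto intro!: derivative_eq_intros u simp: field_simps)
  have v_nz: "v x \<noteq> 0" for x using nz by (simp add: v_def)
  have v_log: "- (w x * v x) / v x = - w x" for x using v_nz by simp
  have v_lim: "((\<lambda>x. - (w x * v x) / v x) \<longlongrightarrow> - sp) at_top" "((\<lambda>x. - (w x * v x) / v x) \<longlongrightarrow> - sm) at_bot"
    unfolding v_log by (intro tendsto_minus sp sm)+
  have u_lim: "((\<lambda>x. deriv u x / u x) \<longlongrightarrow> sp) at_top" "((\<lambda>x. deriv u x / u x) \<longlongrightarrow> sm) at_bot"
    using sp(2) sm(2) by (simp_all add: w_eq)
  have reflect_lim: "((\<lambda>x. - f' (- x) / f (- x)) \<longlongrightarrow> - l) at_top" if "((\<lambda>x. f' x / f x) \<longlongrightarrow> l) at_bot"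
    for f f' :: "real \<Rightarrow> real" and l
    using tendsto_minus[OF that[unfolded tendsto_at_bot_reflect]] by simp
  \<comment> \<open>Square integrability excludes a positive limit of the logarithmic derivative at
    the right end and a negative one at the left end. As both limits have modulus \<open>a\<close>,
    their signs are determined.\<close>
  have L2_signs: "p = - a \<and> q = a"
    if L2: "integrable lebesgue (\<lambda>x. (f x)\<^sup>2)" and f: "\<And>x. (f has_real_derivative f' x) (at x)"
      and f_nz: "\<And>x. f x \<noteq> 0" and lims: "((\<lambda>x. f' x / f x) \<longlongrightarrow> p) at_top" "((\<lambda>x. f' x / f x) \<longlongrightarrow> q) at_bot"
      and pq: "\<bar>p\<bar> = a" "\<bar>q\<bar> = a" for f f' :: "real \<Rightarrow> real" and p q
  proof -
    have "\<not> p > 0" using not_square_integrable_of_log_derivative[OF f f_nz lims(1)] L2 by blast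
    moreover have "integrable lebesgue (\<lambda>x. (f (- x))\<^sup>2)"
      using L2 integrable_lebesgue_reflect(1)[of "\<lambda>x. (f x)\<^sup>2"] by blast
    then have "\<not> - q > 0"
      using not_square_integrable_of_log_derivative[OF has_real_derivative_reflect[OF f] _ reflect_lim[OF lims(2)]] f_nz
      by blast
    ultimately show ?thesis using pq by linarith
  qed
  have jump: "of_real (sp - sm) = - 2 * \<delta> * of_real a"
    using types
  proof (elim disjE conjE)
    assume "deletes_ground_state V0 (- (a\<^sup>2)) u V1" "\<delta> = 1"
    then have "(\<lambda>x. complex_of_real (u x)) \<in> L2"
      unfolding deletes_ground_state_def eigenfunction_def schroedinger_def by blast
    then have "integrable lebesgue (\<lambda>x. (u x)\<^sup>2)" by (auto dest: L2_D(2))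
    from L2_signs[OF this u nz u_lim sp(1) sm(1)] \<open>\<delta> = 1\<close> show ?thesis by simp
  next
    assume "creates_ground_state V0 (- (a\<^sup>2)) u V1" "\<delta> = - 1"
    then have "(\<lambda>x. complex_of_real (v x)) \<in> L2"
      unfolding creates_ground_state_def eigenfunction_def schroedinger_def v_def by blast
    then have "integrable lebesgue (\<lambda>x. (v x)\<^sup>2)" by (auto dest: L2_D(2))
    from L2_signs[OF this v v_nz v_lim] sp(1) sm(1) \<open>\<delta> = - 1\<close> show ?thesis by auto
  next
    assume iso: "isospectral V0 (- (a\<^sup>2)) V1" "\<delta> = 0"
    then have not_spec: "complex_of_real (- (a\<^sup>2)) \<notin> spec V0" "complex_of_real (- (a\<^sup>2)) \<notin> spec V1"
      unfolding isospectral_def below_spec_def by auto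
    \<comment> \<open>With these signs \<open>u\<close> would decay at both ends and make
      \<open>\<alpha>\<close> an eigenvalue of the original operator; the opposite signs would do
      the same with \<open>1 / u\<close> for the partner. Both are ruled out by the spectra, so the
      two limits agree.\<close>
    have "\<not> (sp = - a \<and> sm = a)"
    proof
      assume "sp = - a \<and> sm = a"
      then have "integrable lebesgue (\<lambda>x. (u x)\<^sup>2)"
        using u_lim by (intro square_integrable_of_log_derivative[OF u nz a]) auto
      then have "((\<lambda>x. of_real (u x)), \<lambda>x. of_real (- (a\<^sup>2)) * of_real (u x)) \<in> schroedinger V0"
        using u' by (intro schroedinger_of_real[OF u]) auto
      from homogeneous_solution_in_spec[where f = "\<lambda>x. of_real (u x)", OF this, of 0] not_spec(1) nz
      show False by simp
    qed
    moreover have "\<not> (sp = a \<and> sm = - a)"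
    proof
      assume "sp = a \<and> sm = - a"
      then have "integrable lebesgue (\<lambda>x. (v x)\<^sup>2)"
        using v_lim by (intro square_integrable_of_log_derivative[OF v v_nz a]) auto
      \<comment> \<open>From \<open>v' = - w * v\<close> follows
        \<open>v'' = (w^2 - w') * v\<close>, and by the Riccati equation \<open>w^2 - w'\<close>
        equals \<open>V1 + a^2\<close> almost everywhere.\<close>
      moreover have "has_ac_derivative (\<lambda>x. - (w x * v x)) (\<lambda>x. (V1 x - - (a\<^sup>2)) * v x)"
      proof (rule has_ac_derivative_AE)
        have "isCont v x" for x using v DERIV_isCont by blast
        then have v_ac: "has_ac_derivative v (\<lambda>x. - (w x * v x))"
          using v w_cont
          by (intro has_ac_derivative_of_vector_derivative)
             (auto simp: has_real_derivative_iff_has_vector_derivative intro!: continuous_intros)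
        show "has_ac_derivative (\<lambda>x. - (w x * v x)) (\<lambda>x. - (w' x * v x + w x * - (w x * v x)))"
          by (intro has_ac_derivative_minus has_ac_derivative_mult w_ac v_ac)
        show "AE x in lebesgue. - (w' x * v x + w x * - (w x * v x)) = (V1 x - - (a\<^sup>2)) * v x"
          using riccati
        proof eventually_elim
          case (elim x)
          show ?case unfolding V1 elim by (simp add: algebra_simps power2_eq_square)
        qed
      qed
      ultimately have "((\<lambda>x. of_real (v x)), \<lambda>x. of_real (- (a\<^sup>2)) * of_real (v x)) \<in> schroedinger V1"
        by (intro schroedinger_of_real[OF v])
      from homogeneous_solution_in_spec[where f = "\<lambda>x. of_real (v x)", OF this, of 0] not_spec(2) v_nz
      show False by simp
    qed
    ultimately have "sp = sm" using sp(1) sm(1) a by (auto simp: abs_if split: if_splits)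
    then show ?thesis using iso(2) by simp
  qed
  have \<kappa>0: "\<kappa> \<noteq> 0" using \<kappa> by auto
  have factor: "\<kappa>\<^sup>2 + (of_real a)\<^sup>2 = (\<kappa> + \<i> * of_real a) * (\<kappa> - \<i> * of_real a)"
    by (simp add: algebra_simps power2_eq_square)
  then have pq: "\<kappa> + \<i> * of_real a \<noteq> 0" "\<kappa> - \<i> * of_real a \<noteq> 0" using \<alpha> by auto
  have "- (of_real (sp - sm) / (2 * \<i> * \<kappa> * (\<kappa>\<^sup>2 + (of_real a)\<^sup>2)))
      = \<delta> * (of_real a / (\<i> * \<kappa> * (\<kappa>\<^sup>2 + (of_real a)\<^sup>2)))"
  proof -
    have "- (- 2 * \<delta> * of_real a / (2 * \<i> * \<kappa> * e)) = \<delta> * (of_real a / (\<i> * \<kappa> * e))" if "e \<noteq> 0" for e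
      using that \<kappa>0 by (simp add: field_simps)
    from this[OF \<alpha>] show ?thesis unfolding jump .
  qed
  also have "of_real a / (\<i> * \<kappa> * (\<kappa>\<^sup>2 + (of_real a)\<^sup>2)) = - (\<i> * of_real a) / (\<kappa> * (\<kappa>\<^sup>2 + (of_real a)\<^sup>2))"
    by (simp add: divide_inverse)
  \<comment> \<open>Partial fractions: over the common denominator the numerator is
    \<open>(\<kappa> - \<i> * a) - \<kappa>\<close>.\<close>
  also have "\<dots> = 1 / (\<kappa> * (\<kappa> + \<i> * of_real a)) - 1 / (\<kappa>\<^sup>2 + (of_real a)\<^sup>2)"
    unfolding factor using \<kappa>0 pq by (simp add: divide_simps)
  also have "\<kappa> * (\<kappa> + \<i> * of_real a) = \<kappa>\<^sup>2 + \<i> * of_real a * \<kappa>"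
    by (simp add: algebra_simps power2_eq_square)
  finally have "- (of_real (sp - sm) / (2 * \<i> * \<kappa> * (\<kappa>\<^sup>2 + (of_real a)\<^sup>2)))
      = \<delta> / (\<kappa>\<^sup>2 + \<i> * of_real a * \<kappa>) - \<delta> / (\<kappa>\<^sup>2 + of_real (a\<^sup>2))"
    by (simp add: right_diff_distrib)
  with diff show ?thesis unfolding assms(6) by simp
qed

end
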